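(* Let $\gamma,\xi\in[0,1)$, let $f\in C\big([0,\infty)\times E_\xi,E_\gamma\big)$, and assume that for each $T>0$ there exists a constant $C(T)>0$ with $$\|f(t,u)\|_\gamma\le C(T)\,(1+\|u\|_\xi),\qquad t\in[0,T],\quad u\in E_\xi.$$ Consider the Cauchy problem $$u'=Au+f(t,u),\quad t>0,\qquad u(0)=u^0. \qquad (\mathrm{P})$$ (a) Let $\gamma>0$. Then (P) has a global strong solution $$u\in C^1\big((0,\infty),E_0\big)\cap C\big((0,\infty),E_1\big)\cap C\big([0,\infty),E_\alpha\big)$$ provided either $u^0\in E_\alpha$ with $\alpha\in[\xi,1)$, or $f$ satisfies condition (H) (defined in the context) for some $T_0>0$ and $u^0\in E_\alpha$ with $\alpha\in[0,\min\{1,1+\gamma-\xi\})$. (b) Let $\gamma=0$ and suppose there is $\vartheta_0\in(0,1)$ and for all $T,R>0$ there is $K=K(T,R)>0$ such that $$\|f(t,u)-f(s,v)\|_0\le K\big(|t-s|^{\vartheta_0}+\|u-v\|_\xi^{\vartheta_0}\big),\qquad t,s\in[0,T],\quad u,v\in\bar{\mathbb{B}}_{E_\xi}(0,R).$$ Then (P) has a global strong solution $$u\in C^1\big((0,\infty),E_0\big)\cap C\big((0,\infty),E_1\big)\cap C\big([0,\infty),E_\alpha\big)$$ provided either $u^0\in E_\alpha$ with $\alpha\in[\xi,1)$, or $f$ satisfies conditions (H) and (H') (defined in the context) for some $T_0>0$ and $u^0\in E_\alpha$ with $\alpha\in[0,1-\xi)$.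
   Context: $E_0$ and $E_1$ are Banach spaces over $\mathbb{K}\in\{\mathbb{R},\mathbb{C}\}$ such that $E_1$ is continuously, densely and compactly embedded in $E_0$. For each $\theta\in(0,1)$, $(\cdot,\cdot)_\theta$ is an arbitrary admissible interpolation functor of exponent $\theta$ (admissible meaning that $E_1$ is dense in $(E_0,E_1)_\theta$ whenever $E_1$ is densely embedded in $E_0$), and $E_\theta:=(E_0,E_1)_\theta$ is the corresponding interpolation space with norm $\|\cdot\|_\theta$; $\|\cdot\|_0$ is the norm of $E_0$. Then for $0<\vartheta<\theta<1$ the embeddings $E_1\hookrightarrow E_\theta\hookrightarrow E_\vartheta\hookrightarrow E_0$ are all dense and compact. $A:E_1\to E_0$ is the infinitesimal generator (with domain $E_1$) of a strongly continuous analytic semigroup $\{e^{tA}:t\ge0\}\subset\mathcal{L}(E_0)$. $\bar{\mathbb{B}}_X(0,R)$ denotes the closed ball in $X$ with center $0$ and radius $R$. A global strong solution is a function $u$ with the stated regularity satisfying $u'(t)=Au(t)+f(t,u(t))$ in $E_0$ for all $t>0$ and $u(0)=u^0$. Condition (H) for $T_0>0$: there are $m\in\mathbb{N}$, $m\ge1$, and numbers $0<\vartheta_j\le q_j$, $1\le j\le m$, such that, with $q:=\max\{q_j:1\le j\le m\}>0$, one has $0<\xi<\min\{1,1/q\}$ (and $0\le\gamma<1$), $f\in C\big((0,T_0]\times E_\xi,E_\gamma\big)$, and there is a constant $C>0$ such that for all $t\in(0,T_0]$ and $u,v\in E_\xi$ $$\|f(t,u)\|_\gamma\le C\big(1+\|u\|_\xi\big)$$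 and $$\|f(t,u)-f(t,v)\|_\gamma\le C\sum_{j=1}^m\big(1+\|u\|_\xi^{q_j-\vartheta_j}+\|v\|_\xi^{q_j-\vartheta_j}\big)\|u-v\|_\xi^{\vartheta_j}.$$ Condition (H') for $T_0>0$ (used when $\gamma=0$): there exists $\vartheta_0\in(0,1)$ such that for each $R>0$ there is a constant $K(R)>0$ with $$\|f(t,u)-f(s,u)\|_0\le K(R)\,|t-s|^{\vartheta_0},\qquad t,s\in(0,T_0],\quad u\in E_\xi\cap\bar{\mathbb{B}}_{E_0}(0,R).$$ *)

theory Defs
  imports "HOL-Analysis.Analysis"
begin

section \<open>Scalars\<close>

text \<open>
  The scalar field is a set \<^term>\<open>K :: complex set\<close> that is either \<^term>\<open>\<real> :: complex set\<close> or
  \<^term>\<open>UNIV :: complex set\<close>. The space \<open>E\<^sub>0\<close> is a type \<open>'e :: banach\<close> together with a scalar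
  multiplication \<open>sc\<close>, of which only the values on \<open>K\<close> matter; it extends the real one.
\<close>

definition scalar_structure :: "complex set \<Rightarrow> (complex \<Rightarrow> 'e::banach \<Rightarrow> 'e) \<Rightarrow> bool" where
  "scalar_structure K sc \<longleftrightarrow>
     (K = \<real> \<or> K = UNIV) \<and>
     (\<forall>r x. sc (of_real r) x = r *\<^sub>R x) \<and>
     (\<forall>a\<in>K. \<forall>b\<in>K. \<forall>x. sc (a + b) x = sc a x + sc b x) \<and>
     (\<forall>a\<in>K. \<forall>x y. sc a (x + y) = sc a x + sc a y) \<and>
     (\<forall>a\<in>K. \<forall>b\<in>K. \<forall>x. sc a (sc b x) = sc (a * b) x) \<and>
     (\<forall>a\<in>K. \<forall>x. norm (sc a x) = cmod a * norm x)"


section \<open>Banach spaces embedded in the space \<open>E\<^sub>0\<close>\<close>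

text \<open>A linear subspace of \<open>'e\<close> with a norm of its own.\<close>

datatype 'e nspace = NSpace (carr: "'e set") (nrm: "'e \<Rightarrow> real")

definition ndist :: "'e::banach nspace \<Rightarrow> 'e \<Rightarrow> 'e \<Rightarrow> real" where
  "ndist X x y = nrm X (x - y)"

definition ntop :: "'e::banach nspace \<Rightarrow> 'e topology" where
  "ntop X = Metric_space.mtopology (carr X) (ndist X)"

text \<open>
  The norm is only meaningful on the carrier; off the carrier it is normalised to 0. This makes
  \<^term>\<open>ndist X\<close> nonnegative and symmetric everywhere, as the locale \<^locale>\<open>Metric_space\<close> demands.
\<close>

definition banach_subspace ::
    "complex set \<Rightarrow> (complex \<Rightarrow> 'e::banach \<Rightarrow> 'e) \<Rightarrow> 'e nspace \<Rightarrow> bool" where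
  "banach_subspace K sc X \<longleftrightarrow>
     0 \<in> carr X \<and>
     (\<forall>x\<in>carr X. \<forall>y\<in>carr X. x + y \<in> carr X) \<and>
     (\<forall>a\<in>K. \<forall>x\<in>carr X. sc a x \<in> carr X) \<and>
     (\<forall>x. x \<notin> carr X \<longrightarrow> nrm X x = 0) \<and>
     (\<forall>x\<in>carr X. 0 \<le> nrm X x \<and> (nrm X x = 0 \<longleftrightarrow> x = 0)) \<and>
     (\<forall>x\<in>carr X. \<forall>y\<in>carr X. nrm X (x + y) \<le> nrm X x + nrm X y) \<and>
     (\<forall>a\<in>K. \<forall>x\<in>carr X. nrm X (sc a x) = cmod a * nrm X x) \<and>
     Metric_space.mcomplete (carr X) (ndist X)"

lemma banach_subspace_Metric_space:
  assumes "scalar_structure K sc" and X: "banach_subspace K sc X"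
  shows "Metric_space (carr X) (ndist X)"
proof -
  have K: "-1 \<in> K"
    using assms(1) by (auto simp: scalar_structure_def)
  have sc: "sc (-1) x = - x" for x
  proof -
    have "sc (of_real (-1)) x = (-1) *\<^sub>R x"
      using assms(1) unfolding scalar_structure_def by blast
    then show ?thesis by simp
  qed
  have neg: "- x \<in> carr X" "nrm X (- x) = nrm X x" if "x \<in> carr X" for x
    using X K sc that unfolding banach_subspace_def by (metis, metis mult_1 norm_minus_cancel norm_one)
  have add: "x + y \<in> carr X" "nrm X (x + y) \<le> nrm X x + nrm X y"
    if "x \<in> carr X" "y \<in> carr X" for x y
    using X that unfolding banach_subspace_def by auto
  have diff: "x - y \<in> carr X" if "x \<in> carr X" "y \<in> carr X" for x y
    using add(1)[OF that(1) neg(1)[OF that(2)]] by simp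
  have off: "nrm X x = 0" if "x \<notin> carr X" for x
    using X that unfolding banach_subspace_def by auto
  have nn: "0 \<le> nrm X x" for x
    using X off[of x] unfolding banach_subspace_def by (cases "x \<in> carr X") auto
  have sym: "nrm X (- x) = nrm X x" for x
    using neg(1)[of "- x"] neg(2)[of x] off[of x] off[of "- x"]
    by (cases "x \<in> carr X") auto
  show ?thesis
  proof
    show "0 \<le> ndist X x y" for x y
      by (simp add: ndist_def nn)
    show "ndist X x y = ndist X y x" for x y
      using sym[of "x - y"] by (simp add: ndist_def)
    show "ndist X x y = 0 \<longleftrightarrow> x = y" if "x \<in> carr X" "y \<in> carr X" for x y
      using X diff[OF that] unfolding banach_subspace_def ndist_def by auto
    show "ndist X x z \<le> ndist X x y + ndist X y z"
      if "x \<in> carr X" "y \<in> carr X" "z \<in> carr X" for x y z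
      using add(2)[OF diff[OF that(1,2)] diff[OF that(2,3)]] by (simp add: ndist_def)
  qed
qed

definition whole_space :: "'e::banach nspace" where
  "whole_space = NSpace UNIV norm"

definition cont_embedded :: "'e::banach nspace \<Rightarrow> 'e nspace \<Rightarrow> bool" where
  "cont_embedded X Y \<longleftrightarrow>
     carr X \<subseteq> carr Y \<and> (\<exists>c. \<forall>x\<in>carr X. nrm Y x \<le> c * nrm X x)"

definition dense_in :: "'e::banach nspace \<Rightarrow> 'e nspace \<Rightarrow> bool" where
  "dense_in X Y \<longleftrightarrow> ntop Y closure_of carr X = carr Y"

definition nball :: "'e::banach nspace \<Rightarrow> real \<Rightarrow> 'e set" where
  "nball X R = {x \<in> carr X. nrm X x \<le> R}"

definition compactly_embedded :: "'e::banach nspace \<Rightarrow> 'e nspace \<Rightarrow> bool" where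
  "compactly_embedded X Y \<longleftrightarrow>
     cont_embedded X Y \<and> compactin (ntop Y) (ntop Y closure_of nball X 1)"


section \<open>Interpolation functors\<close>

definition bounded_op ::
    "complex set \<Rightarrow> (complex \<Rightarrow> 'e::banach \<Rightarrow> 'e) \<Rightarrow> 'e nspace \<Rightarrow> 'e nspace \<Rightarrow> ('e \<Rightarrow> 'e) \<Rightarrow> bool" where
  "bounded_op K sc X Y T \<longleftrightarrow>
     (\<forall>x\<in>carr X. T x \<in> carr Y) \<and>
     (\<forall>x\<in>carr X. \<forall>y\<in>carr X. T (x + y) = T x + T y) \<and>
     (\<forall>a\<in>K. \<forall>x\<in>carr X. T (sc a x) = sc a (T x)) \<and>
     (\<exists>c. \<forall>x\<in>carr X. nrm Y (T x) \<le> c * nrm X x)"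

definition op_norm :: "'e::banach nspace \<Rightarrow> 'e nspace \<Rightarrow> ('e \<Rightarrow> 'e) \<Rightarrow> real" where
  "op_norm X Y T = (SUP x\<in>nball X 1. nrm Y (T x))"

definition banach_couple ::
    "complex set \<Rightarrow> (complex \<Rightarrow> 'e::banach \<Rightarrow> 'e) \<Rightarrow> 'e nspace \<Rightarrow> 'e nspace \<Rightarrow> bool" where
  "banach_couple K sc X0 X1 \<longleftrightarrow>
     banach_subspace K sc X0 \<and> banach_subspace K sc X1 \<and> cont_embedded X1 X0"

text \<open>
  An interpolation functor sends a couple \<open>X\<^sub>1 \<hookrightarrow> X\<^sub>0\<close> to an intermediate Banach space and a
  morphism \<open>T\<close> of couples to its restriction. Only couples inside \<open>'e\<close> are considered: any
  interpolation functor on all Banach couples restricts to one in this sense, so that quantifying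
  over the functors below is at least as general. Likewise, the constant in the exponent
  inequality may depend on the couples (but not on the operator).
\<close>

definition interpolation_functor ::
    "complex set \<Rightarrow> (complex \<Rightarrow> 'e::banach \<Rightarrow> 'e) \<Rightarrow> real \<Rightarrow>
     ('e nspace \<Rightarrow> 'e nspace \<Rightarrow> 'e nspace) \<Rightarrow> bool" where
  "interpolation_functor K sc \<theta> F \<longleftrightarrow>
     (\<forall>X0 X1. banach_couple K sc X0 X1 \<longrightarrow>
        banach_subspace K sc (F X0 X1) \<and>
        cont_embedded X1 (F X0 X1) \<and> cont_embedded (F X0 X1) X0) \<and>
     (\<forall>X0 X1 Y0 Y1. banach_couple K sc X0 X1 \<and> banach_couple K sc Y0 Y1 \<longrightarrow>
        (\<exists>c>0. \<forall>T. bounded_op K sc X0 Y0 T \<and> bounded_op K sc X1 Y1 T \<longrightarrow>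
           bounded_op K sc (F X0 X1) (F Y0 Y1) T \<and>
           op_norm (F X0 X1) (F Y0 Y1) T
             \<le> c * op_norm X0 Y0 T powr (1 - \<theta>) * op_norm X1 Y1 T powr \<theta>))"

definition admissible_functor ::
    "complex set \<Rightarrow> (complex \<Rightarrow> 'e::banach \<Rightarrow> 'e) \<Rightarrow> real \<Rightarrow>
     ('e nspace \<Rightarrow> 'e nspace \<Rightarrow> 'e nspace) \<Rightarrow> bool" where
  "admissible_functor K sc \<theta> F \<longleftrightarrow>
     interpolation_functor K sc \<theta> F \<and>
     (\<forall>X0 X1. banach_couple K sc X0 X1 \<and> dense_in X1 X0 \<longrightarrow> dense_in X1 (F X0 X1))"

text \<open>The space \<open>E\<^sub>\<theta>\<close> for \<open>0 \<le> \<theta> < 1\<close>; \<open>E\<^sub>0\<close> is the whole type.\<close>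

definition interp_space ::
    "(real \<Rightarrow> 'e::banach nspace \<Rightarrow> 'e nspace \<Rightarrow> 'e nspace) \<Rightarrow> 'e nspace \<Rightarrow> real \<Rightarrow> 'e nspace" where
  "interp_space F E1 \<theta> = (if \<theta> = 0 then whole_space else F \<theta> whole_space E1)"


section \<open>Generators of strongly continuous analytic semigroups\<close>

definition C0_semigroup ::
    "complex set \<Rightarrow> (complex \<Rightarrow> 'e::banach \<Rightarrow> 'e) \<Rightarrow> (real \<Rightarrow> 'e \<Rightarrow>\<^sub>L 'e) \<Rightarrow> bool" where
  "C0_semigroup K sc T \<longleftrightarrow>
     (\<forall>t\<ge>0. \<forall>a\<in>K. \<forall>x. T t (sc a x) = sc a (T t x)) \<and>
     T 0 = id_blinfun \<and>
     (\<forall>s\<ge>0. \<forall>t\<ge>0. T (s + t) = T s o\<^sub>L T t) \<and>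
     (\<forall>x. ((\<lambda>t. T t x) \<longlongrightarrow> x) (at_right 0))"

definition is_generator :: "(real \<Rightarrow> 'e::banach \<Rightarrow>\<^sub>L 'e) \<Rightarrow> 'e set \<Rightarrow> ('e \<Rightarrow> 'e) \<Rightarrow> bool" where
  "is_generator T D A \<longleftrightarrow>
     D = {x. \<exists>y. ((\<lambda>h. (T h x - x) /\<^sub>R h) \<longlongrightarrow> y) (at_right 0)} \<and>
     (\<forall>x\<in>D. ((\<lambda>h. (T h x - x) /\<^sub>R h) \<longlongrightarrow> A x) (at_right 0))"

definition sector :: "real \<Rightarrow> complex set" where
  "sector \<delta> = {z. z \<noteq> 0 \<and> \<bar>Arg z\<bar> < \<delta>}"

text \<open>
  \<open>T\<close> extends to an analytic semigroup of complex-linear operators on a sector around the positive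
  axis, where \<open>csc\<close> is the multiplication by complex scalars on \<open>'x\<close>. Analyticity is differentiability
  in operator norm with a complex-linear derivative.
\<close>

definition analytic_semigroup ::
    "(complex \<Rightarrow> 'x::banach \<Rightarrow> 'x) \<Rightarrow> (real \<Rightarrow> 'x \<Rightarrow> 'x) \<Rightarrow> bool" where
  "analytic_semigroup csc T \<longleftrightarrow>
     (\<exists>\<delta> (S :: complex \<Rightarrow> 'x \<Rightarrow>\<^sub>L 'x).
        0 < \<delta> \<and> \<delta> \<le> pi / 2 \<and>
        (\<forall>t\<ge>0. blinfun_apply (S (of_real t)) = T t) \<and>
        (\<forall>z\<in>sector \<delta>. \<forall>a x. S z (csc a x) = csc a (S z x)) \<and>
        (\<forall>z\<in>sector \<delta>. \<forall>w\<in>sector \<delta>. S (z + w) = S z o\<^sub>L S w) \<and>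
        (\<forall>z\<in>sector \<delta>. \<exists>L. (S has_derivative L) (at z) \<and>
           (\<forall>a h x. L (a * h) x = csc a (L h x))) \<and>
        (\<forall>x. ((\<lambda>z. S z x) \<longlongrightarrow> x) (at 0 within sector \<delta>)))"

text \<open>
  Complex multiplication on the complexification \<open>'e \<times> 'e\<close>, where \<open>(x, y)\<close> stands for \<open>x + i y\<close>.
  The product norm is not homogeneous for complex scalars, but it is equivalent to the norms that
  are, and analyticity and strong continuity depend on the topology only.
\<close>

definition complexified_scale :: "complex \<Rightarrow> 'e::banach \<times> 'e \<Rightarrow> 'e \<times> 'e" where
  "complexified_scale a p =
     (Re a *\<^sub>R fst p - Im a *\<^sub>R snd p, Re a *\<^sub>R snd p + Im a *\<^sub>R fst p)"

text \<open>Over the reals, analyticity of a semigroup refers to its complexification, as usual.\<close>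

definition generates_analytic_C0_semigroup ::
    "complex set \<Rightarrow> (complex \<Rightarrow> 'e::banach \<Rightarrow> 'e) \<Rightarrow> 'e set \<Rightarrow> ('e \<Rightarrow> 'e) \<Rightarrow> bool" where
  "generates_analytic_C0_semigroup K sc D A \<longleftrightarrow>
     (\<exists>T. C0_semigroup K sc T \<and> is_generator T D A \<and>
        (if K = \<real> then analytic_semigroup complexified_scale (\<lambda>t. map_prod (T t) (T t))
         else analytic_semigroup sc (\<lambda>t. blinfun_apply (T t))))"


section \<open>The Cauchy problem\<close>

definition global_strong_solution ::
    "'e::banach nspace \<Rightarrow> 'e nspace \<Rightarrow> ('e \<Rightarrow> 'e) \<Rightarrow> (real \<Rightarrow> 'e \<Rightarrow> 'e) \<Rightarrow> 'e \<Rightarrow> (real \<Rightarrow> 'e) \<Rightarrow> bool" where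
  "global_strong_solution E1 E\<alpha> A f u0 u \<longleftrightarrow>
     (\<exists>u'. continuous_on {0<..} u' \<and>
        (\<forall>t>0. (u has_vector_derivative u' t) (at t) \<and> u' t = A (u t) + f t (u t))) \<and>
     continuous_map (top_of_set {0<..}) (ntop E1) u \<and>
     continuous_map (top_of_set {0..}) (ntop E\<alpha>) u \<and>
     u 0 = u0"

text \<open>
  The arguments \<open>E\<gamma>\<close> and \<open>E\<xi>\<close> below are the spaces \<open>E\<^sub>\<gamma>\<close> and \<open>E\<^sub>\<xi>\<close>. In \<open>condition_H\<close> with \<open>q j = \<eta> j\<close>,
  Isabelle's convention \<open>0 powr 0 = 0\<close> instead of 1 affects only the size of the constant \<open>C\<close>.
\<close>

definition condition_H ::
    "real \<Rightarrow> real \<Rightarrow> 'e::banach nspace \<Rightarrow> 'e nspace \<Rightarrow> (real \<Rightarrow> 'e \<Rightarrow> 'e) \<Rightarrow> real \<Rightarrow> bool" where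
  "condition_H \<gamma> \<xi> E\<gamma> E\<xi> f T0 \<longleftrightarrow>
     (\<exists>(m::nat) (\<eta> :: nat \<Rightarrow> real) (q :: nat \<Rightarrow> real).
        1 \<le> m \<and>
        (\<forall>j\<in>{1..m}. 0 < \<eta> j \<and> \<eta> j \<le> q j) \<and>
        0 < \<xi> \<and> \<xi> < min 1 (1 / Max (q ` {1..m})) \<and>
        0 \<le> \<gamma> \<and> \<gamma> < 1 \<and>
        continuous_map (prod_topology (top_of_set {0<..T0}) (ntop E\<xi>)) (ntop E\<gamma>) (\<lambda>(t, x). f t x) \<and>
        (\<exists>C>0. \<forall>t\<in>{0<..T0}. \<forall>u\<in>carr E\<xi>. \<forall>v\<in>carr E\<xi>.
           nrm E\<gamma> (f t u) \<le> C * (1 + nrm E\<xi> u) \<and>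
           nrm E\<gamma> (f t u - f t v)
             \<le> C * (\<Sum>j=1..m. (1 + nrm E\<xi> u powr (q j - \<eta> j) + nrm E\<xi> v powr (q j - \<eta> j))
                              * nrm E\<xi> (u - v) powr \<eta> j)))"

definition condition_H' :: "'e::banach nspace \<Rightarrow> (real \<Rightarrow> 'e \<Rightarrow> 'e) \<Rightarrow> real \<Rightarrow> bool" where
  "condition_H' E\<xi> f T0 \<longleftrightarrow>
     (\<exists>\<eta>0\<in>{0<..<1}. \<forall>R>0. \<exists>C>0.
        \<forall>t\<in>{0<..T0}. \<forall>s\<in>{0<..T0}. \<forall>u\<in>carr E\<xi> \<inter> cball 0 R.
          norm (f t u - f s u) \<le> C * \<bar>t - s\<bar> powr \<eta>0)"

end

theory Submission
  imports Defs "HOL-Library.Diagonal_Subsequence"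
begin

text \<open>
  With \<open>\<kappa> = max (\<xi> - \<alpha>) 0 < 1\<close>, the orbit \<open>e\<^sup>t\<^sup>A u\<^sup>0\<close> is \<open>O(t\<^sup>-\<^sup>\<kappa>)\<close> in \<open>E\<^sub>\<xi>\<close>, so that linear growth of \<open>f\<close> and
  a weighted Gronwall argument bound the mild solutions of the delayed equations
  \<open>u(t) = e\<^sup>t\<^sup>A u\<^sup>0 + \<integral>\<^sub>0\<^sup>t e\<^sup>(\<^sup>t\<^sup>-\<^sup>s\<^sup>)\<^sup>A f(s, e\<^sup>h\<^sup>A u(s - h)) ds\<close> in \<open>E\<^sub>\<xi>\<close> by \<open>C t\<^sup>-\<^sup>\<kappa>\<close>, uniformly in \<open>h\<close>. The embedding of \<open>E\<^sub>1\<close> into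
  \<open>E\<^sub>0\<close> is compact and \<open>e\<^sup>t\<^sup>A\<close> maps \<open>E\<^sub>0\<close> into \<open>E\<^sub>1\<close> for \<open>t > 0\<close>, so the semigroup is compact, and a
  subsequence converges to a global mild solution as \<open>h\<close> tends to 0. This \<open>u\<close> is strong because
  \<open>\<parallel>e\<^sup>(\<^sup>t\<^sup>-\<^sup>s\<^sup>)\<^sup>A (g(s) - g(t))\<parallel>\<^sub>1 \<le> C (t - s)\<^sup>\<delta>\<^sup>-\<^sup>1\<close> for \<open>g(t) = f(t, u(t))\<close> and some \<open>\<delta> > 0\<close>: for \<open>\<gamma> > 0\<close> since \<open>g\<close>
  is locally bounded in \<open>E\<^sub>\<gamma>\<close>, and for \<open>\<gamma> = 0\<close> since \<open>u\<close> is locally Hoelder continuous in \<open>E\<^sub>\<xi>\<close>.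
\<close>

text \<open>Since f is merely continuous in its second argument, Picard iteration need not converge.
  The delay h turns the equation into an explicit recursion, and the factor e^{hA} carries u(s - h)
  into E_\<xi>, where f is defined, even if u^0 lies only in a larger space E_\<alpha>. This factor
  also matches the delay: the delayed argument is e^{sA} u^0 plus an integral with the undelayed
  kernel, so the constants do not depend on h. The spaces E_\<theta> come from functors that may be
  unrelated for different \<theta>. They are compared through the semigroup: e^{tA} is interpolated
  between its bounds on E_0 and E_1, and for \<alpha> \<noteq> \<xi> the order \<kappa> comes from
  integrating A e^{sA} u^0 in E_\<xi>. Compactness is extracted in E_0 and raised to E_\<xi> by
  splitting off a short piece e^{\<delta>A}. The norm of E_1 is tied to A only because E_1 is the
  domain of A; a closed graph argument makes it equivalent to the graph norm. From E_0 into E_1 the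
  kernel e^{tA} is only O(1/t), which is not integrable; the gain in the estimate on g(s) - g(t)
  repairs this.\<close>

locale scalars =
  fixes K :: "complex set" and sc :: "complex \<Rightarrow> 'e::banach \<Rightarrow> 'e"
  assumes scalar: "scalar_structure K sc"
begin

lemma of_real_in_K: "of_real r \<in> K"
  using scalar by (auto simp: scalar_structure_def)

lemma sc_of_real: "sc (of_real r) x = r *\<^sub>R x"
  using scalar by (auto simp: scalar_structure_def)

lemma norm_sc: "a \<in> K \<Longrightarrow> norm (sc a x) = cmod a * norm x"
  using scalar by (auto simp: scalar_structure_def)

end

section \<open>Linear subspaces of the base space with a complete norm of their own\<close>

locale normed_subspace = scalars K sc for K :: "complex set" and sc :: "complex \<Rightarrow> 'e::banach \<Rightarrow> 'e" +
  fixes X :: "'e nspace"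
  assumes banach: "banach_subspace K sc X"
begin

sublocale Metric_space "carr X" "ndist X"
  using banach_subspace_Metric_space[OF scalar banach] .

lemma carr_zero [simp, intro]: "0 \<in> carr X"
  using banach by (simp add: banach_subspace_def)

lemma carr_add [intro]: "x \<in> carr X \<Longrightarrow> y \<in> carr X \<Longrightarrow> x + y \<in> carr X"
  using banach by (simp add: banach_subspace_def)

lemma carr_sc [intro]: "a \<in> K \<Longrightarrow> x \<in> carr X \<Longrightarrow> sc a x \<in> carr X"
  using banach by (simp add: banach_subspace_def)

lemma carr_scale [intro]: "x \<in> carr X \<Longrightarrow> r *\<^sub>R x \<in> carr X"
  using carr_sc[OF of_real_in_K[of r]] by (simp add: sc_of_real)

lemma carr_minus [intro]: "x \<in> carr X \<Longrightarrow> - x \<in> carr X"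
  using carr_scale[of x "-1"] by simp

lemma carr_diff [intro]: "x \<in> carr X \<Longrightarrow> y \<in> carr X \<Longrightarrow> x - y \<in> carr X"
  using carr_add[of x "- y"] by auto

lemma nrm_off: "x \<notin> carr X \<Longrightarrow> nrm X x = 0"
  using banach by (simp add: banach_subspace_def)

lemma nrm_nonneg [simp]: "0 \<le> nrm X x"
  using banach nrm_off[of x] by (cases "x \<in> carr X") (auto simp: banach_subspace_def)

lemma nrm_eq_0: "x \<in> carr X \<Longrightarrow> nrm X x = 0 \<longleftrightarrow> x = 0"
  using banach by (simp add: banach_subspace_def)

lemma nrm_zero [simp]: "nrm X 0 = 0"
  using nrm_eq_0[of 0] by simp

lemma nrm_triangle: "x \<in> carr X \<Longrightarrow> y \<in> carr X \<Longrightarrow> nrm X (x + y) \<le> nrm X x + nrm X y"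
  using banach by (simp add: banach_subspace_def)

lemma nrm_scale: "x \<in> carr X \<Longrightarrow> nrm X (r *\<^sub>R x) = \<bar>r\<bar> * nrm X x"
proof -
  assume "x \<in> carr X"
  then have "nrm X (sc (of_real r) x) = cmod (of_real r) * nrm X x"
    using banach of_real_in_K[of r] unfolding banach_subspace_def by blast
  then show ?thesis by (simp add: sc_of_real)
qed

lemma nrm_minus: "nrm X (- x) = nrm X x"
  using nrm_scale[of x "-1"] nrm_off[of x] nrm_off[of "-x"] carr_minus[of "-x"] by (cases "x \<in> carr X") auto

lemma nrm_minus_commute: "nrm X (x - y) = nrm X (y - x)"
  using nrm_minus[of "x - y"] by simp

lemma nrm_triangle_diff: "x \<in> carr X \<Longrightarrow> y \<in> carr X \<Longrightarrow> nrm X (x - y) \<le> nrm X x + nrm X y"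
  using nrm_triangle[of x "- y"] by (auto simp: nrm_minus)

lemma nrm_diff_triangle:
  "x \<in> carr X \<Longrightarrow> y \<in> carr X \<Longrightarrow> z \<in> carr X \<Longrightarrow> nrm X (x - z) \<le> nrm X (x - y) + nrm X (y - z)"
  using nrm_triangle[of "x - y" "y - z"] carr_diff by auto

lemma nrm_abs_diff: "x \<in> carr X \<Longrightarrow> y \<in> carr X \<Longrightarrow> \<bar>nrm X x - nrm X y\<bar> \<le> nrm X (x - y)"
  using nrm_triangle[of "x - y" y] nrm_triangle[of "y - x" x] carr_diff nrm_minus_commute[of x y]
  by auto

lemma ntop_eq: "ntop X = mtopology"
  by (simp add: ntop_def)

lemma limitin_ntop:
  "limitin (ntop X) x l F \<longleftrightarrow>
     l \<in> carr X \<and> (\<forall>\<^sub>F n in F. x n \<in> carr X) \<and> ((\<lambda>n. nrm X (x n - l)) \<longlongrightarrow> 0) F"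
  unfolding ntop_eq limitin_metric_dist_null ndist_def tendsto_iff
  by auto

lemma continuous_map_into:
  "continuous_map (top_of_set (S::'a::metric_space set)) (ntop X) u \<longleftrightarrow>
     (\<forall>s\<in>S. u s \<in> carr X) \<and> (\<forall>t\<in>S. ((\<lambda>s. nrm X (u s - u t)) \<longlongrightarrow> 0) (at t within S))"
proof -
  have "continuous_map (top_of_set S) (ntop X) u \<longleftrightarrow> (\<forall>t\<in>S. limitin (ntop X) u (u t) (at t within S))"
  proof -
    have "atin_within euclidean t S = at t within S" for t :: 'a
      by (rule filter_eqI) (auto simp: eventually_atin_within eventually_at_topological)
    then show ?thesis by (simp add: continuous_map_atin atin_subtopology_within)
  qed
  also have "\<dots> \<longleftrightarrow> (\<forall>s\<in>S. u s \<in> carr X) \<and> (\<forall>t\<in>S. ((\<lambda>s. nrm X (u s - u t)) \<longlongrightarrow> 0) (at t within S))"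
    unfolding limitin_ntop
    by (auto simp: eventually_at intro: zero_less_one)
  finally show ?thesis .
qed

lemma complete:
  assumes "\<And>n. x n \<in> carr X"
    and "\<And>e. e > 0 \<Longrightarrow> \<exists>N. \<forall>m\<ge>N. \<forall>n\<ge>N. nrm X (x m - x n) < e"
  shows "\<exists>l\<in>carr X. (\<lambda>n. nrm X (x n - l)) \<longlonglongrightarrow> 0"
proof -
  have "MCauchy x"
    unfolding MCauchy_def ndist_def using assms by blast
  moreover have "mcomplete"
    using banach by (simp add: banach_subspace_def)
  ultimately obtain l where "limitin mtopology x l sequentially"
    unfolding mcomplete_def by blast
  then show ?thesis
    using limitin_ntop[of x l sequentially] by (auto simp: ntop_eq)
qed

lemma nrm_tendsto:
  assumes "((\<lambda>n. nrm X (x n - l)) \<longlongrightarrow> 0) F" "\<forall>\<^sub>F n in F. x n \<in> carr X" "l \<in> carr X"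
  shows "((\<lambda>n. nrm X (x n)) \<longlongrightarrow> nrm X l) F"
proof -
  have "((\<lambda>n. nrm X (x n) - nrm X l) \<longlongrightarrow> 0) F"
    by (rule Lim_null_comparison[OF _ assms(1)])
       (use assms(2) in eventually_elim, use nrm_abs_diff assms(3) in auto)
  then show ?thesis
    by (simp add: LIM_zero_iff)
qed

lemma nrm_lim_le:
  assumes "((\<lambda>n. nrm X (x n - l)) \<longlongrightarrow> 0) F" "\<forall>\<^sub>F n in F. x n \<in> carr X" "l \<in> carr X" "F \<noteq> bot"
    "\<forall>\<^sub>F n in F. nrm X (x n) \<le> B"
  shows "nrm X l \<le> B"
  using tendsto_upperbound[OF nrm_tendsto[OF assms(1-3)] assms(5,4)] .

end

lemma carr_whole [simp]: "carr whole_space = UNIV" and nrm_whole [simp]: "nrm whole_space = norm"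
  by (auto simp: whole_space_def)

lemma ntop_whole [simp]: "ntop whole_space = euclidean"
proof -
  have "ndist (whole_space :: 'a nspace) = dist"
    by (auto simp: ndist_def fun_eq_iff dist_norm)
  then show ?thesis
    by (simp add: ntop_def)
qed

context scalars
begin

lemma banach_subspace_whole: "banach_subspace K sc whole_space"
proof -
  have "ndist (whole_space :: 'e nspace) = dist"
    by (auto simp: ndist_def fun_eq_iff dist_norm)
  moreover have "Met_TC.mcomplete TYPE('e)"
    by (simp add: complete_UNIV)
  ultimately show ?thesis
    by (auto simp: banach_subspace_def norm_triangle_ineq norm_sc)
qed

sublocale whole: normed_subspace K sc whole_space
  by unfold_locales (rule banach_subspace_whole)

end

text \<open>As both spaces embed into \<open>E\<^sub>0\<close>, the inclusion of \<open>X\<close> into \<open>Y\<close> has closed graph.\<close>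

lemma (in scalars) closed_graph_inclusion:
  assumes X: "banach_subspace K sc X" and Y: "banach_subspace K sc Y"
    and XE: "cont_embedded X whole_space" and YE: "cont_embedded Y whole_space"
    and sub: "carr X \<subseteq> carr Y"
  shows "cont_embedded X Y"
proof -
  interpret X: normed_subspace K sc X by unfold_locales (rule X)
  interpret Y: normed_subspace K sc Y by unfold_locales (rule Y)
  obtain cX where cX: "\<And>x. x \<in> carr X \<Longrightarrow> norm x \<le> cX * nrm X x"
    using XE by (auto simp: cont_embedded_def)
  obtain cY where cY: "\<And>x. x \<in> carr Y \<Longrightarrow> norm x \<le> cY * nrm Y x"
    using YE by (auto simp: cont_embedded_def)
  \<comment> \<open>The sublevel sets of the Y-norm exhaust X, so by Baire the X-closure of one of
    them has an interior point. It remains to move this information to the origin and to remove the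
    closure.\<close>
  define B where "B n = {x \<in> carr X. nrm Y x \<le> real n}" for n :: nat
  define C where "C n = X.mtopology closure_of B n" for n
  have "\<exists>n. X.mtopology interior_of C n \<noteq> {}"
  proof (rule ccontr)
    assume "\<not> ?thesis"
    then have "X.mtopology interior_of \<Union>(range C) = {}"
      using X by (intro X.metric_Baire_category_alt) (auto simp: banach_subspace_def C_def)
    moreover have "carr X \<subseteq> \<Union>(range C)"
    proof
      fix x assume x: "x \<in> carr X"
      obtain n :: nat where "nrm Y x \<le> real n" using real_arch_simple by blast
      then have "x \<in> B n" using x by (auto simp: B_def)
      then have "x \<in> C n"
        using closure_of_subset[of "B n" X.mtopology] by (auto simp: C_def B_def)
      then show "x \<in> \<Union>(range C)" by blast
    qed
    moreover have "\<Union>(range C) \<subseteq> carr X"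
      using closure_of_subset_topspace[of X.mtopology] by (auto simp: C_def)
    ultimately have "X.mtopology interior_of (carr X) = {}"
      by (metis subset_antisym)
    then show False
      using interior_of_topspace[of X.mtopology] X.carr_zero by auto
  qed
  then obtain n x0 where x0: "x0 \<in> X.mtopology interior_of C n" by blast
  obtain r where r: "r > 0" "X.mball x0 r \<subseteq> C n"
    using x0 by (auto simp: interior_of_def X.openin_mtopology)
  have x0X: "x0 \<in> carr X"
    using x0 interior_of_subset_topspace[of X.mtopology "C n"] by auto
  \<comment> \<open>Points near 0 are differences of two points of the ball about \<open>x0\<close>;
    the centre cancels, and each of the two approximants contributes n to the Y-norm.\<close>
  define N where "N = 2 * real n"
  have approx: "\<exists>y\<in>carr X. nrm Y y \<le> N \<and> nrm X (x - y) < r / 2" if x: "x \<in> carr X" "nrm X x < r" for x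
  proof -
    have C_approx: "\<exists>y\<in>B n. nrm X (z - y) < r / 4" if "z \<in> C n" for z
    proof -
      have "z \<in> X.mtopology closure_of B n" using that by (simp add: C_def)
      then obtain y where "y \<in> B n" "y \<in> X.mball z (r / 4)"
        using r(1) unfolding X.metric_closure_of by (auto dest!: spec[of _ "r / 4"])
      then show ?thesis by (auto simp: ndist_def)
    qed
    have "x0 + x \<in> X.mball x0 r" "x0 \<in> X.mball x0 r"
      using x x0X r(1) X.nrm_minus[of x] by (auto simp: ndist_def)
    then obtain y1 y2 where y: "y1 \<in> B n" "nrm X (x0 + x - y1) < r / 4" "y2 \<in> B n" "nrm X (x0 - y2) < r / 4"
      using C_approx r(2) by blast
    have c: "y1 \<in> carr X" "y2 \<in> carr X" using y by (auto simp: B_def)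
    have "nrm X (x - (y1 - y2)) \<le> nrm X (x0 + x - y1) + nrm X (x0 - y2)"
      using X.nrm_triangle_diff[of "x0 + x - y1" "x0 - y2"] c x0X x by (auto simp: algebra_simps)
    moreover have "nrm Y (y1 - y2) \<le> N"
      using Y.nrm_triangle_diff[of y1 y2] y c subsetD[OF sub] by (auto simp: B_def N_def)
    ultimately show ?thesis
      using y c by (intro bexI[of _ "y1 - y2"]) auto
  qed
  have scaled: "\<exists>y\<in>carr X. nrm Y y \<le> N * (1/2)^k \<and> nrm X (x - y) < r * (1/2) ^ Suc k"
    if x: "x \<in> carr X" "nrm X x < r * (1/2) ^ k" for x k
  proof -
    have "nrm X (2^k *\<^sub>R x) < r"
      using x by (simp add: X.nrm_scale power_divide field_simps)
    then obtain y where y: "y \<in> carr X" "nrm Y y \<le> N" "nrm X (2^k *\<^sub>R x - y) < r / 2"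
      using approx[of "2^k *\<^sub>R x"] x by auto
    have "x - (1/2)^k *\<^sub>R y = (1/2)^k *\<^sub>R (2^k *\<^sub>R x - y)"
      by (simp add: scaleR_diff_right power_divide)
    then have "nrm X (x - (1/2)^k *\<^sub>R y) = (1/2)^k * nrm X (2^k *\<^sub>R x - y)"
      using X.nrm_scale[of "2^k *\<^sub>R x - y" "(1/2)^k"] x y by auto
    also have "\<dots> < r * (1/2) ^ Suc k"
      using y(3) by (simp add: power_divide field_simps)
    finally show ?thesis
      using y sub Y.nrm_scale[of y "(1/2)^k"]
      by (intro bexI[of _ "(1/2)^k *\<^sub>R y"]) (auto simp: mult_left_mono mult.commute)
  qed
  have unit: "nrm Y x \<le> 2 * N" if x: "x \<in> carr X" "nrm X x < r" for x
  proof -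
    have "\<forall>k z. \<exists>y. z \<in> carr X \<and> nrm X z < r * (1/2)^k \<longrightarrow>
        y \<in> carr X \<and> nrm Y y \<le> N * (1/2)^k \<and> nrm X (z - y) < r * (1/2) ^ Suc k"
      using scaled by blast
    then obtain g where g: "z \<in> carr X \<and> nrm X z < r * (1/2)^k \<longrightarrow>
        g k z \<in> carr X \<and> nrm Y (g k z) \<le> N * (1/2)^k \<and> nrm X (z - g k z) < r * (1/2) ^ Suc k" for k z
      by metis
    \<comment> \<open>\<open>s k\<close> is what is left of x after k successive approximations, and
      \<open>x - s k\<close> is the k-th partial sum. It is Cauchy in Y because the Y-norms of the
      summands decrease geometrically.\<close>
    define s where "s = rec_nat x (\<lambda>k z. z - g k z)"
    have s0: "s 0 = x" and sS: "s (Suc k) = s k - g k (s k)" for k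
      by (simp_all add: s_def)
    have s: "s k \<in> carr X \<and> nrm X (s k) < r * (1/2)^k" for k
      using x g by (induction k) (auto simp: s0 sS)
    have tail: "nrm Y (s m - s (m + j)) \<le> 2 * N * ((1/2)^m - (1/2)^(m + j))" for m j
    proof (induction j)
      case (Suc j)
      have "nrm Y (s (m + j) - s (Suc (m + j))) \<le> N * (1/2)^(m + j)"
        using g[of "s (m + j)" "m + j"] s by (auto simp: sS)
      moreover have "nrm Y (s m - s (Suc (m + j))) \<le> nrm Y (s m - s (m + j)) + nrm Y (s (m + j) - s (Suc (m + j)))"
        using s sub by (intro Y.nrm_diff_triangle) blast+
      ultimately show ?case using Suc by (simp add: algebra_simps)
    qed simp
    have N0: "0 \<le> N" by (simp add: N_def)
    have tail': "nrm Y ((x - s m) - (x - s n)) \<le> 2 * N * (1/2)^k" if "k \<le> m" "k \<le> n" for m n k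
    proof -
      have *: "nrm Y (s m - s n) \<le> 2 * N * (1/2)^k" if "k \<le> m" "m \<le> n" for m n
      proof -
        have "nrm Y (s m - s n) \<le> 2 * N * ((1/2)^m - (1/2)^n)"
          using tail[of m "n - m"] that by simp
        also have "\<dots> \<le> 2 * N * (1/2)^k"
          using that N0 power_decreasing[of k m "1/2::real"] zero_le_power[of "1/2::real" n]
          by (intro mult_left_mono) linarith+
        finally show ?thesis .
      qed
      show ?thesis
        using *[of m n] *[of n m] that Y.nrm_minus_commute[of "s m" "s n"] Y.nrm_minus_commute[of "x - s m" "x - s n"]
        by (cases "m \<le> n") auto
    qed
    have pow0: "(\<lambda>k. c * (1/2)^k) \<longlonglongrightarrow> 0" for c :: real
      by (intro tendsto_mult_right_zero LIMSEQ_power_zero) simp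
    have xs: "x - s k \<in> carr Y" for k using s x sub by auto
    have "\<exists>M. \<forall>m\<ge>M. \<forall>n\<ge>M. nrm Y ((x - s m) - (x - s n)) < e" if e: "e > 0" for e
    proof -
      obtain k where "2 * N * (1/2)^k < e"
        using order_tendstoD(2)[OF pow0 e] by (auto simp: eventually_sequentially)
      then show ?thesis using tail' by (meson le_less_trans)
    qed
    then obtain l where l: "l \<in> carr Y" "(\<lambda>n. nrm Y ((x - s n) - l)) \<longlonglongrightarrow> 0"
      using Y.complete[of "\<lambda>k. x - s k"] xs by blast
    \<comment> \<open>The limit l is taken in Y, while \<open>s\<close> tends to 0 in X. Both
      statements are pushed down to the ambient norm, where limits are unique, to obtain x =
      l.\<close>
    have "(\<lambda>n. (x - s n) - l) \<longlonglongrightarrow> 0"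
    proof (rule Lim_null_comparison)
      show "\<forall>\<^sub>F n in sequentially. norm ((x - s n) - l) \<le> cY * nrm Y ((x - s n) - l)"
        using cY xs l by (intro always_eventually) blast
      show "(\<lambda>n. cY * nrm Y ((x - s n) - l)) \<longlonglongrightarrow> 0"
        by (rule tendsto_mult_right_zero[OF l(2)])
    qed
    moreover have "s \<longlonglongrightarrow> 0"
    proof (rule Lim_null_comparison)
      show "\<forall>\<^sub>F n in sequentially. norm (s n) \<le> (\<bar>cX\<bar> * r) * (1/2)^n"
      proof (intro always_eventually allI)
        fix n
        have "norm (s n) \<le> \<bar>cX\<bar> * nrm X (s n)"
          using cX[of "s n"] s[of n] mult_right_mono[OF abs_ge_self X.nrm_nonneg] by (meson order_trans)
        also have "\<dots> \<le> \<bar>cX\<bar> * (r * (1/2)^n)"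
          using s[of n] by (intro mult_left_mono) auto
        finally show "norm (s n) \<le> (\<bar>cX\<bar> * r) * (1/2)^n" by (simp add: mult.assoc)
      qed
    qed (rule pow0)
    ultimately have "(\<lambda>n. ((x - s n) - l) + s n) \<longlonglongrightarrow> 0 + 0"
      by (rule tendsto_add)
    then have "x = l"
      by (simp add: LIMSEQ_const_iff)
    moreover have "nrm Y (x - s n) \<le> 2 * N" for n
      using tail[of 0 n] N0 mult_left_mono[of "1 - (1/2)^n" 1 "2 * N"] by (simp add: s0)
    ultimately show ?thesis
      using Y.nrm_lim_le[OF l(2), of "2 * N"] xs l(1) by auto
  qed
  have "nrm Y x \<le> 4 * N / r * nrm X x" if x: "x \<in> carr X" for x
  proof (cases "x = 0")
    case False
    then have pos: "nrm X x > 0"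
      using X.nrm_eq_0[OF x] X.nrm_nonneg[of x] by linarith
    define c where "c = r / (2 * nrm X x)"
    have c: "c > 0" using pos r(1) by (simp add: c_def)
    have "nrm X (c *\<^sub>R x) < r"
      using X.nrm_scale[OF x, of c] c pos r(1) by (simp add: c_def)
    then have "nrm Y (c *\<^sub>R x) \<le> 2 * N"
      using unit x by blast
    then have "c * nrm Y x \<le> 2 * N"
      using Y.nrm_scale[of x c] c x sub by auto
    then show ?thesis
      using pos r(1) by (simp add: c_def field_simps)
  qed simp
  then show ?thesis
    unfolding cont_embedded_def using sub by blast
qed

text \<open>Baire's theorem gives a ball on which all \<open>S n\<close> are bounded by one N; a
  vector of length r is the difference of two points of that ball, whence the factor 2N/r. Sequences
  suffice, because it is applied to times tending to 0 along which the operator norms are assumed to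
  blow up.\<close>

lemma uniform_boundedness:
  fixes S :: "nat \<Rightarrow> 'x::banach \<Rightarrow>\<^sub>L 'y::real_normed_vector"
  assumes bdd: "\<And>x. bounded (range (\<lambda>n. S n x))"
  shows "bounded (range S)"
proof -
  define B where "B N = (\<Inter>n. {x. norm (S n x) \<le> real N})" for N :: nat
  have closed: "closed (B N)" for N
    unfolding B_def by (intro closed_INT ballI closed_Collect_le continuous_intros)
  have "UNIV \<subseteq> (\<Union>N. B N)"
  proof
    fix x :: 'x
    obtain b where "\<And>n. norm (S n x) \<le> b"
      using bdd[of x] by (auto simp: bounded_iff)
    moreover obtain N :: nat where "b \<le> real N" using real_arch_simple by blast
    ultimately have "x \<in> B N" by (force simp: B_def intro: order_trans)
    then show "x \<in> (\<Union>N. B N)" by blast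
  qed
  then have cover: "(\<Inter>N. - B N) = {}" by blast
  have "\<exists>N. interior (B N) \<noteq> {}"
  proof (rule ccontr)
    assume "\<nexists>N. interior (B N) \<noteq> {}"
    then have "closure (- B N) = UNIV" for N
      by (simp add: closure_complement)
    then have "Met_TC.mtopology closure_of (\<Inter>(range (\<lambda>N. - B N))) = UNIV"
      using closed by (intro Met_TC.metric_Baire_category) (auto simp: complete_UNIV open_Compl)
    then show False unfolding cover by simp
  qed
  then obtain N x0 r where r: "r > 0" "cball x0 r \<subseteq> B N"
    by (metis ex_in_conv mem_interior_cball)
  have "norm (S n) \<le> 2 * real N / r" for n
  proof (rule norm_blinfun_bound)
    show "0 \<le> 2 * real N / r" using r by simp
    fix x :: 'x
    show "norm (S n x) \<le> 2 * real N / r * norm x"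
    proof (cases "x = 0")
      case False
      define y where "y = (r / norm x) *\<^sub>R x"
      have "x0 \<in> cball x0 r" "x0 + y \<in> cball x0 r"
        using r False by (auto simp: y_def dist_norm)
      then have "x0 \<in> B N" "x0 + y \<in> B N"
        using r(2) by blast+
      then have "norm (S n x0) \<le> N" "norm (S n (x0 + y)) \<le> N"
        by (auto simp: B_def)
      then have "norm (S n y) \<le> 2 * N"
        using norm_triangle_ineq4[of "S n (x0 + y)" "S n x0"] by (simp add: blinfun.add_right)
      then show ?thesis
        using r False by (simp add: y_def blinfun.scaleR_right field_simps)
    qed (simp add: blinfun.zero_right)
  qed
  then show ?thesis
    by (auto simp: bounded_iff)
qed

section \<open>Analytic semigroups\<close>

text \<open>Cauchy's estimate for the first derivative of a vector-valued holomorphic function. With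
  \<open>G \<rho> = \<integral> e\<^sup>-\<^sup>i\<^sup>\<theta> \<phi>(w + \<rho>e\<^sup>i\<^sup>\<theta>) d\<theta>\<close> and \<open>H \<rho> = \<integral> \<phi>'(w + \<rho>e\<^sup>i\<^sup>\<theta>) d\<theta>\<close>, differentiation under the
  integral gives \<open>G' = H\<close> and integration by parts gives \<open>G \<rho> = \<rho> H \<rho>\<close>, so that \<open>H\<close> is constant.\<close>

lemma cauchy_estimate:
  fixes csc :: "complex \<Rightarrow> 'x::banach \<Rightarrow> 'x" and \<phi> :: "complex \<Rightarrow> 'x"
  assumes bil: "bounded_bilinear csc"
    and csc_real: "\<And>r x. csc (of_real r) x = r *\<^sub>R x"
    and csc_mult: "\<And>a b x. csc (a * b) x = csc a (csc b x)"
    and bnd: "\<And>a x. norm (csc a x) \<le> k * cmod a * norm x" and k: "0 \<le> k"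
    and R: "R > 0"
    and der: "\<And>z. z \<in> cball w R \<Longrightarrow> (\<phi> has_derivative (\<lambda>h. csc h (d z))) (at z)"
    and cont: "continuous_on (cball w R) d"
    and M: "\<And>z. z \<in> cball w R \<Longrightarrow> norm (\<phi> z) \<le> M"
  shows "norm (d w) \<le> k * M / R"
proof -
  interpret bounded_bilinear csc by (rule bil)
  have csc1: "csc 1 x = x" for x using csc_real[of 1 x] by simp
  define e where "e \<theta> = exp (\<i> * of_real \<theta>)" for \<theta> :: real
  define e' where "e' \<theta> = exp (- (\<i> * of_real \<theta>))" for \<theta> :: real
  have e_e': "e' \<theta> * e \<theta> = 1" for \<theta> by (simp add: e_def e'_def flip: exp_add)
  have norm_e: "cmod (e \<theta>) = 1" "cmod (e' \<theta>) = 1" for \<theta> by (simp_all add: e_def e'_def)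
  have e_der: "(e has_vector_derivative (\<i> * e \<theta>)) (at \<theta> within A)"
    and e'_der: "(e' has_vector_derivative (- \<i> * e' \<theta>)) (at \<theta> within A)" for \<theta> A
    unfolding e_def e'_def by (auto intro!: derivative_eq_intros has_vector_derivative_real_field)
  have e_cont [continuous_intros]: "continuous_on A (\<lambda>x. e (g x))" "continuous_on A (\<lambda>x. e' (g x))"
    if "continuous_on A g" for A and g :: "'z::topological_space \<Rightarrow> real"
    unfolding e_def e'_def by (intro continuous_intros that)+
  define p where "p \<rho> \<theta> = w + of_real \<rho> * e \<theta>" for \<rho> \<theta>
  have p_in: "p \<rho> \<theta> \<in> cball w R" if "\<rho> \<in> {0..R}" for \<rho> \<theta>
    using that by (simp add: p_def dist_norm norm_mult norm_e)
  have p_cont: "continuous_on A (\<lambda>x. p (g x) (h x))" if "continuous_on A g" "continuous_on A h"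
    for A and g h :: "'z::topological_space \<Rightarrow> real"
    unfolding p_def by (intro continuous_intros that)
  have \<phi>_cont: "continuous_on (cball w R) \<phi>"
    by (rule has_derivative_continuous_on[OF has_derivative_at_withinI[OF der]])
  define G where "G \<rho> = integral {0..2*pi} (\<lambda>\<theta>. csc (e' \<theta>) (\<phi> (p \<rho> \<theta>)))" for \<rho>
  define H where "H \<rho> = integral {0..2*pi} (\<lambda>\<theta>. d (p \<rho> \<theta>))" for \<rho>
  have comp_cont: "continuous_on A (\<lambda>x. \<phi> (p (g x) (h x)))" "continuous_on A (\<lambda>x. d (p (g x) (h x)))"
    if "continuous_on A g" "continuous_on A h" "g ` A \<subseteq> {0..R}" for A and g h :: "'z::topological_space \<Rightarrow> real"
  proof -
    have "(\<lambda>x. p (g x) (h x)) ` A \<subseteq> cball w R"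
      using that(3) p_in by blast
    then show "continuous_on A (\<lambda>x. \<phi> (p (g x) (h x)))" "continuous_on A (\<lambda>x. d (p (g x) (h x)))"
      using continuous_on_compose2[OF \<phi>_cont p_cont[OF that(1,2)]]
        continuous_on_compose2[OF cont p_cont[OF that(1,2)]] by auto
  qed
  have csc_cont: "continuous_on A (\<lambda>x. csc (g x) (h x))" if "continuous_on A g" "continuous_on A h"
    for A and g :: "'z::topological_space \<Rightarrow> complex" and h
    by (rule continuous_on[OF that])
  have G_der: "(G has_vector_derivative H \<rho>) (at \<rho> within {0..R})" if "\<rho> \<in> {0..R}" for \<rho>
  proof -
    have "((\<lambda>\<rho>. integral (cbox 0 (2*pi)) (\<lambda>\<theta>. csc (e' \<theta>) (\<phi> (p \<rho> \<theta>)))) has_vector_derivative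
             integral (cbox 0 (2*pi)) (\<lambda>\<theta>. d (p \<rho> \<theta>))) (at \<rho> within {0..R})"
    proof (rule leibniz_rule_vector_derivative)
      fix r \<theta> assume r: "r \<in> {0..R}"
      have p: "((\<lambda>r. p r \<theta>) has_vector_derivative e \<theta>) (at r within {0..R})"
        unfolding p_def by (auto intro!: derivative_eq_intros simp: has_vector_derivative_def scaleR_conv_of_real)
      have "((\<lambda>r. \<phi> (p r \<theta>)) has_derivative (\<lambda>x. csc (x *\<^sub>R e \<theta>) (d (p r \<theta>)))) (at r within {0..R})"
        using has_derivative_compose[OF p[unfolded has_vector_derivative_def] der[OF p_in[OF r]]] .
      then have "((\<lambda>r. csc (e' \<theta>) (\<phi> (p r \<theta>))) has_derivative (\<lambda>x. csc (e' \<theta>) (csc (x *\<^sub>R e \<theta>) (d (p r \<theta>))))) (at r within {0..R})"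
        by (rule bounded_linear.has_derivative[OF bounded_linear_right])
      \<comment> \<open>The weight \<open>e'\<close> in G cancels the factor \<open>e\<close> that
        the chain rule produces in the radial direction, so the integrand of H remains.\<close>
      moreover have "csc (e' \<theta>) (csc (x *\<^sub>R e \<theta>) y) = x *\<^sub>R y" for x y
        by (simp add: csc_mult[symmetric] scaleR_left e_e' csc1 flip: scaleR_right)
      ultimately show "((\<lambda>r. csc (e' \<theta>) (\<phi> (p r \<theta>))) has_vector_derivative d (p r \<theta>)) (at r within {0..R})"
        by (simp add: has_vector_derivative_def)
    next
      fix r assume "r \<in> {0..R}"
      then show "(\<lambda>\<theta>. csc (e' \<theta>) (\<phi> (p r \<theta>))) integrable_on cbox 0 (2*pi)"
        by (intro integrable_continuous csc_cont continuous_intros comp_cont) auto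
    next
      have "continuous_on ({0..R} \<times> cbox 0 (2 * pi)) (\<lambda>x. d (p (fst x) (snd x)))"
        by (intro comp_cont continuous_intros) auto
      then show "continuous_on ({0..R} \<times> cbox 0 (2 * pi)) (\<lambda>(\<rho>, \<theta>). d (p \<rho> \<theta>))"
        by (simp add: case_prod_beta)
    qed (use that in auto)
    then show ?thesis by (simp add: G_def[abs_def] H_def)
  qed
  have GH: "G \<rho> = \<rho> *\<^sub>R H \<rho>" if \<rho>: "\<rho> \<in> {0..R}" for \<rho>
  proof -
    \<comment> \<open>In the angular direction the same integrand is a primitive: its derivative is
      -i times (integrand of G minus \<rho> times integrand of H). The boundary terms agree by
      periodicity, and multiplication by i removes the factor.\<close>
    have "((\<lambda>\<theta>. csc (- \<i>) (csc (e' \<theta>) (\<phi> (p \<rho> \<theta>)) - \<rho> *\<^sub>R d (p \<rho> \<theta>))) has_integral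
        (csc (e' (2*pi)) (\<phi> (p \<rho> (2*pi))) - csc (e' 0) (\<phi> (p \<rho> 0)))) {0..2*pi}"
    proof (rule fundamental_theorem_of_calculus)
      fix \<theta> assume "\<theta> \<in> {0..2*pi}"
      have p: "(p \<rho> has_vector_derivative \<rho> *\<^sub>R (\<i> * e \<theta>)) (at \<theta> within {0..2*pi})"
        unfolding p_def by (auto intro!: derivative_eq_intros e_der simp: scaleR_conv_of_real)
      have c: "((\<lambda>\<theta>. \<phi> (p \<rho> \<theta>)) has_derivative (\<lambda>x. csc (x *\<^sub>R \<rho> *\<^sub>R (\<i> * e \<theta>)) (d (p \<rho> \<theta>)))) (at \<theta> within {0..2*pi})"
        using has_derivative_compose[OF p[unfolded has_vector_derivative_def] der[OF p_in[OF \<rho>]]] .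
      have "((\<lambda>\<theta>. csc (e' \<theta>) (\<phi> (p \<rho> \<theta>))) has_derivative
          (\<lambda>x. csc (e' \<theta>) (csc (x *\<^sub>R \<rho> *\<^sub>R (\<i> * e \<theta>)) (d (p \<rho> \<theta>))) + csc (x *\<^sub>R (- \<i> * e' \<theta>)) (\<phi> (p \<rho> \<theta>)))) (at \<theta> within {0..2*pi})"
        by (rule FDERIV[OF e'_der[unfolded has_vector_derivative_def] c])
      moreover have "csc (e' \<theta>) (csc (x *\<^sub>R \<rho> *\<^sub>R (\<i> * e \<theta>)) y) + csc (x *\<^sub>R (- \<i> * e' \<theta>)) z =
          x *\<^sub>R csc (- \<i>) (csc (e' \<theta>) z - \<rho> *\<^sub>R y)" for x y z
      proof -
        have "e' \<theta> * (x *\<^sub>R \<rho> *\<^sub>R (\<i> * e \<theta>)) = of_real (x * \<rho>) * \<i>"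
          using e_e'[of \<theta>] by (simp add: scaleR_conv_of_real algebra_simps)
        then have "csc (e' \<theta>) (csc (x *\<^sub>R \<rho> *\<^sub>R (\<i> * e \<theta>)) y) = csc (of_real (x * \<rho>)) (csc \<i> y)"
          by (simp only: csc_mult[symmetric])
        then have "csc (e' \<theta>) (csc (x *\<^sub>R \<rho> *\<^sub>R (\<i> * e \<theta>)) y) = x *\<^sub>R \<rho> *\<^sub>R csc \<i> y"
          by (simp only: csc_real scaleR_scaleR)
        moreover have "csc (x *\<^sub>R (- \<i> * e' \<theta>)) z = x *\<^sub>R csc (- \<i>) (csc (e' \<theta>) z)"
          by (simp only: scaleR_left csc_mult)
        ultimately show ?thesis
          by (simp add: diff_right scaleR_right minus_left scaleR_diff_right scaleR_minus_right)
      qed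
      ultimately show "((\<lambda>\<theta>. csc (e' \<theta>) (\<phi> (p \<rho> \<theta>))) has_vector_derivative
          csc (- \<i>) (csc (e' \<theta>) (\<phi> (p \<rho> \<theta>)) - \<rho> *\<^sub>R d (p \<rho> \<theta>))) (at \<theta> within {0..2*pi})"
        by (simp add: has_vector_derivative_def)
    qed simp
    moreover have "e (2*pi) = e 0" "e' (2*pi) = e' 0"
      unfolding e_def e'_def using exp_two_pi_i by (simp_all add: exp_minus mult.commute)
    ultimately have 1: "((\<lambda>\<theta>. csc (- \<i>) (csc (e' \<theta>) (\<phi> (p \<rho> \<theta>)) - \<rho> *\<^sub>R d (p \<rho> \<theta>))) has_integral 0) {0..2*pi}"
      by (simp add: p_def)
    have i1: "((\<lambda>\<theta>. csc (e' \<theta>) (\<phi> (p \<rho> \<theta>))) has_integral G \<rho>) {0..2*pi}"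
      unfolding G_def using \<rho>
      by (intro integrable_integral integrable_continuous_interval csc_cont continuous_intros comp_cont) auto
    have i2: "((\<lambda>\<theta>. d (p \<rho> \<theta>)) has_integral H \<rho>) {0..2*pi}"
      unfolding H_def using \<rho>
      by (intro integrable_integral integrable_continuous_interval continuous_intros comp_cont) auto
    have "((\<lambda>\<theta>. csc \<i> (csc (- \<i>) (csc (e' \<theta>) (\<phi> (p \<rho> \<theta>)) - \<rho> *\<^sub>R d (p \<rho> \<theta>)))) has_integral csc \<i> 0) {0..2*pi}"
      using has_integral_linear[OF 1 bounded_linear_right[of \<i>]] by (simp add: o_def)
    then have "((\<lambda>\<theta>. csc (e' \<theta>) (\<phi> (p \<rho> \<theta>)) - \<rho> *\<^sub>R d (p \<rho> \<theta>)) has_integral 0) {0..2*pi}"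
      by (simp add: csc_mult[symmetric] csc1 zero_right)
    moreover have "((\<lambda>\<theta>. csc (e' \<theta>) (\<phi> (p \<rho> \<theta>)) - \<rho> *\<^sub>R d (p \<rho> \<theta>)) has_integral G \<rho> - \<rho> *\<^sub>R H \<rho>) {0..2*pi}"
      by (intro has_integral_diff i1 has_integral_cmul i2)
    ultimately have "0 = G \<rho> - \<rho> *\<^sub>R H \<rho>"
      by (rule has_integral_unique)
    then show ?thesis by simp
  qed
  have H_cont: "continuous_on {0..R} H"
  proof -
    have "continuous_on ({0..R} \<times> cbox 0 (2 * pi)) (\<lambda>x. d (p (fst x) (snd x)))"
      by (intro comp_cont continuous_intros) auto
    then have "continuous_on {0..R} (\<lambda>\<rho>. integral (cbox 0 (2*pi)) (\<lambda>\<theta>. d (p \<rho> \<theta>)))"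
      by (intro integral_continuous_on_param) (simp add: case_prod_beta)
    then show ?thesis by (simp add: H_def[abs_def])
  qed
  \<comment> \<open>With H = G/\<rho> and G' = H the product rule gives H/\<rho> - G/\<rho>^2 = 0.
    The quotient is defined only for \<rho> > 0, so constancy up to \<rho> = 0 uses the continuity
    of H.\<close>
  have H_der: "(H has_derivative (\<lambda>h. 0)) (at \<rho>)" if "\<rho> \<in> {0<..<R}" for \<rho>
  proof -
    have "(G has_vector_derivative H \<rho>) (at \<rho>)"
      using G_der[of \<rho>] that at_within_Icc_at[of 0 \<rho> R] by auto
    then have "((\<lambda>r. inverse r *\<^sub>R G r) has_vector_derivative
        (inverse \<rho> *\<^sub>R H \<rho> + (- (inverse \<rho> * inverse \<rho>)) *\<^sub>R G \<rho>)) (at \<rho>)"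
      using that by (intro has_vector_derivative_scaleR) (auto intro!: derivative_eq_intros simp: power2_eq_square)
    then have "((\<lambda>r. inverse r *\<^sub>R G r) has_derivative (\<lambda>h. 0)) (at \<rho>)"
      using GH[of \<rho>] that by (simp add: has_vector_derivative_def mult.assoc)
    then show ?thesis
      by (rule has_derivative_transform_within_open[of _ _ _ _ "{0<..<R}"]) (use that GH in auto)
  qed
  have "(H has_derivative (\<lambda>h. 0)) (at \<rho> within {0..R})" if "\<rho> \<in> {0..R} - {0, R}" for \<rho>
    by (rule has_derivative_at_withinI[OF H_der]) (use that in auto)
  then have "H R = H 0"
    using has_derivative_zero_unique_strong_interval[OF _ H_cont refl, of "{0, R}" R] R by simp
  moreover have "H 0 = (2 * pi) *\<^sub>R d w"
    by (simp add: H_def p_def)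
  ultimately have "G R = (R * (2 * pi)) *\<^sub>R d w"
    using GH[of R] R by simp
  moreover have "norm (G R) \<le> k * M * (2 * pi - 0)"
    unfolding G_def
  proof (rule integral_bound)
    show "continuous_on {0..2*pi} (\<lambda>\<theta>. csc (e' \<theta>) (\<phi> (p R \<theta>)))"
      using R by (intro csc_cont continuous_intros comp_cont) auto
    fix \<theta>
    have "norm (csc (e' \<theta>) (\<phi> (p R \<theta>))) \<le> k * 1 * norm (\<phi> (p R \<theta>))"
      using bnd[of "e' \<theta>"] norm_e by metis
    also have "\<dots> \<le> k * M"
      using M[OF p_in[of R]] R k by (simp add: mult_left_mono)
    finally show "norm (csc (e' \<theta>) (\<phi> (p R \<theta>))) \<le> k * M" .
  qed simp
  ultimately have "(R * (2 * pi)) * norm (d w) \<le> (k * M) * (2 * pi)"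
    using R by (simp add: abs_mult)
  then have "R * norm (d w) \<le> k * M"
    using mult_le_cancel_right_pos[of "2 * pi" "R * norm (d w)" "k * M"] by (simp add: mult_ac)
  then show ?thesis
    using R by (simp add: field_simps)
qed

lemma has_vector_derivative_iff_quotient:
  "(f has_vector_derivative D) (at t) \<longleftrightarrow> ((\<lambda>h. (f (t + h) - f t) /\<^sub>R h) \<longlongrightarrow> D) (at 0)"
proof -
  have "((\<lambda>h. (f (t + h) - f t) /\<^sub>R h) \<longlongrightarrow> D) (at 0) \<longleftrightarrow>
      ((\<lambda>h. norm ((f (t + h) - f t) /\<^sub>R h - D)) \<longlongrightarrow> 0) (at 0)"
    by (simp add: tendsto_norm_zero_iff LIM_zero_iff)
  also have "\<dots> \<longleftrightarrow> ((\<lambda>h. norm (f (t + h) - f t - h *\<^sub>R D) / norm h) \<longlongrightarrow> 0) (at 0)"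
  proof (rule filterlim_cong)
    show "\<forall>\<^sub>F h in at 0. norm ((f (t + h) - f t) /\<^sub>R h - D) = norm (f (t + h) - f t - h *\<^sub>R D) / norm h"
    proof (rule eventually_mono[OF eventually_neq_at_within])
      fix h :: real assume h: "h \<noteq> 0"
      then have "(f (t + h) - f t) /\<^sub>R h - D = (f (t + h) - f t - h *\<^sub>R D) /\<^sub>R h"
        by (simp add: scaleR_diff_right)
      then show "norm ((f (t + h) - f t) /\<^sub>R h - D) = norm (f (t + h) - f t - h *\<^sub>R D) / norm h"
        by (simp add: divide_inverse)
    qed
  qed auto
  finally show ?thesis
    by (simp add: has_vector_derivative_def has_derivative_at bounded_linear_scaleR_left)
qed

text \<open>As \<delta> \<le> pi/2 < 2, the radius is at most s/2, so the real part stays above s/2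
  while the imaginary part is at most s\<delta>/4. Hence the slope is at most \<delta>/2, and arctan
  does not exceed its argument.\<close>

lemma sector_contains_cball:
  assumes "s > 0" "0 < \<delta>" "\<delta> \<le> pi / 2" "cmod (w - of_real s) \<le> s * \<delta> / 4"
  shows "w \<in> sector \<delta>"
proof -
  have "pi < 4" using pi_half_less_two by simp
  then have "\<delta> / 4 \<le> 1 / 2" using assms(3) by simp
  then have s: "s * \<delta> / 4 \<le> s / 2" using assms(1) mult_left_mono[of "\<delta> / 4" "1 / 2" s] by simp
  have "\<bar>Re w - s\<bar> \<le> s / 2"
    using abs_Re_le_cmod[of "w - of_real s"] order_trans[OF assms(4) s] by simp
  then have Re: "Re w \<ge> s / 2" by linarith
  have Im: "\<bar>Im w\<bar> \<le> s * \<delta> / 4"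
    using abs_Im_le_cmod[of "w - of_real s"] assms(4) by simp
  have pos: "Re w > 0" using Re assms(1) by simp
  have "\<bar>Arg w\<bar> = \<bar>arctan (Im w / Re w)\<bar>"
    using pos by (simp add: arg_conv_arctan)
  also have "\<dots> \<le> \<bar>Im w / Re w\<bar>" by (rule abs_arctan_le)
  also have "\<dots> \<le> (s * \<delta> / 4) / (s / 2)"
    using frac_le[OF _ Im _ Re] pos assms(1,2) by (simp add: abs_divide)
  also have "\<dots> < \<delta>" using assms(1,2) by simp
  finally show ?thesis using pos by (auto simp: sector_def)
qed

text \<open>Cauchy's estimate on a disc about t of radius proportional to t gives the factor 1/t.
  The bound M near the vertex of the sector comes from strong continuity and
  \<open>uniform_boundedness\<close>. The derivative is stated as a right limit of quotients because
  that is the form in which the generator is defined.\<close>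

lemma analytic_semigroup_derivative_bound:
  fixes csc :: "complex \<Rightarrow> 'x::banach \<Rightarrow> 'x" and \<tau> :: "real \<Rightarrow> 'x \<Rightarrow> 'x"
  assumes an: "analytic_semigroup csc \<tau>"
    and bil: "bounded_bilinear csc"
    and csc_real: "\<And>r x. csc (of_real r) x = r *\<^sub>R x"
    and csc_mult: "\<And>a b x. csc (a * b) x = csc a (csc b x)"
    and bnd: "\<And>a x. norm (csc a x) \<le> k * cmod a * norm x" and k: "0 \<le> k"
  shows "\<exists>r>0. \<exists>C. \<forall>t\<in>{0<..r}. \<forall>x. \<exists>y.
      ((\<lambda>h. (\<tau> (t + h) x - \<tau> t x) /\<^sub>R h) \<longlongrightarrow> y) (at_right 0) \<and> norm y \<le> C / t * norm x"
proof -
  obtain \<delta> and S :: "complex \<Rightarrow> 'x \<Rightarrow>\<^sub>L 'x" where \<delta>: "0 < \<delta>" "\<delta> \<le> pi / 2"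
    and S\<tau>': "\<forall>t\<ge>0. blinfun_apply (S (of_real t)) = \<tau> t"
    and Slin': "\<forall>z\<in>sector \<delta>. \<forall>a x. S z (csc a x) = csc a (S z x)"
    and Sadd': "\<forall>z\<in>sector \<delta>. \<forall>w\<in>sector \<delta>. S (z + w) = S z o\<^sub>L S w"
    and Sder': "\<forall>z\<in>sector \<delta>. \<exists>L. (S has_derivative L) (at z) \<and> (\<forall>a h x. L (a * h) x = csc a (L h x))"
    and S0': "\<forall>x. ((\<lambda>z. S z x) \<longlongrightarrow> x) (at 0 within sector \<delta>)"
    using an unfolding analytic_semigroup_def by (elim exE conjE) (rule that)
  note S\<tau> = S\<tau>'[rule_format] and Slin = Slin'[rule_format] and Sadd = Sadd'[rule_format]
    and Sder = Sder'[rule_format] and S0 = S0'[rule_format]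
  have "\<exists>M. \<exists>r>0. \<forall>z\<in>sector \<delta>. cmod z < r \<longrightarrow> norm (S z) \<le> M"
  proof (rule ccontr)
    assume "\<not> ?thesis"
    then have "\<exists>z\<in>sector \<delta>. cmod z < inverse (real (Suc n)) \<and> norm (S z) > real n" for n
      by (force simp: not_le)
    then obtain z where z: "\<And>n. z n \<in> sector \<delta>" "\<And>n. cmod (z n) < inverse (real (Suc n))" "\<And>n. norm (S (z n)) > real n"
      by metis
    have "z \<longlonglongrightarrow> 0"
      by (rule Lim_null_comparison[OF always_eventually LIMSEQ_inverse_real_of_nat]) (use z(2) less_imp_le in blast)
    moreover have "z n \<noteq> 0" for n using z(1)[of n] by (auto simp: sector_def)
    ultimately have "filterlim z (at 0 within sector \<delta>) sequentially"
      using z(1) by (auto simp: filterlim_at)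
    then have "(\<lambda>n. S (z n) x) \<longlonglongrightarrow> x" for x
      using filterlim_compose[OF S0] by blast
    then have "bounded (range (\<lambda>n. S (z n) x))" for x
      using convergent_imp_bounded by blast
    then have "bounded (range (\<lambda>n. S (z n)))"
      by (rule uniform_boundedness)
    then obtain b where b: "\<And>n. norm (S (z n)) \<le> b"
      by (auto simp: bounded_iff)
    obtain n :: nat where "b \<le> real n" using real_arch_simple by blast
    then show False using b[of n] z(3)[of n] by linarith
  qed
  then obtain M r where r: "r > 0" and M: "\<And>z. z \<in> sector \<delta> \<Longrightarrow> cmod z < r \<Longrightarrow> norm (S z) \<le> M"
    by blast
  have "\<exists>y. ((\<lambda>h. (\<tau> (t + h) x - \<tau> t x) /\<^sub>R h) \<longlongrightarrow> y) (at_right 0) \<and> norm y \<le> (8 * k * M / \<delta>) / t * norm x"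
    if t: "t \<in> {0<..r/2}" for t x
  proof -
    \<comment> \<open>Moved by -z0, the disc of radius \<rho> about t becomes the disc about t/2
      that \<open>sector_contains_cball\<close> keeps inside the sector.\<close>
    define z0 :: complex where "z0 = of_real (t / 2)"
    define \<rho> where "\<rho> = t * \<delta> / 8"
    have \<rho>: "\<rho> > 0" using t \<delta> by (simp add: \<rho>_def)
    have shift: "z - z0 \<in> sector \<delta>" if "z \<in> cball (of_real t) \<rho>" for z
    proof (rule sector_contains_cball[of "t/2"])
      have "cmod (z - z0 - of_real (t/2)) = cmod (z - of_real t)"
        by (simp add: z0_def)
      then show "cmod (z - z0 - of_real (t/2)) \<le> t / 2 * \<delta> / 4"
        using that by (simp only:) (simp add: \<rho>_def dist_norm norm_minus_commute)
    qed (use t \<delta> in auto)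
    have z0: "z0 \<in> sector \<delta>"
      using t \<delta> by (intro sector_contains_cball[of "t/2"]) (auto simp: z0_def)
    obtain L0 where L0: "(S has_derivative L0) (at z0)" and L0c: "\<And>a h x. L0 (a * h) x = csc a (L0 h x)"
      using Sder[OF z0] by blast
    \<comment> \<open>Near z the semigroup law gives S z' = S (z - z0) S (z' - (z - z0)), and the
      second factor is differentiated at the fixed point z0. The derivative is therefore
      \<open>d\<close>, which is continuous because S is; \<open>cauchy_estimate\<close> asks for
      this continuity, while the definition of analyticity provides differentiability.\<close>
    define d where "d z = S (z - z0) (L0 1 x)" for z
    have der: "((\<lambda>z. S z x) has_derivative (\<lambda>h. csc h (d z))) (at z)" if z: "z \<in> cball (of_real t) \<rho>" for z
    proof -
      have "((\<lambda>z'. S (z' - (z - z0))) has_derivative L0) (at z)"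
      proof -
        have "((\<lambda>z'. z' - (z - z0)) has_derivative (\<lambda>h. h)) (at z)"
          by (auto intro!: derivative_eq_intros)
        from has_derivative_compose[OF this, of S L0] L0 show ?thesis by simp
      qed
      then have "((\<lambda>z'. S (z' - (z - z0)) x) has_derivative (\<lambda>h. L0 h x)) (at z)"
        by (rule bounded_linear.has_derivative[OF blinfun.bounded_linear_left])
      then have "((\<lambda>z'. S (z - z0) (S (z' - (z - z0)) x)) has_derivative (\<lambda>h. S (z - z0) (L0 h x))) (at z)"
        by (rule bounded_linear.has_derivative[OF blinfun.bounded_linear_right])
      moreover have "S (z - z0) (L0 h x) = csc h (d z)" for h
        using L0c[of h 1] Slin[OF shift[OF z]] by (simp add: d_def)
      ultimately have "((\<lambda>z'. S (z - z0) (S (z' - (z - z0)) x)) has_derivative (\<lambda>h. csc h (d z))) (at z)"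
        by simp
      then show ?thesis
      proof (rule has_derivative_transform_within_open)
        show "open (ball z \<rho>)" "z \<in> ball z \<rho>" using \<rho> by auto
        fix z' assume z': "z' \<in> ball z \<rho>"
        have "z' - (z - z0) \<in> sector \<delta>"
        proof (rule sector_contains_cball[of "t/2"])
          have "cmod (z' - (z - z0) - of_real (t/2)) = cmod (z' - z)" by (simp add: z0_def)
          then show "cmod (z' - (z - z0) - of_real (t/2)) \<le> t / 2 * \<delta> / 4"
            using z' by (simp only:) (simp add: \<rho>_def dist_norm norm_minus_commute)
        qed (use t \<delta> in auto)
        from Sadd[OF shift[OF z] this] show "S (z - z0) (S (z' - (z - z0)) x) = S z' x"
          by simp
      qed
    qed
    have "continuous_on (cball (of_real t) \<rho>) d"
    proof (rule continuous_at_imp_continuous_on, rule ballI)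
      fix z :: complex assume z: "z \<in> cball (of_real t) \<rho>"
      obtain L where "(S has_derivative L) (at (z - z0))"
        using Sder[OF shift[OF z]] by blast
      then have "isCont S (z - z0)" by (rule has_derivative_continuous)
      then have "isCont (\<lambda>z. S (z - z0)) z"
        by (rule isCont_o2[of z "\<lambda>z. z - z0" S, rotated]) (intro continuous_intros)
      then show "isCont d z"
        unfolding d_def by (rule bounded_linear.isCont[OF blinfun.bounded_linear_left])
    qed
    moreover have "norm (S z x) \<le> M * norm x" if z: "z \<in> cball (of_real t) \<rho>" for z
    proof -
      have "\<delta> < 2" using \<delta>(2) pi_half_less_two by linarith
      then have "t * \<delta> \<le> t * 2" using t by (intro mult_left_mono) auto
      then have \<rho>t: "\<rho> < t" using t by (simp add: \<rho>_def)
      have dz: "cmod (z - of_real t) \<le> \<rho>"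
        using z by (simp add: dist_norm norm_minus_commute)
      then have "cmod z < r"
        using norm_triangle_ineq[of "z - of_real t" "of_real t"] t \<rho>t by simp
      moreover have "z \<in> sector \<delta>"
      proof (rule sector_contains_cball[of t])
        have "0 < t * \<delta>" using t \<delta> by simp
        then show "cmod (z - of_real t) \<le> t * \<delta> / 4"
          using dz unfolding \<rho>_def by linarith
      qed (use t \<delta> in auto)
      ultimately have "norm (S z) * norm x \<le> M * norm x"
        by (intro mult_right_mono M) auto
      then show ?thesis
        using norm_blinfun[of "S z" x] by linarith
    qed
    ultimately have "norm (d (of_real t)) \<le> k * (M * norm x) / \<rho>"
      using cauchy_estimate[where csc = csc and k = k and \<phi> = "\<lambda>z. S z x" and d = d and w = "of_real t"
          and R = \<rho> and M = "M * norm x"] bil csc_real csc_mult bnd k \<rho> der by blast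
    then have "norm (d (of_real t)) \<le> (8 * k * M / \<delta>) / t * norm x"
      using t \<delta> by (simp add: \<rho>_def field_simps)
    moreover have "((\<lambda>h. (\<tau> (t + h) x - \<tau> t x) /\<^sub>R h) \<longlongrightarrow> d (of_real t)) (at_right 0)"
    proof -
      have "((\<lambda>s. S (of_real s) x) has_derivative (\<lambda>h. csc (of_real h) (d (of_real t)))) (at t)"
        using \<rho> by (intro has_derivative_compose[where g = "\<lambda>z. S z x" and f = of_real, OF _ der])
          (auto intro!: derivative_eq_intros)
      then have "((\<lambda>s. S (of_real s) x) has_vector_derivative d (of_real t)) (at t)"
        by (simp add: has_vector_derivative_def csc_real)
      then have "((\<lambda>h. (S (of_real (t + h)) x - S (of_real t) x) /\<^sub>R h) \<longlongrightarrow> d (of_real t)) (at_right 0)"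
        unfolding has_vector_derivative_iff_quotient by (rule filterlim_mono) (auto simp: at_le)
      then show ?thesis
        by (rule tendsto_cong[THEN iffD1, rotated])
          (use t in \<open>auto simp: S\<tau> eventually_at intro!: exI[of _ 1] simp del: of_real_add\<close>)
    qed
    ultimately show ?thesis by blast
  qed
  then have "\<forall>t\<in>{0<..r/2}. \<forall>x. \<exists>y. ((\<lambda>h. (\<tau> (t + h) x - \<tau> t x) /\<^sub>R h) \<longlongrightarrow> y) (at_right 0) \<and>
      norm y \<le> (8 * k * M / \<delta>) / t * norm x"
    by (intro ballI allI)
  then show ?thesis
    using half_gt_zero[OF r] by (intro exI[of _ "r/2"] conjI exI[of _ "8 * k * M / \<delta>"])
qed

section \<open>Semigroups and their generators\<close>

text \<open>Riemann sums of f satisfy the bound because p is subadditive and homogeneous, and C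
  makes p continuous along their convergence. It is meant for p x = \<open>nrm X (T t x)\<close>
  with t > 0, which is bounded on E_0 although \<open>nrm X\<close> itself is not, and for majorants
  with a singular end point.\<close>

lemma seminorm_integral_bound:
  fixes f :: "real \<Rightarrow> 'e::banach" and p :: "'e \<Rightarrow> real"
  assumes add: "\<And>x y. p (x + y) \<le> p x + p y" and scale: "\<And>c x. p (c *\<^sub>R x) = \<bar>c\<bar> * p x"
    and bnd: "\<And>x. p x \<le> C * norm x"
    and f: "(f has_integral i) {a..b}" and g: "(g has_integral j) {a..b}"
    and le: "\<And>x. x \<in> {a<..<b} \<Longrightarrow> p (f x) \<le> g x"
  shows "p i \<le> j"
proof -
  \<comment> \<open>The hypothesis says nothing at the two end points, which may occur as tags;
    changing the majorant there to \<open>p (f x)\<close> leaves its integral unchanged.\<close>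
  define g' where "g' x = (if x \<in> {a, b} then p (f x) else g x)" for x
  have g': "(g' has_integral j) {a..b}"
    by (rule has_integral_spike_finite[OF _ _ g, of "{a, b}"]) (auto simp: g'_def)
  have le': "p (f x) \<le> g' x" if "x \<in> {a..b}" for x
    using le[of x] that by (auto simp: g'_def)
  have p0: "p 0 = 0" using scale[of 0 0] by simp
  have psum: "p (\<Sum>x\<in>I. h x) \<le> (\<Sum>x\<in>I. p (h x))" for I and h :: "real \<times> real set \<Rightarrow> 'e"
    by (induction I rule: infinite_finite_induct) (auto simp: p0 intro: order_trans[OF add])
  show ?thesis
  proof (rule field_le_epsilon)
    fix e :: real assume e: "e > 0"
    define d where "d = e / (1 + \<bar>C\<bar>)"
    have d: "d > 0" using e by (simp add: d_def)
    obtain G1 where G1: "gauge G1" "\<And>D. D tagged_division_of cbox a b \<Longrightarrow> G1 fine D \<Longrightarrow>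
        norm ((\<Sum>(x, k)\<in>D. measure lborel k *\<^sub>R f x) - i) < d"
      using f d unfolding has_integral[of f i a b, simplified] by (auto simp: cbox_interval)
    obtain G2 where G2: "gauge G2" "\<And>D. D tagged_division_of cbox a b \<Longrightarrow> G2 fine D \<Longrightarrow>
        norm ((\<Sum>(x, k)\<in>D. measure lborel k *\<^sub>R g' x) - j) < d"
      using g' d unfolding has_integral[of g' j a b, simplified] by (auto simp: cbox_interval)
    obtain D where D: "D tagged_division_of cbox a b" "(\<lambda>x. G1 x \<inter> G2 x) fine D"
      using fine_division_exists[OF gauge_Int[OF G1(1) G2(1)]] by blast
    define S where "S = (\<Sum>(x, k)\<in>D. measure lborel k *\<^sub>R f x)"
    have S: "norm (S - i) < d" "\<bar>(\<Sum>(x, k)\<in>D. measure lborel k *\<^sub>R g' x) - j\<bar> < d"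
      using G1(2)[OF D(1)] G2(2)[OF D(1)] D(2) by (auto simp: S_def fine_Int)
    have "p S \<le> (\<Sum>(x, k)\<in>D. measure lborel k *\<^sub>R g' x)"
    proof -
      have "p S \<le> (\<Sum>z\<in>D. p (case z of (x, k) \<Rightarrow> measure lborel k *\<^sub>R f x))"
        unfolding S_def by (rule psum)
      also have "\<dots> \<le> (\<Sum>(x, k)\<in>D. measure lborel k *\<^sub>R g' x)"
      proof (rule sum_mono)
        fix z assume z: "z \<in> D"
        obtain x k where zk: "z = (x, k)" by force
        have "x \<in> {a..b}" using tagged_division_ofD(2,3)[OF D(1), of x k] z zk by auto
        then show "p (case z of (x, k) \<Rightarrow> measure lborel k *\<^sub>R f x) \<le> (case z of (x, k) \<Rightarrow> measure lborel k *\<^sub>R g' x)"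
          using le'[of x] by (simp add: zk scale mult_left_mono)
      qed
      finally show ?thesis .
    qed
    then have "p S \<le> j + d" using S(2) by linarith
    moreover have "p (i - S) \<le> \<bar>C\<bar> * d"
    proof -
      have "p (i - S) \<le> \<bar>C\<bar> * norm (i - S)"
        using bnd[of "i - S"] mult_right_mono[OF abs_ge_self norm_ge_zero, of C "i - S"] by linarith
      also have "\<dots> \<le> \<bar>C\<bar> * d"
        using S(1) by (intro mult_left_mono) (auto simp: norm_minus_commute)
      finally show ?thesis .
    qed
    moreover have "p i \<le> p S + p (i - S)" using add[of S "i - S"] by simp
    moreover have "(1 + \<bar>C\<bar>) * d = e" by (simp add: d_def add_pos_nonneg)
    then have "d + \<bar>C\<bar> * d = e" by (simp add: distrib_right)
    ultimately show "p i \<le> j + e" by linarith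
  qed
qed

lemma has_vector_derivative_quotient_right:
  assumes "(f has_vector_derivative D) (at t within {t..b})" "t < b"
  shows "((\<lambda>h. (f (t + h) - f t) /\<^sub>R h) \<longlongrightarrow> D) (at_right 0)"
proof -
  have "((\<lambda>y. norm (f y - f t - (y - t) *\<^sub>R D) / norm (y - t)) \<longlongrightarrow> 0) (at_right t)"
    using assms by (simp add: has_vector_derivative_def has_derivative_iff_norm at_within_Icc_at_right)
  then have *: "((\<lambda>h. norm (f (h + t) - f t - h *\<^sub>R D) / norm h) \<longlongrightarrow> 0) (at_right 0)"
    by (subst (asm) filterlim_at_right_to_0) simp
  have "((\<lambda>h. (f (t + h) - f t) /\<^sub>R h - D) \<longlongrightarrow> 0) (at_right 0)"
  proof (rule Lim_null_comparison[OF _ *])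
    show "\<forall>\<^sub>F h in at_right 0. norm ((f (t + h) - f t) /\<^sub>R h - D) \<le> norm (f (h + t) - f t - h *\<^sub>R D) / norm h"
    proof (rule eventually_mono[OF eventually_neq_at_within])
      fix h :: real assume h: "h \<noteq> 0"
      then have "(f (t + h) - f t) /\<^sub>R h - D = (f (t + h) - f t - h *\<^sub>R D) /\<^sub>R h"
        by (simp add: scaleR_diff_right)
      then show "norm ((f (t + h) - f t) /\<^sub>R h - D) \<le> norm (f (h + t) - f t - h *\<^sub>R D) / norm h"
        by (simp add: divide_inverse add.commute mult.commute)
    qed
  qed
  then show ?thesis by (simp add: LIM_zero_iff)
qed

text \<open>The values of \<open>T\<close> at negative times are irrelevant; they are normalised to the identity
  so that \<open>T\<close> is strongly continuous on the whole line.\<close>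

locale analytic_generator = scalars K sc
  for K :: "complex set" and sc :: "complex \<Rightarrow> 'e::banach \<Rightarrow> 'e" +
  fixes E1 :: "'e nspace" and A :: "'e \<Rightarrow> 'e" and T :: "real \<Rightarrow> 'e \<Rightarrow>\<^sub>L 'e"
  assumes E1: "banach_subspace K sc E1"
    and E1_compact: "compactly_embedded E1 whole_space"
    and E1_dense: "dense_in E1 whole_space"
    and C0: "C0_semigroup K sc T"
    and gen: "is_generator T (carr E1) A"
    and T_neg: "\<And>t. t \<le> 0 \<Longrightarrow> T t = id_blinfun"
    and smoothing: "\<exists>r>0. \<exists>C. \<forall>t\<in>{0<..r}. \<forall>x. T t x \<in> carr E1 \<and> norm (A (T t x)) \<le> C / t * norm x"
begin

sublocale E1: normed_subspace K sc E1
  by unfold_locales (rule E1)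

lemma T_zero [simp]: "T 0 x = x"
  using T_neg[of 0] by simp

lemma T_sc: "a \<in> K \<Longrightarrow> T t (sc a x) = sc a (T t x)"
  using C0 T_neg[of t] by (cases "t \<ge> 0") (auto simp: C0_semigroup_def)

lemma T_add: "s \<ge> 0 \<Longrightarrow> t \<ge> 0 \<Longrightarrow> T (s + t) x = T s (T t x)"
  using C0 by (auto simp: C0_semigroup_def)

lemma T_commute: "s \<ge> 0 \<Longrightarrow> t \<ge> 0 \<Longrightarrow> T s (T t x) = T t (T s x)"
  using T_add[of s t x] T_add[of t s x] by (simp add: add.commute)

lemma T_right_cont: "((\<lambda>t. T t x) \<longlongrightarrow> x) (at_right 0)"
  using C0 by (auto simp: C0_semigroup_def)

text \<open>A short interval is handled by uniform boundedness, and each further step of length r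
  costs a factor M. No lower limit on t is imposed because T is the identity at negative
  times.\<close>

lemma T_bounded: "\<exists>M\<ge>1. \<forall>t\<le>\<tau>. norm (T t) \<le> M"
proof -
  have "\<exists>M. \<exists>r>0. \<forall>t. 0 < t \<and> t < r \<longrightarrow> norm (T t) \<le> M"
  proof (rule ccontr)
    assume contr: "\<nexists>M. \<exists>r>0. \<forall>t. 0 < t \<and> t < r \<longrightarrow> norm (T t) \<le> M"
    have "\<exists>t. 0 < t \<and> t < inverse (real (Suc n)) \<and> norm (T t) > real n" for n
    proof (rule ccontr)
      assume "\<not> ?thesis"
      then have "\<forall>t. 0 < t \<and> t < inverse (real (Suc n)) \<longrightarrow> norm (T t) \<le> real n"
        by (metis not_less)
      moreover have "inverse (real (Suc n)) > 0" by simp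
      ultimately show False using contr by blast
    qed
    then obtain t where t: "\<And>n. 0 < t n" "\<And>n. t n < inverse (real (Suc n))" "\<And>n. norm (T (t n)) > real n"
      by metis
    have "t \<longlonglongrightarrow> 0"
      by (rule Lim_null_comparison[OF always_eventually LIMSEQ_inverse_real_of_nat])
        (use t(1,2) in \<open>auto simp: less_imp_le\<close>)
    moreover have "t n \<noteq> 0" for n using t(1)[of n] by simp
    ultimately have "filterlim t (at_right 0) sequentially"
      using t(1) by (auto simp: filterlim_at)
    then have "(\<lambda>n. T (t n) x) \<longlonglongrightarrow> x" for x
      using filterlim_compose[OF T_right_cont] by blast
    then have "bounded (range (\<lambda>n. T (t n) x))" for x
      using convergent_imp_bounded by blast
    then have "bounded (range (\<lambda>n. T (t n)))"
      by (rule uniform_boundedness)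
    then obtain b where b: "\<And>n. norm (T (t n)) \<le> b"
      by (auto simp: bounded_iff)
    obtain n :: nat where "b \<le> real n" using real_arch_simple by blast
    then show False using b[of n] t(3)[of n] by linarith
  qed
  then obtain M0 r0 where r0: "r0 > 0" and M0: "\<And>t. 0 < t \<Longrightarrow> t < r0 \<Longrightarrow> norm (T t) \<le> M0"
    by blast
  define M r where "M = max 1 M0" and "r = r0 / 2"
  have M: "norm (T t) \<le> M" if "t \<le> r" for t
  proof (cases "t \<le> 0")
    case True
    have "norm (T t) \<le> 1" by (rule norm_blinfun_bound) (auto simp: T_neg[OF True])
    then show ?thesis by (simp add: M_def)
  next
    case False
    then show ?thesis using M0[of t] that r0 by (simp add: r_def M_def)
  qed
  have M1: "M \<ge> 1" by (simp add: M_def)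
  have r: "r > 0" using r0 by (simp add: r_def)
  have pow: "\<forall>t\<le>real (Suc n) * r. norm (T t) \<le> M ^ Suc n" for n
  proof (induction n)
    case 0
    then show ?case using M by simp
  next
    case (Suc n)
    show ?case
    proof (intro allI impI)
      fix t assume t: "t \<le> real (Suc (Suc n)) * r"
      show "norm (T t) \<le> M ^ Suc (Suc n)"
      proof (cases "t \<le> r")
        case True
        have "norm (T t) \<le> M" by (rule M[OF True])
        also have "\<dots> \<le> M ^ Suc (Suc n)" using M1 by (simp add: self_le_power del: power_Suc)
        finally show ?thesis .
      next
        case False
        have "T t = T r o\<^sub>L T (t - r)"
          using T_add[of r "t - r"] r False by (intro blinfun_eqI) simp
        then have "norm (T t) \<le> norm (T r) * norm (T (t - r))"
          by (simp add: norm_blinfun_compose)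
        also have "\<dots> \<le> M * M ^ Suc n"
          using M[of r] Suc.IH t M1 by (intro mult_mono) (auto simp: algebra_simps)
        finally show ?thesis by simp
      qed
    qed
  qed
  obtain n :: nat where "\<tau> / r \<le> real n" using real_arch_simple by blast
  then have "\<tau> \<le> real (Suc n) * r" using r by (simp add: field_simps)
  then have "\<forall>t\<le>\<tau>. norm (T t) \<le> M ^ Suc n" using pow[of n] by (meson order_trans)
  moreover have "M ^ Suc n \<ge> 1" using M1 by (rule one_le_power)
  ultimately show ?thesis by blast
qed

lemma T_bound: obtains M where "M \<ge> 1" "\<And>t x. t \<le> \<tau> \<Longrightarrow> norm (T t x) \<le> M * norm x"
proof -
  obtain M where M: "M \<ge> 1" "\<forall>t\<le>\<tau>. norm (T t) \<le> M" using T_bounded by blast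
  have "norm (T t x) \<le> M * norm x" if "t \<le> \<tau>" for t x
    using norm_blinfun[of "T t" x] mult_right_mono[OF M(2)[rule_format, OF that] norm_ge_zero[of x]] by linarith
  then show ?thesis using M(1) that by blast
qed

lemma T_isCont_0: "isCont (\<lambda>t. T t x) 0"
proof -
  have "((\<lambda>t. T t x) \<longlongrightarrow> x) (at_left 0)"
    by (rule tendsto_eventually) (auto simp: eventually_at_filter T_neg)
  then show ?thesis
    using T_right_cont[of x] by (simp add: isCont_def filterlim_split_at)
qed

text \<open>Strong continuity and local boundedness combine to joint continuity in time and vector.
  Times are truncated at 0, which does not change T, so that the semigroup law applies to the
  difference of two of them.\<close>

lemma T_tendsto:
  assumes g: "(g \<longlongrightarrow> s) F" and h: "(h \<longlongrightarrow> x) F"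
  shows "((\<lambda>n. T (g n) (h n)) \<longlongrightarrow> T s x) F"
proof -
  obtain M where M: "M \<ge> 1" "\<And>t x. t \<le> \<bar>s\<bar> + 1 \<Longrightarrow> norm (T t x) \<le> M * norm x"
    using T_bound by blast
  have T_max: "T t = T (max 0 t)" for t
    using T_neg[of t] T_neg[of 0] by (auto simp: max_def)
  have le: "norm (T a x - T b x) \<le> M * norm (T \<bar>a - b\<bar> x - x)" if "0 \<le> b" "b \<le> a" "a \<le> \<bar>s\<bar> + 1" for a b
  proof -
    have "T a x - T b x = T b (T (a - b) x - x)"
      using T_add[of b "a - b" x] that by (simp add: blinfun.diff_right)
    then show ?thesis using M(2)[of b "T (a - b) x - x"] that by simp
  qed
  have le': "norm (T a x - T b x) \<le> M * norm (T \<bar>a - b\<bar> x - x)"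
    if "0 \<le> a" "0 \<le> b" "a \<le> \<bar>s\<bar> + 1" "b \<le> \<bar>s\<bar> + 1" for a b
    using le[of a b] le[of b a] that by (cases "b \<le> a") (auto simp: norm_minus_commute abs_minus_commute)
  define r where "r n = \<bar>max 0 (g n) - max 0 s\<bar>" for n
  have "(r \<longlongrightarrow> \<bar>max 0 s - max 0 s\<bar>) F"
    unfolding r_def by (intro tendsto_intros g)
  then have "((\<lambda>n. T (r n) x) \<longlongrightarrow> T 0 x) F"
    using isCont_tendsto_compose[OF T_isCont_0] by simp
  then have r0: "((\<lambda>n. norm (T (r n) x - x)) \<longlongrightarrow> 0) F"
    by (auto intro: tendsto_norm_zero simp: LIM_zero_iff)
  have h0: "((\<lambda>n. norm (h n - x)) \<longlongrightarrow> 0) F"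
    using h by (auto intro: tendsto_norm_zero simp: LIM_zero_iff)
  have "\<forall>\<^sub>F n in F. g n < \<bar>s\<bar> + 1"
    using g by (rule order_tendstoD) simp
  then have "\<forall>\<^sub>F n in F. norm (T (g n) (h n) - T s x) \<le> M * norm (h n - x) + M * norm (T (r n) x - x)"
  proof eventually_elim
    case (elim n)
    have "norm (T (g n) (h n - x)) \<le> M * norm (h n - x)"
      using elim by (intro M) simp
    moreover have "norm (T (g n) x - T s x) \<le> M * norm (T (r n) x - x)"
      using le'[of "max 0 (g n)" "max 0 s"] elim T_max[of "g n"] T_max[of s] by (simp add: r_def)
    moreover have eq: "T (g n) (h n) - T s x = T (g n) (h n - x) + (T (g n) x - T s x)"
      by (simp add: blinfun.diff_right)
    have "norm (T (g n) (h n) - T s x) \<le> norm (T (g n) (h n - x)) + norm (T (g n) x - T s x)"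
      unfolding eq by (rule norm_triangle_ineq)
    ultimately show ?case by linarith
  qed
  moreover have "((\<lambda>n. M * norm (h n - x) + M * norm (T (r n) x - x)) \<longlongrightarrow> M * 0 + M * 0) F"
    by (intro tendsto_intros r0 h0)
  ultimately have "((\<lambda>n. T (g n) (h n) - T s x) \<longlongrightarrow> 0) F"
    using Lim_null_comparison by force
  then show ?thesis by (simp add: LIM_zero_iff)
qed

lemma T_continuous_on [continuous_intros]:
  "continuous_on S g \<Longrightarrow> continuous_on S h \<Longrightarrow> continuous_on S (\<lambda>s. T (g s) (h s))"
  unfolding continuous_on_def by (intro ballI T_tendsto) blast+

lemma T_integral: "f integrable_on S \<Longrightarrow> T t (integral S f) = integral S (\<lambda>s. T t (f s))"
  using integral_linear[OF _ blinfun.bounded_linear_right[of "T t"], of f S] by (simp add: o_def)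

section \<open>The generator: linearity, closedness and the graph norm\<close>

lemma A_lim: "x \<in> carr E1 \<Longrightarrow> ((\<lambda>h. (T h x - x) /\<^sub>R h) \<longlongrightarrow> A x) (at_right 0)"
  using gen by (auto simp: is_generator_def)

lemma A_I:
  assumes "((\<lambda>h. (T h x - x) /\<^sub>R h) \<longlongrightarrow> y) (at_right 0)"
  shows "x \<in> carr E1" "A x = y"
proof -
  show x: "x \<in> carr E1" using gen assms by (auto simp: is_generator_def)
  show "A x = y" by (rule tendsto_unique[OF _ A_lim[OF x] assms]) simp
qed

lemma A_add: "x \<in> carr E1 \<Longrightarrow> y \<in> carr E1 \<Longrightarrow> A (x + y) = A x + A y"
  using tendsto_add[OF A_lim[of x] A_lim[of y]]
  by (intro A_I(2)) (simp add: blinfun.add_right scaleR_diff_right scaleR_add_right algebra_simps)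

lemma A_sc:
  assumes "a \<in> K" "x \<in> carr E1"
  shows "A (sc a x) = sc a (A x)"
proof (rule A_I(2))
  have "sc (of_real r) y = r *\<^sub>R y" for r y by (rule sc_of_real)
  have lin: "bounded_linear (sc a)"
  proof (rule bounded_linear_intro[of _ "cmod a"])
    show "sc a (y + z) = sc a y + sc a z" for y z
      using scalar assms(1) by (auto simp: scalar_structure_def)
    show "sc a (r *\<^sub>R y) = r *\<^sub>R sc a y" for r y
    proof -
      have "sc a (sc (of_real r) y) = sc (a * of_real r) y" "sc (of_real r) (sc a y) = sc (of_real r * a) y"
        using scalar assms(1) of_real_in_K[of r] unfolding scalar_structure_def by blast+
      then show ?thesis by (simp add: sc_of_real mult.commute)
    qed
    show "norm (sc a y) \<le> norm y * cmod a" for y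
      using assms(1) by (simp add: norm_sc mult.commute)
  qed
  then have "((\<lambda>h. sc a ((T h x - x) /\<^sub>R h)) \<longlongrightarrow> sc a (A x)) (at_right 0)"
    by (rule bounded_linear.tendsto[OF _ A_lim[OF assms(2)]])
  then show "((\<lambda>h. (T h (sc a x) - sc a x) /\<^sub>R h) \<longlongrightarrow> sc a (A x)) (at_right 0)"
    using lin by (simp add: T_sc assms(1) linear_simps)
qed

lemma A_scale: "x \<in> carr E1 \<Longrightarrow> A (r *\<^sub>R x) = r *\<^sub>R A x"
  using A_sc[OF of_real_in_K] by (simp add: sc_of_real)

lemma A_diff: "x \<in> carr E1 \<Longrightarrow> y \<in> carr E1 \<Longrightarrow> A (x - y) = A x - A y"
  using A_add[of x "(-1) *\<^sub>R y"] A_scale[of y "-1"] E1.carr_scale[of y "-1"] by simp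

lemma T_E1:
  assumes "x \<in> carr E1"
  shows "T t x \<in> carr E1" "A (T t x) = T t (A x)"
proof -
  have *: "T t x \<in> carr E1 \<and> A (T t x) = T t (A x)" if t: "t \<ge> 0"
  proof -
    have "((\<lambda>h. T t ((T h x - x) /\<^sub>R h)) \<longlongrightarrow> T t (A x)) (at_right 0)"
      by (rule bounded_linear.tendsto[OF blinfun.bounded_linear_right A_lim[OF assms]])
    moreover have "\<forall>\<^sub>F h in at_right 0. T t ((T h x - x) /\<^sub>R h) = (T h (T t x) - T t x) /\<^sub>R h"
      using eventually_at_right_less[of 0]
    proof eventually_elim
      case (elim h)
      then show ?case using t T_commute[of h t x] by (simp add: blinfun.diff_right blinfun.scaleR_right)
    qed
    ultimately have "((\<lambda>h. (T h (T t x) - T t x) /\<^sub>R h) \<longlongrightarrow> T t (A x)) (at_right 0)"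
      using tendsto_cong by force
    then show ?thesis using A_I by blast
  qed
  show "T t x \<in> carr E1" "A (T t x) = T t (A x)"
    using * T_neg[of t] assms by (cases "t \<ge> 0"; simp)+
qed

lemma T_has_derivative_E1:
  assumes x: "x \<in> carr E1" and t: "t > 0"
  shows "((\<lambda>t. T t x) has_vector_derivative T t (A x)) (at t)"
  unfolding has_vector_derivative_iff_quotient
proof (rule filterlim_split_at)
  have "((\<lambda>h. T t ((T h x - x) /\<^sub>R h)) \<longlongrightarrow> T t (A x)) (at_right 0)"
    by (rule bounded_linear.tendsto[OF blinfun.bounded_linear_right A_lim[OF x]])
  moreover have "\<forall>\<^sub>F h in at_right 0. T t ((T h x - x) /\<^sub>R h) = (T (t + h) x - T t x) /\<^sub>R h"
    using eventually_at_right_less[of 0]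
  proof eventually_elim
    case (elim h)
    then show ?case using t T_add[of t h x] by (simp add: blinfun.diff_right blinfun.scaleR_right)
  qed
  ultimately show "((\<lambda>h. (T (t + h) x - T t x) /\<^sub>R h) \<longlongrightarrow> T t (A x)) (at_right 0)"
    using tendsto_cong by force
  \<comment> \<open>The left quotient at t is T (t - k) applied to the right quotient at 0. Operator
    and vector both vary with k, which is why joint continuity is invoked.\<close>
  have "((\<lambda>k. T (t - k) ((T k x - x) /\<^sub>R k)) \<longlongrightarrow> T (t - 0) (A x)) (at_right 0)"
    by (intro T_tendsto A_lim x tendsto_intros)
  moreover have "\<forall>\<^sub>F k in at_right 0. T (t - k) ((T k x - x) /\<^sub>R k) = (T (t + - k) x - T t x) /\<^sub>R (- k)"
    using eventually_at_right_real[OF t]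
  proof eventually_elim
    case (elim k)
    then have "T t x = T (t - k) (T k x)" using T_add[of "t - k" k x] by simp
    then show ?case by (simp add: blinfun.diff_right blinfun.scaleR_right algebra_simps)
  qed
  ultimately have "((\<lambda>k. (T (t + - k) x - T t x) /\<^sub>R (- k)) \<longlongrightarrow> T t (A x)) (at_right 0)"
    using tendsto_cong by force
  then show "((\<lambda>h. (T (t + h) x - T t x) /\<^sub>R h) \<longlongrightarrow> T t (A x)) (at_left 0)"
    by (subst filterlim_at_left_to_right) simp
qed

lemma T_diff_integral_E1:
  assumes x: "x \<in> carr E1" and ab: "0 \<le> a" "a \<le> b"
  shows "((\<lambda>s. T s (A x)) has_integral (T b x - T a x)) {a..b}"
proof (rule fundamental_theorem_of_calculus_interior)
  show "continuous_on {a..b} (\<lambda>s. T s x)"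
    by (intro continuous_intros)
qed (use ab T_has_derivative_E1[OF x] in auto)

lemma integral_T_derivative:
  assumes "h \<ge> 0"
  shows "((\<lambda>k. (integral {0..h+k} (\<lambda>s. T s y) - integral {0..h} (\<lambda>s. T s y)) /\<^sub>R k) \<longlongrightarrow> T h y) (at_right 0)"
proof -
  have "((\<lambda>u. integral {0..u} (\<lambda>s. T s y)) has_vector_derivative T h y) (at h within {0..h+1})"
    by (rule integral_has_vector_derivative) (use assms in \<open>auto intro!: continuous_intros\<close>)
  then have "((\<lambda>u. integral {0..u} (\<lambda>s. T s y)) has_vector_derivative T h y) (at h within {h..h+1})"
    by (rule has_vector_derivative_within_subset) (use assms in auto)
  from has_vector_derivative_quotient_right[OF this] show ?thesis by simp
qed

text \<open>The semigroup law shifts the interval of integration, so T k \<Phi>(h) - \<Phi>(h)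
  equals (\<Phi>(h + k) - \<Phi>(h)) - \<Phi>(k). After division by k both parts are right
  difference quotients of \<Phi>, at h and at 0.\<close>

lemma integral_T_E1:
  assumes h: "h \<ge> 0"
  shows "integral {0..h} (\<lambda>s. T s y) \<in> carr E1" "A (integral {0..h} (\<lambda>s. T s y)) = T h y - y"
proof -
  define \<Phi> where "\<Phi> u = integral {0..u} (\<lambda>s. T s y)" for u
  have int: "(\<lambda>s. T s y) integrable_on {a..b}" for a b
    by (intro integrable_continuous_interval continuous_intros)
  have "((\<lambda>k. (\<Phi> (h + k) - \<Phi> h) /\<^sub>R k - (\<Phi> (0 + k) - \<Phi> 0) /\<^sub>R k) \<longlongrightarrow> T h y - T 0 y) (at_right 0)"
    unfolding \<Phi>_def using h by (intro tendsto_diff integral_T_derivative) auto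
  moreover have "\<forall>\<^sub>F k in at_right 0. (\<Phi> (h + k) - \<Phi> h) /\<^sub>R k - (\<Phi> (0 + k) - \<Phi> 0) /\<^sub>R k = (T k (\<Phi> h) - \<Phi> h) /\<^sub>R k"
    using eventually_at_right_less[of 0]
  proof eventually_elim
    case (elim k)
    have "T k (\<Phi> h) = integral {0..h} (\<lambda>s. T k (T s y))"
      unfolding \<Phi>_def by (rule T_integral[OF int])
    also have "\<dots> = integral {0..h} ((\<lambda>s. T s y) \<circ> (+) k)"
      using elim by (intro integral_cong) (simp add: T_add)
    also have "\<dots> = integral {k..h+k} (\<lambda>s. T s y)"
      by (simp add: integral_shift_Icc_real)
    finally have "\<Phi> k + T k (\<Phi> h) = \<Phi> (h + k)"
      unfolding \<Phi>_def using Henstock_Kurzweil_Integration.integral_combine[of 0 k "h+k", OF _ _ int] elim h by simp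
    then have "T k (\<Phi> h) = \<Phi> (h + k) - \<Phi> k" by (simp add: algebra_simps)
    then show ?case by (simp add: \<Phi>_def scaleR_diff_right[symmetric])
  qed
  ultimately have "((\<lambda>k. (T k (\<Phi> h) - \<Phi> h) /\<^sub>R k) \<longlongrightarrow> T h y - y) (at_right 0)"
    using tendsto_cong by force
  from A_I[OF this] show "integral {0..h} (\<lambda>s. T s y) \<in> carr E1" "A (integral {0..h} (\<lambda>s. T s y)) = T h y - y"
    by (simp_all add: \<Phi>_def)
qed

text \<open>The identity T h x - x = \<integral> T s (A x) ds over [0, h] contains no derivative and
  passes to the limit; its right derivative at h = 0 then identifies A l.\<close>

lemma A_closed:
  assumes x: "\<And>n. x n \<in> carr E1" and lim: "x \<longlonglongrightarrow> l" "(\<lambda>n. A (x n)) \<longlonglongrightarrow> y"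
  shows "l \<in> carr E1" "A l = y"
proof -
  have eq: "T h l - l = integral {0..h} (\<lambda>s. T s y)" if h: "h \<ge> 0" for h
  proof -
    obtain M where M: "M \<ge> 1" "\<And>t x. t \<le> h \<Longrightarrow> norm (T t x) \<le> M * norm x"
      using T_bound by blast
    have le: "norm (integral {0..h} (\<lambda>s. T s (A (x n))) - integral {0..h} (\<lambda>s. T s y)) \<le> M * norm (A (x n) - y) * h" for n
    proof -
      have "norm (integral {0..h} (\<lambda>s. T s (A (x n) - y))) \<le> M * norm (A (x n) - y) * (h - 0)"
        by (rule integral_bound) (use h M(2) in \<open>auto intro!: continuous_intros\<close>)
      moreover have "integral {0..h} (\<lambda>s. T s (A (x n) - y)) =
          integral {0..h} (\<lambda>s. T s (A (x n))) - integral {0..h} (\<lambda>s. T s y)"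
        unfolding blinfun.diff_right
        by (rule Henstock_Kurzweil_Integration.integral_diff)
          (auto intro!: integrable_continuous_interval continuous_intros)
      ultimately show ?thesis by simp
    qed
    have "(\<lambda>n. M * norm (A (x n) - y) * h) \<longlonglongrightarrow> M * 0 * h"
      by (intro tendsto_intros tendsto_norm_zero LIM_zero lim)
    then have "(\<lambda>n. integral {0..h} (\<lambda>s. T s (A (x n))) - integral {0..h} (\<lambda>s. T s y)) \<longlonglongrightarrow> 0"
      by (intro Lim_null_comparison[OF always_eventually[OF allI[OF le]]]) simp
    then have "(\<lambda>n. integral {0..h} (\<lambda>s. T s (A (x n)))) \<longlonglongrightarrow> integral {0..h} (\<lambda>s. T s y)"
      by (simp add: LIM_zero_iff)
    moreover have "integral {0..h} (\<lambda>s. T s (A (x n))) = T h (x n) - x n" for n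
      using integral_unique[OF T_diff_integral_E1[OF x, of 0 h]] h by simp
    moreover have "(\<lambda>n. T h (x n) - x n) \<longlonglongrightarrow> T h l - l"
      by (intro tendsto_intros T_tendsto lim)
    ultimately show ?thesis using LIMSEQ_unique by simp
  qed
  have "((\<lambda>k. (integral {0..0+k} (\<lambda>s. T s y) - integral {0..0} (\<lambda>s. T s y)) /\<^sub>R k) \<longlongrightarrow> T 0 y) (at_right 0)"
    by (rule integral_T_derivative) simp
  moreover have "\<forall>\<^sub>F k in at_right 0. (integral {0..0+k} (\<lambda>s. T s y) - integral {0..0} (\<lambda>s. T s y)) /\<^sub>R k = (T k l - l) /\<^sub>R k"
    using eventually_at_right_less[of 0]
  proof eventually_elim
    case (elim k)
    then show ?case using eq[of k] by simp
  qed
  ultimately have "((\<lambda>k. (T k l - l) /\<^sub>R k) \<longlongrightarrow> T 0 y) (at_right 0)"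
    by (rule Lim_transform_eventually)
  then have "((\<lambda>k. (T k l - l) /\<^sub>R k) \<longlongrightarrow> y) (at_right 0)"
    by simp
  from A_I[OF this] show "l \<in> carr E1" "A l = y" by auto
qed

text \<open>The domain of A with the graph norm; the value 0 off the carrier is what
  \<open>banach_subspace\<close> prescribes.\<close>

definition graph_space :: "'e nspace" where
  "graph_space = NSpace (carr E1) (\<lambda>x. if x \<in> carr E1 then norm x + norm (A x) else 0)"

lemma carr_graph [simp]: "carr graph_space = carr E1"
  by (simp add: graph_space_def)

lemma nrm_graph: "x \<in> carr E1 \<Longrightarrow> nrm graph_space x = norm x + norm (A x)"
  by (simp add: graph_space_def)

lemma A_zero [simp]: "A 0 = 0"
  using A_scale[of 0 0] by simp

lemma banach_subspace_graph: "banach_subspace K sc graph_space"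
proof -
  have off: "nrm graph_space x = 0" if "x \<notin> carr E1" for x
    using that by (simp add: graph_space_def)
  have ms: "Metric_space (carr E1) (ndist graph_space)"
  proof
    fix x y
    have eq: "nrm graph_space (- x) = nrm graph_space x" for x
    proof (cases "x \<in> carr E1")
      case True
      then show ?thesis
        using A_scale[of x "-1"] E1.carr_minus[of x] by (simp add: nrm_graph)
    next
      case False
      then have "- x \<notin> carr E1" using E1.carr_minus[of "- x"] by auto
      then show ?thesis using False by (simp add: off)
    qed
    show "0 \<le> ndist graph_space x y"
      by (simp add: ndist_def graph_space_def)
    show "ndist graph_space x y = ndist graph_space y x"
      using eq[of "x - y"] by (simp add: ndist_def)
  next
    fix x y assume "x \<in> carr E1" "y \<in> carr E1"
    moreover from this have "x - y \<in> carr E1" by blast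
    ultimately show "ndist graph_space x y = 0 \<longleftrightarrow> x = y"
      by (auto simp: ndist_def nrm_graph add_nonneg_eq_0_iff A_diff)
  next
    fix x y z assume *: "x \<in> carr E1" "y \<in> carr E1" "z \<in> carr E1"
    then have "x - y \<in> carr E1" "y - z \<in> carr E1" "x - z \<in> carr E1" by blast+
    then show "ndist graph_space x z \<le> ndist graph_space x y + ndist graph_space y z"
      using * norm_triangle_ineq[of "x - y" "y - z"] norm_triangle_ineq[of "A x - A y" "A y - A z"]
      by (simp add: ndist_def nrm_graph A_diff)
  qed
  then interpret G: Metric_space "carr E1" "ndist graph_space" .
  have comp: "G.mcomplete"
    unfolding G.mcomplete_def
  proof (intro allI impI)
    fix \<sigma> assume cau: "G.MCauchy \<sigma>"
    then have \<sigma>: "\<sigma> n \<in> carr E1" for n by (auto simp: G.MCauchy_def)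
    have dist: "ndist graph_space (\<sigma> m) y = norm (\<sigma> m - y) + norm (A (\<sigma> m) - A y)" if "y \<in> carr E1" for m y
    proof -
      have "\<sigma> m - y \<in> carr E1" using \<sigma> that by blast
      then show ?thesis using \<sigma> that by (simp add: ndist_def nrm_graph A_diff)
    qed
    have N: "\<exists>N. \<forall>m\<ge>N. \<forall>n\<ge>N. norm (\<sigma> m - \<sigma> n) + norm (A (\<sigma> m) - A (\<sigma> n)) < e" if "e > 0" for e
      using cau that unfolding G.MCauchy_def by (simp add: dist[OF \<sigma>])
    have "Cauchy \<sigma>" "Cauchy (\<lambda>n. A (\<sigma> n))"
      unfolding Cauchy_def dist_norm
      using N by (meson le_add_same_cancel1 le_add_same_cancel2 le_less_trans norm_ge_zero)+
    then obtain l y where ly: "\<sigma> \<longlonglongrightarrow> l" "(\<lambda>n. A (\<sigma> n)) \<longlonglongrightarrow> y"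
      by (meson Cauchy_convergent_iff convergent_def)
    then have l: "l \<in> carr E1" "A l = y" using A_closed[OF \<sigma>] by auto
    have "(\<lambda>n. norm (\<sigma> n - l) + norm (A (\<sigma> n) - A l)) \<longlonglongrightarrow> 0 + 0"
      using ly l by (intro tendsto_add tendsto_norm_zero LIM_zero) auto
    then have "limitin G.mtopology \<sigma> l sequentially"
      unfolding G.limitin_metric_dist_null using \<sigma> l dist[OF l(1)] by auto
    then show "\<exists>x. limitin G.mtopology \<sigma> x sequentially" by blast
  qed
  have hom: "nrm graph_space (sc a x) = cmod a * nrm graph_space x" if "a \<in> K" "x \<in> carr E1" for a x
    using E1.carr_sc[OF that] that by (simp add: nrm_graph A_sc norm_sc distrib_left)
  have tri: "nrm graph_space (x + y) \<le> nrm graph_space x + nrm graph_space y"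
    if "x \<in> carr E1" "y \<in> carr E1" for x y
    using E1.carr_add[OF that] that norm_triangle_ineq[of x y] norm_triangle_ineq[of "A x" "A y"]
    by (simp add: nrm_graph A_add)
  have pos: "0 \<le> nrm graph_space x \<and> (nrm graph_space x = 0 \<longleftrightarrow> x = 0)" if "x \<in> carr E1" for x
    using that by (auto simp: nrm_graph add_nonneg_eq_0_iff)
  show ?thesis
    unfolding banach_subspace_def carr_graph
    by (intro conjI ballI allI impI comp hom tri off E1.carr_zero E1.carr_add E1.carr_sc conjunct1[OF pos] conjunct2[OF pos])
qed

lemma E1_embedded: "cont_embedded E1 whole_space"
  using E1_compact by (simp add: compactly_embedded_def)

lemma graph_embedded: "cont_embedded graph_space whole_space"
proof -
  have "\<forall>x\<in>carr graph_space. nrm whole_space x \<le> 1 * nrm graph_space x"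
    by (simp add: nrm_graph)
  then show ?thesis
    unfolding cont_embedded_def by (metis carr_whole subset_UNIV)
qed

text \<open>The generator determines E1 as a set. Its given norm is linked to A by
  \<open>closed_graph_inclusion\<close>, applied in both directions between E1 and
  \<open>graph_space\<close>; the latter is complete since A is closed. One constant is returned for
  all three inequalities.\<close>

lemma E1_graph_norm: obtains C where "C \<ge> 0" "\<And>x. x \<in> carr E1 \<Longrightarrow> nrm E1 x \<le> C * (norm x + norm (A x))"
    "\<And>x. x \<in> carr E1 \<Longrightarrow> norm (A x) \<le> C * nrm E1 x" "\<And>x. x \<in> carr E1 \<Longrightarrow> norm x \<le> C * nrm E1 x"
proof -
  have "cont_embedded graph_space E1"
    by (rule closed_graph_inclusion[OF banach_subspace_graph E1 graph_embedded E1_embedded]) simp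
  then obtain c where "\<forall>x\<in>carr graph_space. nrm E1 x \<le> c * nrm graph_space x"
    unfolding cont_embedded_def by blast
  then have c: "\<And>x. x \<in> carr E1 \<Longrightarrow> nrm E1 x \<le> c * (norm x + norm (A x))"
    by (simp add: nrm_graph)
  have "cont_embedded E1 graph_space"
    by (rule closed_graph_inclusion[OF E1 banach_subspace_graph E1_embedded graph_embedded]) simp
  then obtain c' where "\<forall>x\<in>carr E1. nrm graph_space x \<le> c' * nrm E1 x"
    unfolding cont_embedded_def by blast
  then have c': "\<And>x. x \<in> carr E1 \<Longrightarrow> norm x + norm (A x) \<le> c' * nrm E1 x"
    by (simp add: nrm_graph)
  define C where "C = \<bar>c\<bar> + \<bar>c'\<bar>"
  have 1: "nrm E1 x \<le> C * (norm x + norm (A x))" if "x \<in> carr E1" for x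
  proof -
    have "c * (norm x + norm (A x)) \<le> C * (norm x + norm (A x))"
      by (rule mult_right_mono) (auto simp: C_def)
    then show ?thesis using c[OF that] by linarith
  qed
  have 2: "norm x + norm (A x) \<le> C * nrm E1 x" if "x \<in> carr E1" for x
  proof -
    have "c' * nrm E1 x \<le> C * nrm E1 x"
      by (rule mult_right_mono) (auto simp: C_def)
    then show ?thesis using c'[OF that] by linarith
  qed
  show thesis
  proof (rule that[of C])
    show "norm (A x) \<le> C * nrm E1 x" "norm x \<le> C * nrm E1 x" if "x \<in> carr E1" for x
      using 2[OF that] norm_ge_zero[of x] norm_ge_zero[of "A x"] by linarith+
  qed (use 1 in \<open>auto simp: C_def\<close>)
qed

lemma T_smooth: "t > 0 \<Longrightarrow> T t x \<in> carr E1"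
proof -
  assume t: "t > 0"
  obtain r C where r: "r > 0" and C: "\<forall>t\<in>{0<..r}. \<forall>x. T t x \<in> carr E1 \<and> norm (A (T t x)) \<le> C / t * norm x"
    using smoothing by blast
  define s where "s = min t r"
  have "T s x \<in> carr E1" using C t r by (simp add: s_def)
  moreover have "T t x = T (t - s) (T s x)" using T_add[of "t - s" s x] t r by (simp add: s_def)
  ultimately show ?thesis using T_E1(1) by simp
qed

lemma AT_bound:
  assumes "\<tau> > 0"
  obtains C where "C \<ge> 0" "\<And>t x. 0 < t \<Longrightarrow> t \<le> \<tau> \<Longrightarrow> norm (A (T t x)) \<le> C * t powr -1 * norm x"
proof -
  obtain r C where r: "r > 0" and C: "\<forall>t\<in>{0<..r}. \<forall>x. T t x \<in> carr E1 \<and> norm (A (T t x)) \<le> C / t * norm x"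
    using smoothing by blast
  obtain M where M: "M \<ge> 1" "\<And>t x. t \<le> \<tau> \<Longrightarrow> norm (T t x) \<le> M * norm x" using T_bound by blast
  \<comment> \<open>The first summand covers t \<le> r. For larger t the bound at time r is
    multiplied by \<tau>/t \<ge> 1, which brings it to the form constant/t.\<close>
  define B where "B = \<bar>C\<bar> + \<bar>C\<bar> / r * M * \<tau>"
  have B: "B \<ge> 0" using r M(1) assms by (simp add: B_def)
  have "norm (A (T t x)) \<le> B / t * norm x" if t: "0 < t" "t \<le> \<tau>" for t x
  proof (cases "t \<le> r")
    case True
    have "norm (A (T t x)) \<le> C / t * norm x" using C t True by simp
    also have "\<dots> \<le> B / t * norm x"
      using t r M(1) assms by (intro mult_right_mono divide_right_mono) (auto simp: B_def add_increasing2)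
    finally show ?thesis .
  next
    case False
    have "A (T t x) = A (T r (T (t - r) x))" using T_add[of r "t - r" x] r False by simp
    also have "norm \<dots> \<le> C / r * norm (T (t - r) x)" using C r by simp
    also have "\<dots> \<le> \<bar>C\<bar> / r * (M * norm x)"
      using M(2)[of "t - r" x] t r by (intro mult_mono divide_right_mono) auto
    also have "\<dots> = \<bar>C\<bar> / r * M * 1 * norm x" by simp
    also have "\<dots> \<le> \<bar>C\<bar> / r * M * (\<tau> / t) * norm x"
      using r M(1) t by (intro mult_right_mono mult_left_mono) auto
    also have "\<dots> = (\<bar>C\<bar> / r * M * \<tau>) / t * norm x" by simp
    also have "\<dots> \<le> B / t * norm x"
      using t by (intro mult_right_mono divide_right_mono) (auto simp: B_def)
    finally show ?thesis .
  qed
  then have "norm (A (T t x)) \<le> B * t powr -1 * norm x" if "0 < t" "t \<le> \<tau>" for t x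
    using that by (simp add: powr_minus divide_inverse)
  then show thesis by (rule that[OF B])
qed

lemma T_has_derivative:
  assumes t: "t > 0"
  shows "((\<lambda>t. T t x) has_vector_derivative A (T t x)) (at t)"
proof -
  have d1: "((\<lambda>s. s - t/2) has_vector_derivative 1) (at t)"
    by (auto intro!: derivative_eq_intros)
  have "((\<lambda>s. T s (T (t/2) x)) has_vector_derivative T (t/2) (A (T (t/2) x))) (at (t - t/2))"
    using T_has_derivative_E1[OF T_smooth, of "t/2" "t - t/2" x] t by simp
  then have "((\<lambda>s. T (s - t/2) (T (t/2) x)) has_vector_derivative T (t/2) (A (T (t/2) x))) (at t)"
    using vector_diff_chain_at[OF d1, of "\<lambda>s. T s (T (t/2) x)"] by (simp add: o_def)
  then have "((\<lambda>s. T s x) has_vector_derivative T (t/2) (A (T (t/2) x))) (at t)"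
  proof (rule has_vector_derivative_transform_within_open)
    show "open {t/2<..}" "t \<in> {t/2<..}" using t by auto
    fix s assume "s \<in> {t/2<..}"
    then show "T (s - t/2) (T (t/2) x) = T s x"
      using T_add[of "s - t/2" "t/2" x] t by simp
  qed
  moreover have "T (t/2) (A (T (t/2) x)) = A (T t x)"
    using T_E1(2)[OF T_smooth, of "t/2" "t/2" x] T_add[of "t/2" "t/2" x] t by simp
  ultimately show ?thesis by simp
qed

end

locale smoothing_target = analytic_generator K sc E1 A T + normed_subspace K sc X
  for K :: "complex set" and sc :: "complex \<Rightarrow> 'e::banach \<Rightarrow> 'e"
    and E1 :: "'e nspace" and A :: "'e \<Rightarrow> 'e" and T :: "real \<Rightarrow> 'e \<Rightarrow>\<^sub>L 'e" and X :: "'e nspace" +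
  fixes \<theta> :: real
  assumes \<theta>_nonneg: "0 \<le> \<theta>"
    and smooth: "\<And>\<tau>. \<tau> > 0 \<Longrightarrow> \<exists>C\<ge>0. \<forall>t x. 0 < t \<and> t \<le> \<tau> \<longrightarrow>
      T t x \<in> carr X \<and> nrm X (T t x) \<le> C * t powr (- \<theta>) * norm x"
    and embed: "\<exists>C\<ge>0. \<forall>x\<in>carr X. norm x \<le> C * nrm X x"
begin

lemma smooth_bound:
  obtains C where "C \<ge> 0" "\<And>t x. 0 < t \<Longrightarrow> t \<le> \<tau> \<Longrightarrow> nrm X (T t x) \<le> C * t powr (- \<theta>) * norm x"
proof (cases "\<tau> > 0")
  case True
  show thesis using smooth[OF True] that by blast
next
  case False
  show thesis by (rule that[of 0]) (use False in auto)
qed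

lemma T_in: "t > 0 \<Longrightarrow> T t x \<in> carr X"
  using smooth[of t] by blast

lemma T_bounded_into: "t > 0 \<Longrightarrow> \<exists>C\<ge>0. \<forall>x. nrm X (T t x) \<le> C * norm x"
proof -
  assume t: "t > 0"
  obtain C where C: "C \<ge> 0" "\<And>s x. 0 < s \<Longrightarrow> s \<le> t \<Longrightarrow> nrm X (T s x) \<le> C * s powr (- \<theta>) * norm x"
    using smooth_bound[where \<tau> = t] by blast
  show ?thesis
    using C t by (intro exI[of _ "C * t powr (- \<theta>)"]) auto
qed

lemma embed_tendsto:
  assumes "((\<lambda>n. nrm X (x n - l)) \<longlongrightarrow> 0) F" "\<forall>\<^sub>F n in F. x n \<in> carr X" "l \<in> carr X"
  shows "(x \<longlongrightarrow> l) F"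
proof -
  obtain C where C: "C \<ge> 0" "\<And>x. x \<in> carr X \<Longrightarrow> norm x \<le> C * nrm X x" using embed by blast
  have "((\<lambda>n. C * nrm X (x n - l)) \<longlongrightarrow> 0) F"
    by (rule tendsto_mult_right_zero[OF assms(1)])
  moreover have "\<forall>\<^sub>F n in F. norm (x n - l) \<le> C * nrm X (x n - l)"
    using assms(2) by eventually_elim (use assms(3) C(2) in blast)
  ultimately have "((\<lambda>n. x n - l) \<longlongrightarrow> 0) F"
    by (rule Lim_null_comparison[rotated])
  then show ?thesis by (simp add: LIM_zero_iff)
qed

text \<open>A factor T (t/2) is split off: the rest converges in E_0, and T (t/2) is bounded from
  E_0 into X.\<close>

lemma T_tendsto_into:
  assumes g: "(g \<longlongrightarrow> t) F" and h: "(h \<longlongrightarrow> x) F" and t: "t > 0"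
  shows "((\<lambda>n. nrm X (T (g n) (h n) - T t x)) \<longlongrightarrow> 0) F"
proof -
  obtain C where C: "\<And>x. nrm X (T (t/2) x) \<le> C * norm x"
    using T_bounded_into[of "t/2"] t by auto
  have "((\<lambda>n. T (g n - t/2) (h n) - T (t - t/2) x) \<longlongrightarrow> 0) F"
    by (intro LIM_zero T_tendsto tendsto_intros g h)
  then have lim: "((\<lambda>n. C * norm (T (g n - t/2) (h n) - T (t/2) x)) \<longlongrightarrow> 0) F"
    by (intro tendsto_mult_right_zero tendsto_norm_zero) simp
  have "\<forall>\<^sub>F n in F. g n > t/2"
    by (rule order_tendstoD(1)[OF g]) (use t in simp)
  then have "\<forall>\<^sub>F n in F. norm (nrm X (T (g n) (h n) - T t x)) \<le> C * norm (T (g n - t/2) (h n) - T (t/2) x)"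
  proof eventually_elim
    case (elim n)
    have "T (g n) (h n) - T t x = T (t/2) (T (g n - t/2) (h n) - T (t/2) x)"
      using T_add[of "t/2" "g n - t/2" "h n"] T_add[of "t/2" "t/2" x] t elim by (simp add: blinfun.diff_right)
    then show ?case using C[of "T (g n - t/2) (h n) - T (t/2) x"] by simp
  qed
  then show ?thesis
    by (rule Lim_null_comparison[OF _ lim])
qed

lemma seminorm_T:
  assumes "t > 0"
  shows "nrm X (T t (x + y)) \<le> nrm X (T t x) + nrm X (T t y)" "nrm X (T t (c *\<^sub>R x)) = \<bar>c\<bar> * nrm X (T t x)"
  using nrm_triangle[OF T_in[OF assms] T_in[OF assms]] nrm_scale[OF T_in[OF assms]]
  by (simp_all add: blinfun.add_right blinfun.scaleR_right)

lemma convolution_split: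
  assumes k: "continuous_on {a..b} k" and c: "a \<le> c" "c \<le> b"
  shows "integral {a..c} (\<lambda>s. T (b - s) (k s)) = T (b - c) (integral {a..c} (\<lambda>s. T (c - s) (k s)))"
proof -
  have kc: "continuous_on {a..c} k" using k by (rule continuous_on_subset) (use c in auto)
  have "T (b - c) (integral {a..c} (\<lambda>s. T (c - s) (k s))) = integral {a..c} (\<lambda>s. T (b - c) (T (c - s) (k s)))"
    by (rule T_integral) (intro integrable_continuous_interval continuous_intros kc)
  also have "\<dots> = integral {a..c} (\<lambda>s. T (b - s) (k s))"
  proof (rule integral_cong)
    fix s assume "s \<in> {a..c}"
    then show "T (b - c) (T (c - s) (k s)) = T (b - s) (k s)"
      using T_add[of "b - c" "c - s" "k s"] c by simp
  qed
  finally show ?thesis by simp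
qed

text \<open>The integrand may be singular in \<open>X\<close> at the upper end point, although it is continuous in \<open>E\<^sub>0\<close>.\<close>

lemma convolution_in:
  assumes k: "continuous_on {a..b} k" and ab: "a \<le> b"
    and \<phi>: "(\<phi> has_integral I) {a..b}"
    and le: "\<And>s. s \<in> {a<..<b} \<Longrightarrow> nrm X (T (b - s) (k s)) \<le> \<phi> s"
  shows "integral {a..b} (\<lambda>s. T (b - s) (k s)) \<in> carr X \<and> nrm X (integral {a..b} (\<lambda>s. T (b - s) (k s))) \<le> I"
proof (cases "a = b")
  case True
  then have "I = 0"
    using has_integral_unique[OF _ has_integral_refl(2)[of \<phi> a]] \<phi> by simp
  then show ?thesis using True by simp
next
  case False
  then have ab: "a < b" using ab by simp
  \<comment> \<open>For c < b a factor T (b - c) can be pulled out of the truncated integral, so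
    \<open>J c\<close> lies in X. The increments of \<open>\<Phi>\<close> bound those of
    \<open>J\<close> in X, and \<open>\<Phi>\<close> is continuous up to b.\<close>
  define J where "J c = integral {a..c} (\<lambda>s. T (b - s) (k s))" for c
  define \<Phi> where "\<Phi> c = integral {a..c} \<phi>" for c
  have int: "(\<lambda>s. T (b - s) (k s)) integrable_on {c..d}" if "a \<le> c" "d \<le> b" for c d
  proof (rule integrable_continuous_interval)
    have "continuous_on {c..d} k" using k by (rule continuous_on_subset) (use that in auto)
    then show "continuous_on {c..d} (\<lambda>s. T (b - s) (k s))" by (intro continuous_intros)
  qed
  have int\<phi>: "\<phi> integrable_on {c..d}" if "a \<le> c" "d \<le> b" for c d
    by (rule integrable_on_subinterval[OF has_integral_integrable[OF \<phi>]]) (use that in auto)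
  have J_cont: "continuous_on {a..b} J" unfolding J_def
    by (rule indefinite_integral_continuous_1[OF int]) auto
  have \<Phi>_cont: "continuous_on {a..b} \<Phi>" unfolding \<Phi>_def
    by (rule indefinite_integral_continuous_1[OF int\<phi>]) auto
  have J_in: "J c \<in> carr X" if "a \<le> c" "c < b" for c
    unfolding J_def using convolution_split[OF k, of c] T_in[of "b - c"] that by simp
  have diff_le: "nrm X (J d - J c) \<le> \<Phi> d - \<Phi> c" if cd: "a \<le> c" "c \<le> d" "d < b" for c d
  proof -
    have kcd: "continuous_on {c..b} k" "continuous_on {c..d} k"
      using k by (rule continuous_on_subset; use cd in auto)+
    have "J d - J c = integral {c..d} (\<lambda>s. T (b - s) (k s))"
      unfolding J_def using Henstock_Kurzweil_Integration.integral_combine[of a c d, OF _ _ int[of a d]] cd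
      by (simp add: algebra_simps)
    also have "\<dots> = T (b - d) (integral {c..d} (\<lambda>s. T (d - s) (k s)))"
      using convolution_split[OF kcd(1), of d] cd by simp
    finally have eq: "J d - J c = T (b - d) (integral {c..d} (\<lambda>s. T (d - s) (k s)))" .
    have "\<Phi> d - \<Phi> c = integral {c..d} \<phi>"
      unfolding \<Phi>_def using Henstock_Kurzweil_Integration.integral_combine[of a c d, OF _ _ int\<phi>[of a d]] cd
      by (simp add: algebra_simps)
    moreover have "nrm X (T (b - d) (integral {c..d} (\<lambda>s. T (d - s) (k s)))) \<le> integral {c..d} \<phi>"
    proof -
      obtain C where C: "\<And>x. nrm X (T (b - d) x) \<le> C * norm x"
        using T_bounded_into[of "b - d"] cd by auto
      show ?thesis
      proof (rule seminorm_integral_bound[where p = "\<lambda>x. nrm X (T (b - d) x)"])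
        show "((\<lambda>s. T (d - s) (k s)) has_integral integral {c..d} (\<lambda>s. T (d - s) (k s))) {c..d}"
          by (intro integrable_integral integrable_continuous_interval continuous_intros kcd)
        show "(\<phi> has_integral integral {c..d} \<phi>) {c..d}"
          using int\<phi> cd by (intro integrable_integral) auto
        fix s assume "s \<in> {c<..<d}"
        then show "nrm X (T (b - d) (T (d - s) (k s))) \<le> \<phi> s"
          using T_add[of "b - d" "d - s" "k s"] le[of s] cd by simp
      qed (use seminorm_T[of "b - d"] C cd in auto)
    qed
    ultimately show ?thesis by (simp add: eq)
  qed
  define c where "c n = b - (b - a) * inverse (real (Suc n))" for n
  have "c \<longlonglongrightarrow> b - (b - a) * 0"
    unfolding c_def by (intro tendsto_intros LIMSEQ_inverse_real_of_nat)
  then have c_lim: "c \<longlonglongrightarrow> b" by simp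
  have c: "a \<le> c n" "c n < b" for n
  proof -
    have "(b - a) * inverse (real (Suc n)) \<le> (b - a) * 1"
      using ab by (intro mult_left_mono) (auto simp: inverse_le_1_iff)
    then show "a \<le> c n" by (simp add: c_def)
    show "c n < b" using ab by (simp add: c_def)
  qed
  have lims: "(\<lambda>n. J (c n)) \<longlonglongrightarrow> J b" "(\<lambda>n. \<Phi> (c n)) \<longlonglongrightarrow> \<Phi> b"
  proof -
    have "\<forall>\<^sub>F n in sequentially. c n \<in> {a..b}"
      by (rule always_eventually) (use c in \<open>auto simp: less_imp_le\<close>)
    then show "(\<lambda>n. J (c n)) \<longlonglongrightarrow> J b" "(\<lambda>n. \<Phi> (c n)) \<longlonglongrightarrow> \<Phi> b"
      using continuous_on_tendsto_compose[OF J_cont c_lim] continuous_on_tendsto_compose[OF \<Phi>_cont c_lim] ab by auto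
  qed
  have "\<exists>l\<in>carr X. (\<lambda>n. nrm X (J (c n) - l)) \<longlonglongrightarrow> 0"
  proof (rule complete)
    show "J (c n) \<in> carr X" for n using J_in c by blast
    fix e :: real assume "e > 0"
    then obtain N where N: "\<And>m n. m \<ge> N \<Longrightarrow> n \<ge> N \<Longrightarrow> \<bar>\<Phi> (c m) - \<Phi> (c n)\<bar> < e"
      using LIMSEQ_imp_Cauchy[OF lims(2)] unfolding Cauchy_def dist_real_def by meson
    have "nrm X (J (c m) - J (c n)) \<le> \<bar>\<Phi> (c m) - \<Phi> (c n)\<bar>" for m n
      using diff_le[of "c m" "c n"] diff_le[of "c n" "c m"] c nrm_minus_commute[of "J (c m)" "J (c n)"]
      by (cases "c m \<le> c n") auto
    then show "\<exists>N. \<forall>m\<ge>N. \<forall>n\<ge>N. nrm X (J (c m) - J (c n)) < e"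
      using N by (meson le_less_trans)
  qed
  then obtain l where l: "l \<in> carr X" "(\<lambda>n. nrm X (J (c n) - l)) \<longlonglongrightarrow> 0" by blast
  \<comment> \<open>The limit found in X is identified with the full integral through their common
    limit in E_0.\<close>
  have "(\<lambda>n. J (c n)) \<longlonglongrightarrow> l"
    using J_in c l by (intro embed_tendsto) auto
  then have lJ: "l = J b" using lims(1) LIMSEQ_unique by blast
  have "(\<lambda>n. nrm X (J (c n))) \<longlonglongrightarrow> nrm X l"
    using J_in c l by (intro nrm_tendsto) auto
  moreover have "nrm X (J (c n)) \<le> \<Phi> (c n)" for n
    using diff_le[of a "c n"] c by (simp add: J_def \<Phi>_def)
  ultimately have "nrm X l \<le> \<Phi> b"
    using lims(2) LIMSEQ_le by blast
  then show ?thesis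
    using l lJ integral_unique[OF \<phi>] by (simp add: J_def \<Phi>_def)
qed

text \<open>u s and u t are compared through one earlier time q: they are close to T (s - q) (u q)
  and T (t - q) (u q) respectively, and these two are close in X because t - q > 0. As q lies
  strictly below t, s may approach t from both sides.\<close>

lemma mild_tendsto:
  assumes u: "\<And>q s. 0 < q \<Longrightarrow> q < s \<Longrightarrow> u s - T (s - q) (u q) \<in> carr X"
    and small: "\<And>e. e > 0 \<Longrightarrow> \<exists>d>0. \<forall>q s. 0 < q \<and> t - d < q \<and> q < s \<and> s < t + d \<longrightarrow> nrm X (u s - T (s - q) (u q)) < e"
    and t: "t > 0"
  shows "u t \<in> carr X" "((\<lambda>s. nrm X (u s - u t)) \<longlongrightarrow> 0) (at t)"
proof -
  have in_X: "u s \<in> carr X" if "s > 0" for s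
  proof -
    have "(u s - T (s - s/2) (u (s/2))) + T (s - s/2) (u (s/2)) \<in> carr X"
      using that by (intro carr_add u T_in) auto
    then show ?thesis by simp
  qed
  then show "u t \<in> carr X" using t .
  show "((\<lambda>s. nrm X (u s - u t)) \<longlongrightarrow> 0) (at t)"
  proof (rule tendstoI)
    fix e :: real assume "e > 0"
    then obtain d where d: "d > 0" "\<And>q s. 0 < q \<Longrightarrow> t - d < q \<Longrightarrow> q < s \<Longrightarrow> s < t + d \<Longrightarrow> nrm X (u s - T (s - q) (u q)) < e / 3"
      using small[of "e / 3"] by auto
    define q where "q = max (t/2) (t - d/2)"
    have q: "0 < q" "q < t" "t - d < q" using t d by (auto simp: q_def)
    have "((\<lambda>s. nrm X (T (s - q) (u q) - T (t - q) (u q))) \<longlongrightarrow> 0) (at t)"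
      using q by (intro T_tendsto_into tendsto_intros) auto
    then have "\<forall>\<^sub>F s in at t. nrm X (T (s - q) (u q) - T (t - q) (u q)) < e / 3"
      by (rule order_tendstoD(2)) (use \<open>e > 0\<close> in simp)
    moreover have "\<forall>\<^sub>F s in at t. q < s" "\<forall>\<^sub>F s in at t. s < t + d"
      using order_tendstoD(1)[OF tendsto_ident_at q(2)] order_tendstoD(2)[OF tendsto_ident_at, of t "t + d"] d by auto
    ultimately show "\<forall>\<^sub>F s in at t. dist (nrm X (u s - u t)) 0 < e"
    proof eventually_elim
      case (elim s)
      have in': "u s - T (s - q) (u q) \<in> carr X" "T (s - q) (u q) - T (t - q) (u q) \<in> carr X" "u t - T (t - q) (u q) \<in> carr X"
        using u[of q s] u[of q t] carr_diff[OF T_in T_in, of "s - q" "t - q" "u q" "u q"] elim q by simp_all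
      have eq: "u s - u t = (u s - T (s - q) (u q)) + (T (s - q) (u q) - T (t - q) (u q)) - (u t - T (t - q) (u q))"
        by simp
      have "nrm X (u s - u t) \<le> nrm X (u s - T (s - q) (u q)) + nrm X (T (s - q) (u q) - T (t - q) (u q)) + nrm X (u t - T (t - q) (u q))"
        using nrm_triangle_diff[OF carr_add[OF in'(1,2)] in'(3)] nrm_triangle[OF in'(1,2)]
          arg_cong[OF eq, of "nrm X"] by linarith
      moreover have "nrm X (u s - T (s - q) (u q)) < e / 3" "nrm X (u t - T (t - q) (u q)) < e / 3"
        using d q elim by auto
      ultimately show ?case using elim by simp
    qed
  qed
qed

end

lemma (in analytic_generator) smoothing_target_E1: "smoothing_target K sc E1 A T E1 1"
proof unfold_locales
  obtain C where C: "C \<ge> 0" "\<And>x. x \<in> carr E1 \<Longrightarrow> nrm E1 x \<le> C * (norm x + norm (A x))"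
    "\<And>x. x \<in> carr E1 \<Longrightarrow> norm (A x) \<le> C * nrm E1 x" "\<And>x. x \<in> carr E1 \<Longrightarrow> norm x \<le> C * nrm E1 x"
    by (rule E1_graph_norm) (rule that)
  show "\<exists>C\<ge>0. \<forall>x\<in>carr E1. norm x \<le> C * nrm E1 x" using C(1,4) by blast
  fix \<tau> :: real assume \<tau>: "\<tau> > 0"
  obtain M where M: "M \<ge> 1" "\<And>t x. t \<le> \<tau> \<Longrightarrow> norm (T t x) \<le> M * norm x" using T_bound by blast
  obtain B where B: "B \<ge> 0" "\<And>t x. 0 < t \<Longrightarrow> t \<le> \<tau> \<Longrightarrow> norm (A (T t x)) \<le> B * t powr -1 * norm x"
    by (rule AT_bound[OF \<tau>]) (rule that)
  have "T t x \<in> carr E1 \<and> nrm E1 (T t x) \<le> (C * (M * \<tau> + B)) * t powr -1 * norm x" if t: "0 < t" "t \<le> \<tau>" for t x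
  proof
    show *: "T t x \<in> carr E1" using t by (intro T_smooth)
    have t1: "t powr -1 = inverse t" using t by (simp add: powr_minus)
    have "M * norm x \<le> M * \<tau> * t powr -1 * norm x"
    proof -
      have "1 \<le> \<tau> * inverse t" using t by (simp add: field_simps)
      then have "(M * norm x) * 1 \<le> (M * norm x) * (\<tau> * inverse t)" using M(1) by (intro mult_left_mono) auto
      then show ?thesis unfolding t1 by (simp only: mult_ac mult_1_right)
    qed
    then have "norm (T t x) + norm (A (T t x)) \<le> (M * \<tau> + B) * t powr -1 * norm x"
      using M(2)[OF t(2), of x] B(2)[OF t, of x] unfolding distrib_right by linarith
    then have "C * (norm (T t x) + norm (A (T t x))) \<le> C * ((M * \<tau> + B) * t powr -1 * norm x)"
      using C(1) by (intro mult_left_mono)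
    then show "nrm E1 (T t x) \<le> (C * (M * \<tau> + B)) * t powr -1 * norm x"
      using C(2)[OF *] by (simp add: mult.assoc)
  qed
  moreover have "C * (M * \<tau> + B) \<ge> 0" using C(1) M(1) B(1) \<tau> by simp
  ultimately show "\<exists>C\<ge>0. \<forall>t x. 0 < t \<and> t \<le> \<tau> \<longrightarrow> T t x \<in> carr E1 \<and> nrm E1 (T t x) \<le> C * t powr - 1 * norm x"
    by (intro exI[of _ "C * (M * \<tau> + B)"] conjI allI impI) simp_all
qed simp

section \<open>Interpolation spaces\<close>

lemma powr_inverse_scaled:
  fixes C t a :: real
  assumes "0 \<le> C" "0 < t"
  shows "(C * t powr -1) powr a = C powr a * t powr (- a)"
proof -
  have "(C * t powr -1) powr a = C powr a * (t powr -1) powr a"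
    by (rule powr_mult)
  also have "(t powr -1) powr a = t powr (-1 * a)"
    by (rule powr_powr)
  finally show ?thesis by simp
qed

context scalars
begin

lemma op_norm_bounds:
  assumes X: "banach_subspace K sc X" and Y: "banach_subspace K sc Y" and S: "bounded_op K sc X Y S"
  shows "0 \<le> op_norm X Y S"
    and "\<And>x. x \<in> carr X \<Longrightarrow> nrm Y (S x) \<le> op_norm X Y S * nrm X x"
    and "\<And>M. 0 \<le> M \<Longrightarrow> (\<And>x. x \<in> carr X \<Longrightarrow> nrm Y (S x) \<le> M * nrm X x) \<Longrightarrow> op_norm X Y S \<le> M"
proof -
  interpret X: normed_subspace K sc X by unfold_locales (rule X)
  interpret Y: normed_subspace K sc Y by unfold_locales (rule Y)
  obtain c where c: "\<And>x. x \<in> carr X \<Longrightarrow> nrm Y (S x) \<le> c * nrm X x"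
    using S unfolding bounded_op_def by blast
  have zero: "0 \<in> nball X 1" by (simp add: nball_def)
  have bdd: "bdd_above ((\<lambda>x. nrm Y (S x)) ` nball X 1)"
  proof (rule bdd_aboveI2)
    fix x assume x: "x \<in> nball X 1"
    have "nrm Y (S x) \<le> c * nrm X x" using x c by (simp add: nball_def)
    also have "\<dots> \<le> \<bar>c\<bar> * nrm X x" by (rule mult_right_mono) auto
    also have "\<dots> \<le> \<bar>c\<bar> * 1" using x by (intro mult_left_mono) (auto simp: nball_def)
    finally show "nrm Y (S x) \<le> \<bar>c\<bar> * 1" .
  qed
  show pos: "0 \<le> op_norm X Y S"
    unfolding op_norm_def using cSUP_upper[OF zero bdd] Y.nrm_nonneg[of "S 0"] by linarith
  show "nrm Y (S x) \<le> op_norm X Y S * nrm X x" if x: "x \<in> carr X" for x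
  proof (cases "x = 0")
    case True
    have "\<forall>x\<in>carr X. \<forall>y\<in>carr X. S (x + y) = S x + S y" using S unfolding bounded_op_def by blast
    then have "S (0 + 0) = S 0 + S 0" using X.carr_zero by blast
    then show ?thesis using True by simp
  next
    case False
    then have n: "nrm X x > 0" using X.nrm_eq_0[OF x] X.nrm_nonneg[of x] by linarith
    have "S (sc (of_real (inverse (nrm X x))) x) = sc (of_real (inverse (nrm X x))) (S x)"
      using S x of_real_in_K[of "inverse (nrm X x)"] unfolding bounded_op_def by blast
    then have eq: "S (x /\<^sub>R nrm X x) = S x /\<^sub>R nrm X x"
      by (simp only: sc_of_real)
    have "x /\<^sub>R nrm X x \<in> nball X 1"
      using n X.carr_scale[OF x] X.nrm_scale[OF x, of "inverse (nrm X x)"] by (simp add: nball_def)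
    then have "nrm Y (S (x /\<^sub>R nrm X x)) \<le> op_norm X Y S"
      unfolding op_norm_def by (rule cSUP_upper[OF _ bdd])
    moreover have "S x \<in> carr Y" using S x by (simp add: bounded_op_def)
    ultimately have "inverse (nrm X x) * nrm Y (S x) \<le> op_norm X Y S"
      using n Y.nrm_scale[of "S x" "inverse (nrm X x)"] by (simp add: eq)
    then show ?thesis using n by (simp add: field_simps)
  qed
  show "op_norm X Y S \<le> M" if "0 \<le> M" "\<And>x. x \<in> carr X \<Longrightarrow> nrm Y (S x) \<le> M * nrm X x" for M
    unfolding op_norm_def
  proof (rule cSUP_least)
    fix x assume x: "x \<in> nball X 1"
    then have "nrm Y (S x) \<le> M * nrm X x" using that by (simp add: nball_def)
    also have "\<dots> \<le> M * 1" using x that(1) by (intro mult_left_mono) (auto simp: nball_def)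
    finally show "nrm Y (S x) \<le> M" by simp
  qed (use zero in blast)
qed

text \<open>Operator norms are replaced by arbitrary upper bounds, which is legitimate because both
  exponents are positive. The constant c is chosen before S, so the bound applies uniformly to the
  whole family T t.\<close>

lemma interpolation_bound:
  assumes F: "interpolation_functor K sc \<theta> F" and \<theta>: "0 < \<theta>" "\<theta> < 1"
    and X: "banach_couple K sc X0 X1" and Y: "banach_couple K sc Y0 Y1"
  shows "\<exists>c>0. \<forall>S M0 M1. 0 \<le> M0 \<and> 0 \<le> M1 \<and>
      (\<forall>x\<in>carr X0. S x \<in> carr Y0 \<and> nrm Y0 (S x) \<le> M0 * nrm X0 x) \<and>
      (\<forall>x\<in>carr X1. S x \<in> carr Y1 \<and> nrm Y1 (S x) \<le> M1 * nrm X1 x) \<and>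
      (\<forall>x\<in>carr X0. \<forall>y\<in>carr X0. S (x + y) = S x + S y) \<and>
      (\<forall>a\<in>K. \<forall>x\<in>carr X0. S (sc a x) = sc a (S x)) \<longrightarrow>
      (\<forall>x\<in>carr (F X0 X1). S x \<in> carr (F Y0 Y1) \<and>
         nrm (F Y0 Y1) (S x) \<le> c * M0 powr (1 - \<theta>) * M1 powr \<theta> * nrm (F X0 X1) x)"
proof -
  obtain c where c: "c > 0" "\<And>S. bounded_op K sc X0 Y0 S \<Longrightarrow> bounded_op K sc X1 Y1 S \<Longrightarrow>
      bounded_op K sc (F X0 X1) (F Y0 Y1) S \<and>
      op_norm (F X0 X1) (F Y0 Y1) S \<le> c * op_norm X0 Y0 S powr (1 - \<theta>) * op_norm X1 Y1 S powr \<theta>"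
    using F X Y unfolding interpolation_functor_def by blast
  have b: "banach_subspace K sc X0" "banach_subspace K sc X1" "banach_subspace K sc Y0" "banach_subspace K sc Y1"
    "carr X1 \<subseteq> carr X0"
    using X Y by (auto simp: banach_couple_def cont_embedded_def)
  have bF: "banach_subspace K sc (F X0 X1)" "banach_subspace K sc (F Y0 Y1)"
    using F X Y unfolding interpolation_functor_def by blast+
  interpret FX: normed_subspace K sc "F X0 X1" by unfold_locales (rule bF)
  have main: "S x \<in> carr (F Y0 Y1) \<and> nrm (F Y0 Y1) (S x) \<le> c * M0 powr (1 - \<theta>) * M1 powr \<theta> * nrm (F X0 X1) x"
    if M: "0 \<le> M0" "0 \<le> M1"
      and S0: "\<forall>x\<in>carr X0. S x \<in> carr Y0 \<and> nrm Y0 (S x) \<le> M0 * nrm X0 x"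
      and S1: "\<forall>x\<in>carr X1. S x \<in> carr Y1 \<and> nrm Y1 (S x) \<le> M1 * nrm X1 x"
      and add: "\<forall>x\<in>carr X0. \<forall>y\<in>carr X0. S (x + y) = S x + S y"
      and hom: "\<forall>a\<in>K. \<forall>x\<in>carr X0. S (sc a x) = sc a (S x)"
      and x: "x \<in> carr (F X0 X1)" for S M0 M1 x
  proof -
    have B0: "bounded_op K sc X0 Y0 S"
      unfolding bounded_op_def using S0 add hom by blast
    have B1: "bounded_op K sc X1 Y1 S"
      unfolding bounded_op_def using S1 add hom b(5) by blast
    have B: "bounded_op K sc (F X0 X1) (F Y0 Y1) S"
      and le: "op_norm (F X0 X1) (F Y0 Y1) S \<le> c * op_norm X0 Y0 S powr (1 - \<theta>) * op_norm X1 Y1 S powr \<theta>"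
      using c(2)[OF B0 B1] by auto
    have "op_norm X0 Y0 S powr (1 - \<theta>) \<le> M0 powr (1 - \<theta>)" "op_norm X1 Y1 S powr \<theta> \<le> M1 powr \<theta>"
      using op_norm_bounds(1,3)[OF b(1,3) B0] op_norm_bounds(1,3)[OF b(2,4) B1] M S0 S1 \<theta>
      by (auto intro!: powr_mono2)
    then have "c * op_norm X0 Y0 S powr (1 - \<theta>) * op_norm X1 Y1 S powr \<theta> \<le> c * M0 powr (1 - \<theta>) * M1 powr \<theta>"
      using c(1) by (intro mult_mono mult_left_mono) auto
    with le have "op_norm (F X0 X1) (F Y0 Y1) S * nrm (F X0 X1) x \<le> (c * M0 powr (1 - \<theta>) * M1 powr \<theta>) * nrm (F X0 X1) x"
      by (intro mult_right_mono) auto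
    moreover have "nrm (F Y0 Y1) (S x) \<le> op_norm (F X0 X1) (F Y0 Y1) S * nrm (F X0 X1) x"
      by (rule op_norm_bounds(2)[OF bF B x])
    moreover have "S x \<in> carr (F Y0 Y1)" using B x by (simp add: bounded_op_def)
    ultimately show ?thesis by simp
  qed
  show ?thesis
    by (intro exI[of _ c] conjI allI impI ballI)
      (rule c(1), (elim conjE, rule conjunct1[OF main], assumption+), (elim conjE, rule conjunct2[OF main], assumption+))
qed

end

text \<open>Records what the existence proof takes from the functor: besides smoothing from E_0, the
  gain that a starting point in X brings (\<open>AT_from\<close>) and strong continuity of the
  semigroup on X. The exponent 0 is included, since E_0 is the whole type and not a value of a
  functor.\<close>

locale interpolation_space = smoothing_target K sc E1 A T X \<theta>
  for K :: "complex set" and sc :: "complex \<Rightarrow> 'e::banach \<Rightarrow> 'e"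
    and E1 :: "'e nspace" and A :: "'e \<Rightarrow> 'e" and T :: "real \<Rightarrow> 'e \<Rightarrow>\<^sub>L 'e" and X :: "'e nspace" and \<theta> :: real +
  assumes \<theta>_less_1: "\<theta> < 1"
    and E1_embed: "\<exists>C\<ge>0. \<forall>x\<in>carr E1. x \<in> carr X \<and> nrm X x \<le> C * nrm E1 x"
    and AT_from: "\<And>\<tau>. \<tau> > 0 \<Longrightarrow> \<exists>C\<ge>0. \<forall>t x. 0 < t \<and> t \<le> \<tau> \<and> x \<in> carr X \<longrightarrow>
      norm (A (T t x)) \<le> C * t powr (\<theta> - 1) * nrm X x"
    and T_bounded_X: "\<And>\<tau>. \<tau> > 0 \<Longrightarrow> \<exists>C\<ge>0. \<forall>t x. 0 \<le> t \<and> t \<le> \<tau> \<and> x \<in> carr X \<longrightarrow>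
      T t x \<in> carr X \<and> nrm X (T t x) \<le> C * nrm X x"
    and T_right_cont_X: "\<And>x. x \<in> carr X \<Longrightarrow> ((\<lambda>t. nrm X (T t x - x)) \<longlongrightarrow> 0) (at_right 0)"

context analytic_generator
begin

lemma interpolation_space_whole: "interpolation_space K sc E1 A T whole_space 0"
proof unfold_locales
  fix \<tau> :: real assume \<tau>: "\<tau> > 0"
  obtain M where M: "M \<ge> 1" "\<And>t x. t \<le> \<tau> \<Longrightarrow> norm (T t x) \<le> M * norm x" using T_bound by blast
  show "\<exists>C\<ge>0. \<forall>t x. 0 < t \<and> t \<le> \<tau> \<longrightarrow> T t x \<in> carr whole_space \<and>
      nrm whole_space (T t x) \<le> C * t powr - 0 * norm x"
    using M by (intro exI[of _ M]) auto
  show "\<exists>C\<ge>0. \<forall>t x. 0 \<le> t \<and> t \<le> \<tau> \<and> x \<in> carr whole_space \<longrightarrow> T t x \<in> carr whole_space \<and>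
      nrm whole_space (T t x) \<le> C * nrm whole_space x"
    using M by (intro exI[of _ M]) auto
  obtain C where C: "C \<ge> 0" "\<And>t x. 0 < t \<Longrightarrow> t \<le> \<tau> \<Longrightarrow> norm (A (T t x)) \<le> C * t powr -1 * norm x"
    by (rule AT_bound[OF \<tau>]) (rule that)
  then show "\<exists>C\<ge>0. \<forall>t x. 0 < t \<and> t \<le> \<tau> \<and> x \<in> carr whole_space \<longrightarrow>
      norm (A (T t x)) \<le> C * t powr (0 - 1) * nrm whole_space x"
    by (intro exI[of _ C]) auto
next
  fix x :: 'e
  have "((\<lambda>t. T t x - x) \<longlongrightarrow> 0) (at_right 0)"
    using T_right_cont by (rule LIM_zero)
  then show "((\<lambda>t. nrm whole_space (T t x - x)) \<longlongrightarrow> 0) (at_right 0)"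
    by (simp add: tendsto_norm_zero)
next
  obtain C where C: "C \<ge> 0" "\<And>x. x \<in> carr E1 \<Longrightarrow> nrm E1 x \<le> C * (norm x + norm (A x))"
    "\<And>x. x \<in> carr E1 \<Longrightarrow> norm (A x) \<le> C * nrm E1 x" "\<And>x. x \<in> carr E1 \<Longrightarrow> norm x \<le> C * nrm E1 x"
    by (rule E1_graph_norm) (rule that)
  then show "\<exists>C\<ge>0. \<forall>x\<in>carr E1. x \<in> carr whole_space \<and> nrm whole_space x \<le> C * nrm E1 x"
    by (intro exI[of _ C]) auto
qed (auto intro: exI[of _ 1])

text \<open>Each estimate interpolates one operator between two end point bounds: T t on E_0 and on
  E_1 for boundedness; T t from E_0 to E_0 and to E_1 for smoothing; A T t from E_0 and from E_1 to
  E_0 for \<open>AT_from\<close>. Right continuity is clear on E_1 and extends by density, which is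
  where admissibility enters.\<close>

lemma interpolation_space_functor:
  assumes adm: "admissible_functor K sc \<theta> F" and \<theta>: "0 < \<theta>" "\<theta> < 1"
  shows "interpolation_space K sc E1 A T (F whole_space E1) \<theta>"
proof -
  let ?E0 = "whole_space :: 'e nspace"
  define X where "X = F ?E0 E1"
  \<comment> \<open>Two of the three estimates involve the degenerate couple (E_0, E_0). Its
    interpolation space lies between E_0 and E_0, hence is E_0 with an equivalent norm;
    \<open>z1\<close> and \<open>z2\<close> are the two constants.\<close>
  define Z where "Z = F ?E0 ?E0"
  have F: "interpolation_functor K sc \<theta> F" using adm by (simp add: admissible_functor_def)
  have c01: "banach_couple K sc ?E0 E1"
    by (simp add: banach_couple_def banach_subspace_whole E1 E1_embedded)
  have c00: "banach_couple K sc ?E0 ?E0"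
    by (auto simp: banach_couple_def banach_subspace_whole cont_embedded_def intro: exI[of _ 1])
  have dense: "dense_in E1 X"
    using adm c01 E1_dense unfolding admissible_functor_def X_def by blast
  have X: "banach_subspace K sc X" "cont_embedded E1 X" "cont_embedded X ?E0"
    using F c01 unfolding interpolation_functor_def X_def by blast+
  have Z: "cont_embedded ?E0 Z" "cont_embedded Z ?E0"
    using F c00 unfolding interpolation_functor_def Z_def by blast+
  interpret X: normed_subspace K sc X by unfold_locales (rule X)
  interpret T1: smoothing_target K sc E1 A T E1 1 by (rule smoothing_target_E1)
  have Z_UNIV: "x \<in> carr Z" for x using Z(1) by (auto simp: cont_embedded_def)
  obtain z1 where "\<And>x. nrm Z x \<le> z1 * norm x" using Z(1) by (auto simp: cont_embedded_def)
  then have z1: "nrm Z x \<le> \<bar>z1\<bar> * norm x" for x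
    using mult_right_mono[OF abs_ge_self norm_ge_zero, of z1 x] by (meson order_trans)
  obtain z2 where z2': "\<And>x. norm x \<le> z2 * nrm Z x" using Z(2) Z_UNIV by (auto simp: cont_embedded_def)
  have z2: "norm x \<le> \<bar>z2\<bar> * \<bar>nrm Z x\<bar>" for x
    using z2'[of x] abs_ge_self[of "z2 * nrm Z x"] by (simp add: abs_mult)
  have "0 \<le> nrm Z x" for x
  proof -
    have "banach_subspace K sc Z" using F c00 unfolding interpolation_functor_def Z_def by blast
    then interpret Z: normed_subspace K sc Z by unfold_locales
    show ?thesis by simp
  qed
  then have z2: "norm x \<le> \<bar>z2\<bar> * nrm Z x" for x using z2[of x] by simp
  obtain C1 where C1: "C1 \<ge> 0" "\<And>x. x \<in> carr E1 \<Longrightarrow> nrm E1 x \<le> C1 * (norm x + norm (A x))"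
    "\<And>x. x \<in> carr E1 \<Longrightarrow> norm (A x) \<le> C1 * nrm E1 x" "\<And>x. x \<in> carr E1 \<Longrightarrow> norm x \<le> C1 * nrm E1 x"
    by (rule E1_graph_norm) (rule that)
  obtain e1 where e1': "\<forall>x\<in>carr E1. nrm X x \<le> e1 * nrm E1 x" "carr E1 \<subseteq> carr X"
    using X(2) unfolding cont_embedded_def by blast
  have e1: "nrm X x \<le> \<bar>e1\<bar> * nrm E1 x" if "x \<in> carr E1" for x
    using e1'(1) that mult_right_mono[OF abs_ge_self, of "nrm E1 x" e1] by fastforce
  obtain e0 where e0': "\<forall>x\<in>carr X. norm x \<le> e0 * nrm X x"
    using X(3) unfolding cont_embedded_def by auto
  have e0: "norm x \<le> \<bar>e0\<bar> * nrm X x" if "x \<in> carr X" for x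
    using e0' that mult_right_mono[OF abs_ge_self, of "nrm X x" e0] by fastforce
  have AT_lin: "A (T t (x + y)) = A (T t x) + A (T t y)" "a \<in> K \<Longrightarrow> A (T t (sc a x)) = sc a (A (T t x))"
    if "t > 0" for t x y a
    using that by (simp_all add: blinfun.add_right A_add T_smooth T_sc A_sc)
  have bd: "\<exists>C\<ge>0. \<forall>t x. 0 \<le> t \<and> t \<le> \<tau> \<and> x \<in> carr X \<longrightarrow> T t x \<in> carr X \<and> nrm X (T t x) \<le> C * nrm X x"
    if \<tau>: "\<tau> > 0" for \<tau>
  proof -
    obtain c where c: "c > 0" "\<forall>S M0 M1. 0 \<le> M0 \<and> 0 \<le> M1 \<and>
      (\<forall>x\<in>carr ?E0. S x \<in> carr ?E0 \<and> nrm ?E0 (S x) \<le> M0 * nrm ?E0 x) \<and>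
      (\<forall>x\<in>carr E1. S x \<in> carr E1 \<and> nrm E1 (S x) \<le> M1 * nrm E1 x) \<and>
      (\<forall>x\<in>carr ?E0. \<forall>y\<in>carr ?E0. S (x + y) = S x + S y) \<and>
      (\<forall>a\<in>K. \<forall>x\<in>carr ?E0. S (sc a x) = sc a (S x)) \<longrightarrow>
      (\<forall>x\<in>carr X. S x \<in> carr X \<and> nrm X (S x) \<le> c * M0 powr (1 - \<theta>) * M1 powr \<theta> * nrm X x)"
      using interpolation_bound[OF F \<theta> c01 c01] unfolding X_def by blast
    obtain M where M: "M \<ge> 1" "\<And>t x. t \<le> \<tau> \<Longrightarrow> norm (T t x) \<le> M * norm x" using T_bound by blast
    have E1b: "nrm E1 (T t x) \<le> (C1 * (M * C1 + M * C1)) * nrm E1 x" if "t \<le> \<tau>" "x \<in> carr E1" for t x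
    proof -
      have "norm (T t x) + norm (A (T t x)) \<le> M * norm x + M * norm (A x)"
        using M(2)[OF that(1)] T_E1(2)[OF that(2)] by (intro add_mono) auto
      also have "\<dots> \<le> M * (C1 * nrm E1 x) + M * (C1 * nrm E1 x)"
        using C1(3,4)[OF that(2)] M(1) by (intro add_mono mult_left_mono) auto
      finally have "C1 * (norm (T t x) + norm (A (T t x))) \<le> C1 * (M * (C1 * nrm E1 x) + M * (C1 * nrm E1 x))"
        using C1(1) by (rule mult_left_mono)
      then show ?thesis
        using C1(2)[OF T_E1(1)[OF that(2)], of t] by (simp add: algebra_simps)
    qed
    define B where "B = c * M powr (1 - \<theta>) * (C1 * (M * C1 + M * C1)) powr \<theta>"
    have "T t x \<in> carr X \<and> nrm X (T t x) \<le> B * nrm X x" if t: "0 \<le> t" "t \<le> \<tau>" and x: "x \<in> carr X" for t x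
    proof -
      have "0 \<le> M" "0 \<le> C1 * (M * C1 + M * C1)" using M(1) C1(1) by auto
      then have "\<forall>x\<in>carr X. T t x \<in> carr X \<and> nrm X (T t x) \<le> c * M powr (1 - \<theta>) * (C1 * (M * C1 + M * C1)) powr \<theta> * nrm X x"
        using M(2)[OF t(2)] E1b[OF t(2)] T_E1(1) T_sc
        by (intro ballI c(2)[rule_format, of M "C1 * (M * C1 + M * C1)" "T t"]) (auto simp: blinfun.add_right)
      then show ?thesis using x by (simp add: B_def)
    qed
    moreover have "B \<ge> 0" using c(1) by (simp add: B_def)
    ultimately show ?thesis by (intro exI[of _ B]) simp
  qed
  show ?thesis unfolding X_def[symmetric]
  proof unfold_locales
    fix \<tau> :: real assume \<tau>: "\<tau> > 0"
    obtain M where M: "M \<ge> 1" "\<And>t x. t \<le> \<tau> \<Longrightarrow> norm (T t x) \<le> M * norm x" using T_bound by blast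
    show "\<exists>C\<ge>0. \<forall>t x. 0 \<le> t \<and> t \<le> \<tau> \<and> x \<in> carr X \<longrightarrow> T t x \<in> carr X \<and> nrm X (T t x) \<le> C * nrm X x"
      by (rule bd[OF \<tau>])
    show "\<exists>C\<ge>0. \<forall>t x. 0 < t \<and> t \<le> \<tau> \<longrightarrow> T t x \<in> carr X \<and> nrm X (T t x) \<le> C * t powr - \<theta> * norm x"
    proof -
      obtain c where c: "c > 0" "\<forall>S M0 M1. 0 \<le> M0 \<and> 0 \<le> M1 \<and>
        (\<forall>x\<in>carr ?E0. S x \<in> carr ?E0 \<and> nrm ?E0 (S x) \<le> M0 * nrm ?E0 x) \<and>
        (\<forall>x\<in>carr ?E0. S x \<in> carr E1 \<and> nrm E1 (S x) \<le> M1 * nrm ?E0 x) \<and>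
        (\<forall>x\<in>carr ?E0. \<forall>y\<in>carr ?E0. S (x + y) = S x + S y) \<and>
        (\<forall>a\<in>K. \<forall>x\<in>carr ?E0. S (sc a x) = sc a (S x)) \<longrightarrow>
        (\<forall>x\<in>carr Z. S x \<in> carr X \<and> nrm X (S x) \<le> c * M0 powr (1 - \<theta>) * M1 powr \<theta> * nrm Z x)"
        using interpolation_bound[OF F \<theta> c00 c01] unfolding X_def Z_def by blast
      obtain C where C: "C \<ge> 0" "\<And>t x. 0 < t \<Longrightarrow> t \<le> \<tau> \<Longrightarrow> nrm E1 (T t x) \<le> C * t powr -1 * norm x"
        using T1.smooth_bound[where \<tau> = \<tau>] by blast
      define B where "B = c * M powr (1 - \<theta>) * C powr \<theta> * \<bar>z1\<bar>"
      have "T t x \<in> carr X \<and> nrm X (T t x) \<le> B * t powr - \<theta> * norm x" if t: "0 < t" "t \<le> \<tau>" for t x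
      proof -
        have "0 \<le> M" "0 \<le> C * t powr -1" using M(1) C(1) by auto
        then have *: "T t x \<in> carr X \<and> nrm X (T t x) \<le> c * M powr (1 - \<theta>) * (C * t powr -1) powr \<theta> * nrm Z x"
          using c(2)[rule_format, of M "C * t powr -1" "T t" x] M(2)[OF t(2)] C(2)[OF t] T_smooth[OF t(1)] T_sc Z_UNIV
          by (simp add: blinfun.add_right)
        have "c * M powr (1 - \<theta>) * (C * t powr -1) powr \<theta> * nrm Z x \<le> c * M powr (1 - \<theta>) * (C * t powr -1) powr \<theta> * (\<bar>z1\<bar> * norm x)"
          using z1[of x] c(1) by (intro mult_left_mono) auto
        also have "\<dots> = B * t powr - \<theta> * norm x"
          unfolding powr_inverse_scaled[OF C(1) t(1)] by (simp add: B_def)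
        finally show ?thesis using * by linarith
      qed
      moreover have "B \<ge> 0" using c(1) by (simp add: B_def)
      ultimately show ?thesis by (intro exI[of _ B]) simp
    qed
    show "\<exists>C\<ge>0. \<forall>t x. 0 < t \<and> t \<le> \<tau> \<and> x \<in> carr X \<longrightarrow> norm (A (T t x)) \<le> C * t powr (\<theta> - 1) * nrm X x"
    proof -
      obtain c where c: "c > 0" "\<forall>S M0 M1. 0 \<le> M0 \<and> 0 \<le> M1 \<and>
        (\<forall>x\<in>carr ?E0. S x \<in> carr ?E0 \<and> nrm ?E0 (S x) \<le> M0 * nrm ?E0 x) \<and>
        (\<forall>x\<in>carr E1. S x \<in> carr ?E0 \<and> nrm ?E0 (S x) \<le> M1 * nrm E1 x) \<and>
        (\<forall>x\<in>carr ?E0. \<forall>y\<in>carr ?E0. S (x + y) = S x + S y) \<and>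
        (\<forall>a\<in>K. \<forall>x\<in>carr ?E0. S (sc a x) = sc a (S x)) \<longrightarrow>
        (\<forall>x\<in>carr X. S x \<in> carr Z \<and> nrm Z (S x) \<le> c * M0 powr (1 - \<theta>) * M1 powr \<theta> * nrm X x)"
        using interpolation_bound[OF F \<theta> c01 c00] unfolding X_def Z_def by blast
      obtain C where C: "C \<ge> 0" "\<And>t x. 0 < t \<Longrightarrow> t \<le> \<tau> \<Longrightarrow> norm (A (T t x)) \<le> C * t powr -1 * norm x"
        by (rule AT_bound[OF \<tau>]) (rule that)
      define B where "B = \<bar>z2\<bar> * (c * C powr (1 - \<theta>) * (M * C1) powr \<theta>)"
      have "norm (A (T t x)) \<le> B * t powr (\<theta> - 1) * nrm X x" if t: "0 < t" "t \<le> \<tau>" and x: "x \<in> carr X" for t x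
      proof -
        have "0 \<le> M * C1" "0 \<le> C * t powr -1" using M(1) C(1) C1(1) by auto
        \<comment> \<open>On E_1 the operators A and T t commute, so there is no singularity; only
          the E_0 end point contributes 1/t, raised to the power 1 - \<theta>.\<close>
        moreover have "norm (A (T t y)) \<le> M * C1 * nrm E1 y" if "y \<in> carr E1" for y
        proof -
          have "norm (T t (A y)) \<le> M * norm (A y)" by (rule M(2)[OF t(2)])
          also have "\<dots> \<le> M * (C1 * nrm E1 y)" using M(1) C1(3)[OF that] by (intro mult_left_mono) auto
          finally show ?thesis using T_E1(2)[OF that] by simp
        qed
        ultimately have *: "nrm Z (A (T t x)) \<le> c * (C * t powr -1) powr (1 - \<theta>) * (M * C1) powr \<theta> * nrm X x"
          using c(2)[rule_format, of "C * t powr -1" "M * C1" "\<lambda>x. A (T t x)" x] C(2)[OF t] AT_lin[OF t(1)] x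
          by simp
        have "norm (A (T t x)) \<le> \<bar>z2\<bar> * (c * (C * t powr -1) powr (1 - \<theta>) * (M * C1) powr \<theta> * nrm X x)"
          using z2[of "A (T t x)"] mult_left_mono[OF *, of "\<bar>z2\<bar>"] by simp
        also have "\<dots> = B * t powr (\<theta> - 1) * nrm X x"
          unfolding powr_inverse_scaled[OF C(1) t(1)] by (simp add: B_def)
        finally show ?thesis .
      qed
      moreover have "B \<ge> 0" using c(1) by (simp add: B_def)
      ultimately show ?thesis by (intro exI[of _ B]) simp
    qed
  next
    show "\<exists>C\<ge>0. \<forall>x\<in>carr X. norm x \<le> C * nrm X x"
      using e0 by (intro exI[of _ "\<bar>e0\<bar>"]) auto
    show "\<exists>C\<ge>0. \<forall>x\<in>carr E1. x \<in> carr X \<and> nrm X x \<le> C * nrm E1 x"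
      using e1 e1'(2) by (intro exI[of _ "\<bar>e1\<bar>"]) auto
  next
    fix x assume x: "x \<in> carr X"
    obtain B where B: "B \<ge> 0" "\<forall>t x. 0 \<le> t \<and> t \<le> 1 \<and> x \<in> carr X \<longrightarrow> T t x \<in> carr X \<and> nrm X (T t x) \<le> B * nrm X x"
      using bd[of 1] by auto
    show "((\<lambda>t. nrm X (T t x - x)) \<longlongrightarrow> 0) (at_right 0)"
    proof (rule tendstoI)
      fix e :: real assume e: "e > 0"
      \<comment> \<open>B + 1 bounds T t - 1 on X for t in [0, 1], so replacing x by a point y of
        E_1 within distance d = e/(2(B + 1)) costs at most e/2.\<close>
      define b where "b = B + 1"
      have b: "b > 0" "B + 1 = b" using B(1) by (simp_all add: b_def)
      define d where "d = e / 2 / b"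
      have "d > 0" "b * d = e / 2" using e b(1) by (simp_all add: d_def)
      then have d: "d > 0" "(B + 1) * d = e / 2" unfolding b(2) by simp_all
      have "x \<in> X.mtopology closure_of carr E1"
        using x dense by (simp add: dense_in_def X.ntop_eq)
      then obtain y where y: "y \<in> carr E1" "nrm X (x - y) < d"
        using d(1) unfolding X.metric_closure_of by (auto simp: ndist_def)
      have yX: "y \<in> carr X" using y(1) e1'(2) by blast
      have "((\<lambda>t. \<bar>e1\<bar> * (C1 * (norm (T t y - y) + norm (T t (A y) - A y)))) \<longlongrightarrow> \<bar>e1\<bar> * (C1 * (0 + 0))) (at_right 0)"
        by (intro tendsto_mult_left tendsto_add tendsto_norm_zero LIM_zero T_right_cont)
      then have "\<forall>\<^sub>F t in at_right 0. \<bar>e1\<bar> * (C1 * (norm (T t y - y) + norm (T t (A y) - A y))) < e / 2"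
        by (rule order_tendstoD(2)) (use e in simp)
      moreover have "\<forall>\<^sub>F t in at_right 0. t \<in> {0<..<1::real}" by (rule eventually_at_right_real) simp
      ultimately show "\<forall>\<^sub>F t in at_right 0. dist (nrm X (T t x - x)) 0 < e"
      proof eventually_elim
        case (elim t)
        have Ty: "T t y - y \<in> carr E1" using T_E1(1)[OF y(1)] y(1) by blast
        have "nrm X (T t y - y) \<le> \<bar>e1\<bar> * nrm E1 (T t y - y)" by (rule e1[OF Ty])
        also have "\<dots> \<le> \<bar>e1\<bar> * (C1 * (norm (T t y - y) + norm (A (T t y - y))))"
          by (intro mult_left_mono C1(2)[OF Ty]) simp
        also have "A (T t y - y) = T t (A y) - A y"
          using A_diff[OF T_E1(1)[OF y(1)] y(1)] T_E1(2)[OF y(1)] by simp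
        finally have 1: "nrm X (T t y - y) < e / 2" using elim by linarith
        have "x - y \<in> carr X" using x yX by blast
        then have xy: "x - y \<in> carr X" "T t (x - y) \<in> carr X" "T t y - y \<in> carr X"
          using B(2)[rule_format, of t "x - y"] elim Ty e1'(2) by auto
        have 2: "nrm X (T t (x - y)) \<le> B * nrm X (x - y)" using B(2) elim xy by simp
        have eq: "T t x - x = (T t (x - y) - (x - y)) + (T t y - y)" by (simp add: blinfun.diff_right)
        have "nrm X (T t x - x) \<le> nrm X (T t (x - y)) + nrm X (x - y) + nrm X (T t y - y)"
          using X.nrm_triangle[OF X.carr_diff[OF xy(2,1)] xy(3)] X.nrm_triangle_diff[OF xy(2,1)]
            arg_cong[OF eq, of "nrm X"] by linarith
        also have "\<dots> \<le> (B + 1) * nrm X (x - y) + nrm X (T t y - y)"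
          using 2 by (simp add: distrib_right)
        also have "(B + 1) * nrm X (x - y) \<le> (B + 1) * d"
          using y(2) B(1) by (intro mult_left_mono) auto
        also note d(2)
        finally show ?case using 1 by simp
      qed
    qed
  qed (use \<theta> in auto)
qed

end

section \<open>Estimates for orbits and convolutions\<close>

lemma has_integral_powr_Icc:
  fixes b :: real
  assumes "0 < s" "s \<le> t" "b \<noteq> -1"
  shows "((\<lambda>r. r powr b) has_integral ((t powr (b + 1) - s powr (b + 1)) / (b + 1))) {s..t}"
proof -
  have "((\<lambda>r. r powr b) has_integral (t powr (b + 1) / (b + 1) - s powr (b + 1) / (b + 1))) {s..t}"
  proof (rule fundamental_theorem_of_calculus)
    fix x assume x: "x \<in> {s..t}"
    have "((\<lambda>r. r powr (b + 1) / (b + 1)) has_real_derivative ((b + 1) * x powr (b + 1 - 1)) / (b + 1)) (at x within {s..t})"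
      by (intro DERIV_cdivide DERIV_subset[OF has_real_derivative_powr]) (use x assms in auto)
    then show "((\<lambda>r. r powr (b + 1) / (b + 1)) has_vector_derivative x powr b) (at x within {s..t})"
      using assms(3) by (simp add: has_real_derivative_iff_has_vector_derivative add_eq_0_iff)
  qed (use assms in auto)
  then show ?thesis by (simp add: diff_divide_distrib)
qed

lemma has_integral_powr_reflected:
  fixes \<beta> :: real
  assumes "\<beta> < 1" "a \<le> b"
  shows "((\<lambda>r. (b - r) powr (- \<beta>)) has_integral ((b - a) powr (1 - \<beta>) / (1 - \<beta>))) {a..b}"
proof -
  have "((\<lambda>x. x powr (- \<beta>)) has_integral ((b - a) powr (1 - \<beta>) / (1 - \<beta>))) {0..b - a}"
    using has_integral_powr_from_0[of "- \<beta>" "b - a"] assms by simp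
  then have "((\<lambda>x. (- x) powr (- \<beta>)) has_integral ((b - a) powr (1 - \<beta>) / (1 - \<beta>))) {- (b - a)..- 0}"
    by (subst has_integral_reflect_real)
  from has_integral_shift_real_ivl[OF this, of "- b"] show ?thesis
    by (simp add: algebra_simps)
qed

lemma powr_half: "0 < s \<Longrightarrow> (s / 2) powr (- a) = 2 powr a * s powr (- a)" for s a :: real
proof -
  have "(s / 2) powr (- a) = s powr (- a) / 2 powr (- a)" by (rule powr_divide)
  also have "\<dots> = 2 powr a * s powr (- a)"
    by (simp only: powr_minus[of 2] divide_inverse inverse_inverse_eq mult.commute)
  finally show ?thesis .
qed

text \<open>Each summand freezes the nonsingular one of the two factors of (s - r)^(-\<beta>)
  r^(-\<kappa>) at s/2. The sum has an explicit integral, so that \<open>beta_const\<close> replaces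
  Euler's Beta function at (1 - \<beta>, 1 - \<kappa>).\<close>

definition beta_majorant :: "real \<Rightarrow> real \<Rightarrow> real \<Rightarrow> real \<Rightarrow> real" where
  "beta_majorant \<beta> \<kappa> s r = 2 powr \<kappa> * s powr (- \<kappa>) * (s - r) powr (- \<beta>) + 2 powr \<beta> * s powr (- \<beta>) * r powr (- \<kappa>)"

definition beta_const :: "real \<Rightarrow> real \<Rightarrow> real" where
  "beta_const \<beta> \<kappa> = 2 powr \<kappa> / (1 - \<beta>) + 2 powr \<beta> / (1 - \<kappa>)"

lemma beta_const_nonneg: "\<beta> < 1 \<Longrightarrow> \<kappa> < 1 \<Longrightarrow> 0 \<le> beta_const \<beta> \<kappa>"
  by (simp add: beta_const_def)

lemma beta_majorant_has_integral:
  assumes "\<beta> < 1" "\<kappa> < 1" "0 < s"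
  shows "(beta_majorant \<beta> \<kappa> s has_integral beta_const \<beta> \<kappa> * s powr (1 - \<beta> - \<kappa>)) {0..s}"
proof -
  have "((\<lambda>r. 2 powr \<kappa> * s powr (- \<kappa>) * (s - r) powr (- \<beta>) + 2 powr \<beta> * s powr (- \<beta>) * r powr (- \<kappa>)) has_integral
      (2 powr \<kappa> * s powr (- \<kappa>) * ((s - 0) powr (1 - \<beta>) / (1 - \<beta>)) + 2 powr \<beta> * s powr (- \<beta>) * (s powr (- \<kappa> + 1) / (- \<kappa> + 1)))) {0..s}"
    by (intro has_integral_add has_integral_mult_right has_integral_powr_reflected has_integral_powr_from_0) (use assms in auto)
  moreover have "s powr (- \<kappa>) * s powr (1 - \<beta>) = s powr (1 - \<beta> - \<kappa>)" "s powr (- \<beta>) * s powr (- \<kappa> + 1) = s powr (1 - \<beta> - \<kappa>)"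
    by (simp_all flip: powr_add add: algebra_simps)
  then have "2 powr \<kappa> * s powr (- \<kappa>) * ((s - 0) powr (1 - \<beta>) / (1 - \<beta>)) + 2 powr \<beta> * s powr (- \<beta>) * (s powr (- \<kappa> + 1) / (- \<kappa> + 1))
      = beta_const \<beta> \<kappa> * s powr (1 - \<beta> - \<kappa>)"
    by (simp add: beta_const_def distrib_right mult.assoc)
  ultimately show ?thesis by (simp add: beta_majorant_def[abs_def])
qed

text \<open>One of \<open>r\<close> and \<open>s - r\<close> is at least \<open>s/2\<close>.\<close>

lemma beta_majorant_ge:
  assumes "0 \<le> \<beta>" "0 \<le> \<kappa>" "0 < r" "r < s"
  shows "(s - r) powr (- \<beta>) * r powr (- \<kappa>) \<le> beta_majorant \<beta> \<kappa> s r"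
proof (cases "s / 2 \<le> r")
  case True
  have "r powr (- \<kappa>) \<le> (s / 2) powr (- \<kappa>)"
    using True assms by (intro powr_mono2') auto
  also have "\<dots> = 2 powr \<kappa> * s powr (- \<kappa>)"
    using assms by (simp add: powr_half)
  finally have "(s - r) powr (- \<beta>) * r powr (- \<kappa>) \<le> (s - r) powr (- \<beta>) * (2 powr \<kappa> * s powr (- \<kappa>))"
    by (intro mult_left_mono) auto
  then show ?thesis unfolding beta_majorant_def by (simp add: mult_ac add_increasing2)
next
  case False
  have "(s - r) powr (- \<beta>) \<le> (s / 2) powr (- \<beta>)"
    using False assms by (intro powr_mono2') auto
  also have "\<dots> = 2 powr \<beta> * s powr (- \<beta>)"
    using assms by (simp add: powr_half)
  finally have "(s - r) powr (- \<beta>) * r powr (- \<kappa>) \<le> (2 powr \<beta> * s powr (- \<beta>)) * r powr (- \<kappa>)"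
    by (intro mult_right_mono) auto
  then show ?thesis unfolding beta_majorant_def by (simp add: add_increasing)
qed

lemma beta_majorant_nonneg: "0 \<le> beta_majorant \<beta> \<kappa> s r"
  by (simp add: beta_majorant_def)

text \<open>Half of the time is spent on A, which exploits that x lies in X, the other half on
  entering Y; the exponents \<theta> - 1 and -\<xi> add up.\<close>

lemma (in interpolation_space) AT_into:
  assumes Y: "smoothing_target K sc E1 A T Y \<xi>" and \<tau>: "\<tau> > 0"
  shows "\<exists>C\<ge>0. \<forall>t x. 0 < t \<and> t \<le> \<tau> \<and> x \<in> carr X \<longrightarrow>
    nrm Y (A (T t x)) \<le> C * t powr (\<theta> - 1 - \<xi>) * nrm X x"
proof -
  interpret Y: smoothing_target K sc E1 A T Y \<xi> by (rule Y)
  obtain C1 where C1: "C1 \<ge> 0" "\<And>t x. 0 < t \<Longrightarrow> t \<le> \<tau> \<Longrightarrow> nrm Y (T t x) \<le> C1 * t powr (- \<xi>) * norm x"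
    using Y.smooth_bound[where \<tau> = \<tau>] by blast
  obtain C2 where C2: "C2 \<ge> 0" "\<forall>t x. 0 < t \<and> t \<le> \<tau> \<and> x \<in> carr X \<longrightarrow> norm (A (T t x)) \<le> C2 * t powr (\<theta> - 1) * nrm X x"
    using AT_from[OF \<tau>] by blast
  have "nrm Y (A (T t x)) \<le> (C1 * C2 * 2 powr (1 + \<xi> - \<theta>)) * t powr (\<theta> - 1 - \<xi>) * nrm X x"
    if t: "0 < t" "t \<le> \<tau>" and x: "x \<in> carr X" for t x
  proof -
    have "A (T t x) = T (t/2) (A (T (t/2) x))"
      using T_add[of "t/2" "t/2" x] T_E1(2)[OF T_smooth, of "t/2" "t/2" x] t by simp
    then have "nrm Y (A (T t x)) \<le> C1 * (t/2) powr (- \<xi>) * norm (A (T (t/2) x))"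
      using C1(2)[of "t/2" "A (T (t/2) x)"] t by simp
    also have "\<dots> \<le> C1 * (t/2) powr (- \<xi>) * (C2 * (t/2) powr (\<theta> - 1) * nrm X x)"
      using C2(2)[rule_format, of "t/2" x] t x C1(1) by (intro mult_left_mono) auto
    also have "\<dots> = C1 * C2 * ((t/2) powr (- \<xi>) * (t/2) powr (\<theta> - 1)) * nrm X x"
      by (simp add: mult_ac)
    also have "(t/2) powr (- \<xi>) * (t/2) powr (\<theta> - 1) = (t/2) powr (- (1 + \<xi> - \<theta>))"
    proof -
      have "- \<xi> + (\<theta> - 1) = - (1 + \<xi> - \<theta>)" by simp
      then show ?thesis by (simp only: powr_add[symmetric])
    qed
    also have "\<dots> = 2 powr (1 + \<xi> - \<theta>) * t powr (- (1 + \<xi> - \<theta>))"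
      using t(1) by (rule powr_half)
    finally have "nrm Y (A (T t x)) \<le> C1 * C2 * (2 powr (1 + \<xi> - \<theta>) * t powr (- (1 + \<xi> - \<theta>))) * nrm X x" .
    moreover have "- (1 + \<xi> - \<theta>) = \<theta> - 1 - \<xi>" by simp
    ultimately show ?thesis by (simp only: mult.assoc)
  qed
  then show ?thesis
    using C1(1) C2(1) by (intro exI[of _ "C1 * C2 * 2 powr (1 + \<xi> - \<theta>)"] conjI allI impI) simp_all
qed

text \<open>The orbit is integrated backwards from \<tau>: T \<tau> x - T t x is the integral of A
  (T s x), which by \<open>AT_into\<close> has Y-norm O(s^(\<theta> - 1 - \<xi>)). This links X and
  Y through the semigroup. Equal exponents would produce a logarithm and are excluded.\<close>

lemma (in interpolation_space) orbit_bound: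
  assumes Y: "smoothing_target K sc E1 A T Y \<xi>" and \<tau>: "\<tau> > 0" and x: "x \<in> carr X" and ne: "\<theta> \<noteq> \<xi>"
  shows "\<exists>C\<ge>0. \<forall>t. 0 < t \<and> t \<le> \<tau> \<longrightarrow> nrm Y (T t x) \<le> C * t powr (- max (\<xi> - \<theta>) 0)"
proof -
  interpret Y: smoothing_target K sc E1 A T Y \<xi> by (rule Y)
  define \<kappa> where "\<kappa> = max (\<xi> - \<theta>) 0"
  obtain C where C: "C \<ge> 0" "\<forall>t x. 0 < t \<and> t \<le> \<tau> \<and> x \<in> carr X \<longrightarrow> nrm Y (A (T t x)) \<le> C * t powr (\<theta> - 1 - \<xi>) * nrm X x"
    using AT_into[OF Y \<tau>] by blast
  \<comment> \<open>The first summand stems from the end point \<tau>, the second from the integral;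
    both are brought to the common factor t^(-\<kappa>).\<close>
  define B where "B = nrm Y (T \<tau> x) * \<tau> powr \<kappa> + C * nrm X x * ((1 + \<tau> powr (\<theta> - \<xi>)) / \<bar>\<theta> - \<xi>\<bar>)"
  have B: "B \<ge> 0" using C(1) by (simp add: B_def)
  have "nrm Y (T t x) \<le> B * t powr (- \<kappa>)" if t: "0 < t" "t \<le> \<tau>" for t
  proof -
    define I where "I = (\<tau> powr (\<theta> - \<xi>) - t powr (\<theta> - \<xi>)) / (\<theta> - \<xi>)"
    obtain D where D: "\<And>y. nrm Y (T (t/2) y) \<le> D * norm y" using Y.T_bounded_into[of "t/2"] t by auto
    \<comment> \<open>With T (t/2) split off, the Y-norm becomes a seminorm bounded on E_0, and the
      remaining time s - t/2 is at least t/2, so the integrand A (T (s - t/2) x) is regular in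
      E_0.\<close>
    have "nrm Y (T (t/2) (T (\<tau> - t/2) x - T (t/2) x)) \<le> C * nrm X x * I"
    proof (rule seminorm_integral_bound[where p = "\<lambda>y. nrm Y (T (t/2) y)"])
      show "nrm Y (T (t/2) (y + z)) \<le> nrm Y (T (t/2) y) + nrm Y (T (t/2) z)"
        "nrm Y (T (t/2) (c *\<^sub>R y)) = \<bar>c\<bar> * nrm Y (T (t/2) y)" for y z c
        using Y.seminorm_T[of "t/2"] t by auto
      show "nrm Y (T (t/2) y) \<le> D * norm y" for y by (rule D)
      show "((\<lambda>s. A (T (s - t/2) x)) has_integral T (\<tau> - t/2) x - T (t/2) x) {t..\<tau>}"
      proof -
        have "((\<lambda>s. A (T s x)) has_integral T (\<tau> - t/2) x - T (t/2) x) {t/2..\<tau> - t/2}"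
        proof (rule fundamental_theorem_of_calculus)
          fix s assume "s \<in> {t/2..\<tau> - t/2}"
          then show "((\<lambda>s. T s x) has_vector_derivative A (T s x)) (at s within {t/2..\<tau> - t/2})"
            using t by (intro has_vector_derivative_at_within[OF T_has_derivative]) auto
        qed (use t in auto)
        from has_integral_shift_real_ivl[OF this, of "- (t/2)"] show ?thesis by simp
      qed
      have "((\<lambda>s. C * nrm X x * s powr (\<theta> - 1 - \<xi>)) has_integral
          C * nrm X x * ((\<tau> powr (\<theta> - 1 - \<xi> + 1) - t powr (\<theta> - 1 - \<xi> + 1)) / (\<theta> - 1 - \<xi> + 1))) {t..\<tau>}"
        by (intro has_integral_mult_right has_integral_powr_Icc) (use t ne in auto)
      moreover have "\<theta> - 1 - \<xi> + 1 = \<theta> - \<xi>" by simp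
      ultimately show "((\<lambda>s. C * nrm X x * s powr (\<theta> - 1 - \<xi>)) has_integral C * nrm X x * I) {t..\<tau>}"
        by (simp only: I_def)
      fix s assume s: "s \<in> {t<..<\<tau>}"
      have "T (t/2) (A (T (s - t/2) x)) = A (T s x)"
        using T_add[of "t/2" "s - t/2" x] T_E1(2)[OF T_smooth, of "s - t/2" "t/2" x] s t by simp
      then show "nrm Y (T (t/2) (A (T (s - t/2) x))) \<le> C * nrm X x * s powr (\<theta> - 1 - \<xi>)"
        using C(2)[rule_format, of s x] s t x by (simp add: mult_ac)
    qed
    moreover have "T (t/2) (T (\<tau> - t/2) x - T (t/2) x) = T \<tau> x - T t x"
      using T_add[of "t/2" "\<tau> - t/2" x] T_add[of "t/2" "t/2" x] t by (simp add: blinfun.diff_right)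
    ultimately have diff: "nrm Y (T \<tau> x - T t x) \<le> C * nrm X x * I" by simp
    have in_Y: "T \<tau> x \<in> carr Y" "T t x \<in> carr Y" using t \<tau> by (auto intro: Y.T_in)
    have "nrm Y (T t x) \<le> nrm Y (T \<tau> x) + nrm Y (T \<tau> x - T t x)"
      using Y.nrm_triangle_diff[of "T \<tau> x" "T \<tau> x - T t x"] in_Y by auto
    also have "\<dots> \<le> nrm Y (T \<tau> x) * (\<tau> powr \<kappa> * t powr (- \<kappa>)) + C * nrm X x * (((1 + \<tau> powr (\<theta> - \<xi>)) / \<bar>\<theta> - \<xi>\<bar>) * t powr (- \<kappa>))"
    proof (rule add_mono)
      have "1 = t powr \<kappa> * t powr (- \<kappa>)" using t by (simp flip: powr_add)
      also have "\<dots> \<le> \<tau> powr \<kappa> * t powr (- \<kappa>)"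
        using t by (intro mult_right_mono powr_mono2) (auto simp: \<kappa>_def)
      finally have "1 \<le> \<tau> powr \<kappa> * t powr (- \<kappa>)" .
      then show "nrm Y (T \<tau> x) \<le> nrm Y (T \<tau> x) * (\<tau> powr \<kappa> * t powr (- \<kappa>))"
        using mult_left_mono[of 1 _ "nrm Y (T \<tau> x)"] by simp
      have "I \<le> ((1 + \<tau> powr (\<theta> - \<xi>)) / \<bar>\<theta> - \<xi>\<bar>) * t powr (- \<kappa>)"
      proof (cases "\<theta> > \<xi>")
        case True
        then have "\<kappa> = 0" by (simp add: \<kappa>_def)
        moreover have "I \<le> (1 + \<tau> powr (\<theta> - \<xi>)) / (\<theta> - \<xi>)"
          unfolding I_def using True powr_ge_zero[of t "\<theta> - \<xi>"] by (intro divide_right_mono) (linarith, simp)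
        ultimately show ?thesis using True t by simp
      next
        case False
        then have lt: "\<theta> < \<xi>" and \<kappa>: "- \<kappa> = \<theta> - \<xi>" using ne by (auto simp: \<kappa>_def)
        have "I = (t powr (\<theta> - \<xi>) - \<tau> powr (\<theta> - \<xi>)) / (\<xi> - \<theta>)"
          unfolding I_def using lt by (simp add: field_simps)
        also have "\<dots> \<le> ((1 + \<tau> powr (\<theta> - \<xi>)) * t powr (\<theta> - \<xi>)) / (\<xi> - \<theta>)"
        proof (rule divide_right_mono)
          have "0 \<le> \<tau> powr (\<theta> - \<xi>)" "0 \<le> \<tau> powr (\<theta> - \<xi>) * t powr (\<theta> - \<xi>)" by simp_all
          then show "t powr (\<theta> - \<xi>) - \<tau> powr (\<theta> - \<xi>) \<le> (1 + \<tau> powr (\<theta> - \<xi>)) * t powr (\<theta> - \<xi>)"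
            unfolding distrib_right by linarith
        qed (use lt in simp)
        finally show ?thesis using lt by (simp add: \<kappa>)
      qed
      then show "nrm Y (T \<tau> x - T t x) \<le> C * nrm X x * (((1 + \<tau> powr (\<theta> - \<xi>)) / \<bar>\<theta> - \<xi>\<bar>) * t powr (- \<kappa>))"
        using diff mult_left_mono[of I _ "C * nrm X x"] C(1) by (meson order_trans mult_nonneg_nonneg nrm_nonneg)
    qed
    also have "\<dots> = B * t powr (- \<kappa>)" by (simp add: B_def distrib_right mult.assoc)
    finally show ?thesis .
  qed
  then show ?thesis using B unfolding \<kappa>_def by blast
qed

section \<open>Continuity of convolutions and the delayed equation\<close>

context analytic_generator
begin

text \<open>The variable t occurs as upper limit and in the kernel. The first dependence is
  Lipschitz because k is bounded; for the second the interval is held fixed and the integral depends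
  continuously on a parameter.\<close>

lemma convolution_continuous:
  assumes k: "continuous_on {0..b} k"
  shows "continuous_on {0..b} (\<lambda>t. integral {0..t} (\<lambda>s. T (t - s) (k s)))"
  unfolding continuous_on_def
proof
  fix t assume t: "t \<in> {0..b}"
  have kt: "continuous_on {0..t} k" using k by (rule continuous_on_subset) (use t in auto)
  obtain M where M: "M \<ge> 1" "\<And>t x. t \<le> b \<Longrightarrow> norm (T t x) \<le> M * norm x" using T_bound by blast
  have "bounded (k ` {0..b})"
    by (intro compact_imp_bounded compact_continuous_image k) simp
  then obtain B where "\<forall>s\<in>{0..b}. norm (k s) \<le> B" by (auto simp: bounded_iff)
  then have B: "\<And>s. s \<in> {0..b} \<Longrightarrow> norm (k s) \<le> B" by blast
  have B0: "B \<ge> 0" using B[of t] t norm_ge_zero[of "k t"] by linarith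
  define z where "z t = integral {0..t} (\<lambda>s. T (t - s) (k s))" for t
  have int: "(\<lambda>s. T (t' - s) (k s)) integrable_on {c..d}" if "0 \<le> c" "d \<le> b" for t' c d
  proof (rule integrable_continuous_interval)
    have "continuous_on {c..d} k" using k by (rule continuous_on_subset) (use that in auto)
    then show "continuous_on {c..d} (\<lambda>s. T (t' - s) (k s))" by (intro continuous_intros)
  qed
  have part: "norm (integral {0..d} (\<lambda>s. T (t' - s) (k s)) - integral {0..c} (\<lambda>s. T (t' - s) (k s))) \<le> M * B * (d - c)"
    if "0 \<le> c" "c \<le> d" "d \<le> b" "t' \<le> b" for c d t'
  proof -
    have "integral {0..d} (\<lambda>s. T (t' - s) (k s)) - integral {0..c} (\<lambda>s. T (t' - s) (k s)) = integral {c..d} (\<lambda>s. T (t' - s) (k s))"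
      using Henstock_Kurzweil_Integration.integral_combine[of 0 c d, OF _ _ int[of 0 d]] that by (simp add: algebra_simps)
    moreover have "norm (integral {c..d} (\<lambda>s. T (t' - s) (k s))) \<le> M * B * (d - c)"
    proof (rule integral_bound)
      have "continuous_on {c..d} k" using k by (rule continuous_on_subset) (use that in auto)
      then show "continuous_on {c..d} (\<lambda>s. T (t' - s) (k s))" by (intro continuous_intros)
      fix s assume s: "s \<in> {c..d}"
      have "norm (T (t' - s) (k s)) \<le> M * norm (k s)" using M(2) s that by simp
      also have "\<dots> \<le> M * B" using B[of s] s that M(1) by (intro mult_left_mono) auto
      finally show "norm (T (t' - s) (k s)) \<le> M * B" .
    qed (use that in auto)
    ultimately show ?thesis by simp
  qed
  have "continuous_on {0..b} (\<lambda>t'. integral (cbox 0 t) (\<lambda>s. T (t' - s) (k s)))"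
  proof (rule integral_continuous_on_param)
    have "continuous_on ({0..b} \<times> cbox 0 t) (\<lambda>p. T (fst p - snd p) (k (snd p)))"
      by (intro continuous_intros continuous_on_compose2[OF kt]) auto
    then show "continuous_on ({0..b} \<times> cbox 0 t) (\<lambda>(t', s). T (t' - s) (k s))"
      by (simp add: case_prod_beta)
  qed
  then have 1: "((\<lambda>t'. integral {0..t} (\<lambda>s. T (t' - s) (k s))) \<longlongrightarrow> z t) (at t within {0..b})"
    using t unfolding continuous_on_def z_def by simp
  have 2: "((\<lambda>t'. z t' - integral {0..t} (\<lambda>s. T (t' - s) (k s))) \<longlongrightarrow> 0) (at t within {0..b})"
  proof (rule Lim_null_comparison)
    have "((\<lambda>t'. M * B * \<bar>t' - t\<bar>) \<longlongrightarrow> M * B * \<bar>t - t\<bar>) (at t within {0..b})"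
      by (intro tendsto_intros)
    then show "((\<lambda>t'. M * B * \<bar>t' - t\<bar>) \<longlongrightarrow> 0) (at t within {0..b})" by simp
    have "norm (z t' - integral {0..t} (\<lambda>s. T (t' - s) (k s))) \<le> M * B * \<bar>t' - t\<bar>" if "t' \<in> {0..b}" for t'
      using part[of t t' t'] part[of t' t t'] t that by (cases "t \<le> t'") (auto simp: z_def norm_minus_commute)
    then show "\<forall>\<^sub>F t' in at t within {0..b}. norm (z t' - integral {0..t} (\<lambda>s. T (t' - s) (k s))) \<le> M * B * \<bar>t' - t\<bar>"
      by (auto simp: eventually_at_filter)
  qed
  show "((\<lambda>t. integral {0..t} (\<lambda>s. T (t - s) (k s))) \<longlongrightarrow> integral {0..t} (\<lambda>s. T (t - s) (k s))) (at t within {0..b})"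
    using tendsto_add[OF 2 1] by (simp add: z_def)
qed

text \<open>Because of the delay, the Picard iterates are stationary on \<open>[0, nh]\<close> after \<open>n\<close> steps.\<close>

lemma delayed_solution:
  assumes G: "\<And>b v. continuous_on {0..b} v \<Longrightarrow> continuous_on {0..b} (\<lambda>s. G s (v s))" and h: "h > 0"
  shows "\<exists>u. (\<forall>b. continuous_on {0..b} u) \<and>
    (\<forall>t\<ge>0. u t = T t x + integral {0..t} (\<lambda>s. T (t - s) (G s (u (max (s - h) 0)))))"
proof -
  define \<Psi> where "\<Psi> v t = T t x + integral {0..t} (\<lambda>s. T (t - s) (G s (v (max (s - h) 0))))" for v :: "real \<Rightarrow> 'e" and t
  define w where "w n = (\<Psi> ^^ n) (\<lambda>_. x)" for n
  have w_Suc: "w (Suc n) = \<Psi> (w n)" for n by (simp add: w_def)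
  have w_cont: "continuous_on {0..b} (w n)" for n b
  proof (induction n)
    case (Suc n)
    have "continuous_on {0..b} (\<lambda>s. w n (max (s - h) 0))"
      by (rule continuous_on_compose2[OF Suc]) (use h in \<open>auto intro!: continuous_intros\<close>)
    from convolution_continuous[OF G[OF this]] show ?case
      unfolding w_Suc \<Psi>_def by (intro continuous_intros)
  qed (simp add: w_def)
  \<comment> \<open>Evaluating \<open>\<Psi> v\<close> at t involves v only up to time t - h, or at
    0. This gain of h per iteration drives the induction below.\<close>
  have \<Psi>_cong: "\<Psi> v t = \<Psi> v' t" if "\<And>s. s \<in> {0..max (t - h) 0} \<Longrightarrow> v s = v' s" for v v' t
  proof -
    have "integral {0..t} (\<lambda>s. T (t - s) (G s (v (max (s - h) 0)))) = integral {0..t} (\<lambda>s. T (t - s) (G s (v' (max (s - h) 0))))"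
      by (rule integral_cong) (use that in auto)
    then show ?thesis by (simp add: \<Psi>_def)
  qed
  have w0: "w n 0 = x" for n by (cases n) (auto simp: w_def \<Psi>_def)
  have stable: "w (Suc n) t = w n t" if "t \<in> {0..real n * h}" for n t
    using that
  proof (induction n arbitrary: t)
    case 0
    then show ?case using w0[of "Suc 0"] w0[of 0] by simp
  next
    case (Suc n)
    have "\<Psi> (w (Suc n)) t = \<Psi> (w n) t"
    proof (rule \<Psi>_cong)
      fix s assume "s \<in> {0..max (t - h) 0}"
      then have "s \<in> {0..real n * h}" using Suc.prems h by (auto simp: algebra_simps max_def split: if_splits)
      then show "w (Suc n) s = w n s" by (rule Suc.IH)
    qed
    then show ?case by (simp add: w_Suc)
  qed
  have stable': "w m t = w n t" if "t \<in> {0..real n * h}" "n \<le> m" for m n t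
    using that(2)
  proof (induction m rule: dec_induct)
    case (step m)
    have "real n * h \<le> real m * h" using step h by (intro mult_right_mono) auto
    then show ?case using stable[of t m] step that(1) by auto
  qed simp
  \<comment> \<open>\<open>N t\<close> is an iterate that is already stationary at t; the solution
    reads off this iterate at each time.\<close>
  define N where "N t = nat \<lceil>t / h\<rceil>" for t
  have N: "t \<le> real (N t) * h" if "t \<ge> 0" for t
  proof -
    have "t / h \<le> real (N t)" unfolding N_def by linarith
    then show ?thesis using h by (simp add: field_simps)
  qed
  define u where "u t = w (N t) t" for t
  have u_w: "u t = w n t" if "t \<in> {0..real n * h}" for t n
    using stable'[of t n "N t"] stable'[of t "N t" n] N[of t] that unfolding u_def
    by (cases "n \<le> N t") auto
  have "continuous_on {0..b} u" for b
  proof -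
    have "continuous_on {0..b} (w (N (max b 0)))" by (rule w_cont)
    then show ?thesis
      by (rule continuous_on_eq) (use N[of "max b 0"] in \<open>auto intro!: u_w[symmetric]\<close>)
  qed
  moreover have "u t = \<Psi> u t" if t: "t \<ge> 0" for t
  proof -
    have "u t = w (Suc (N t)) t" using N[OF t] h t by (intro u_w) (auto simp: algebra_simps)
    also have "\<dots> = \<Psi> (w (N t)) t" by (simp add: w_Suc)
    also have "\<dots> = \<Psi> u t"
      by (rule \<Psi>_cong) (use N[OF t] h t in \<open>auto intro!: u_w[symmetric] simp: max_def split: if_splits\<close>)
    finally show ?thesis .
  qed
  ultimately show ?thesis unfolding \<Psi>_def by blast
qed

end

section \<open>Compactness of approximate solutions\<close>

lemma mult_div_cancel: "b \<noteq> 0 \<Longrightarrow> b * (a / b / c) = a / c" for a b c :: real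
  by simp

text \<open>A finite net of the approximating compact set is a net of the range as well. It fits
  sequences that are images under a compact operator up to a uniformly small error.\<close>

lemma compact_closure_approx:
  fixes x :: "nat \<Rightarrow> 'a::banach"
  assumes approx: "\<And>e. e > 0 \<Longrightarrow> \<exists>C. compact C \<and> (\<forall>n. \<exists>y\<in>C. dist (x n) y < e)"
  shows "compact (closure (range x))"
  unfolding compact_eq_totally_bounded
proof (intro conjI allI impI)
  show "complete (closure (range x))" by (simp add: complete_eq_closed)
  fix e :: real assume e: "e > 0"
  obtain C where C: "compact C" "\<forall>n. \<exists>y\<in>C. dist (x n) y < e / 4"
    using approx[of "e / 4"] e by auto
  have "e / 4 > 0" using e by simp
  then obtain k where k: "finite k" "C \<subseteq> (\<Union>z\<in>k. ball z (e / 4))"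
    using C(1) unfolding compact_eq_totally_bounded by meson
  have "range x \<subseteq> (\<Union>z\<in>k. cball z (e / 2))"
  proof
    fix a assume "a \<in> range x"
    then obtain n where a: "a = x n" by blast
    obtain y where y: "y \<in> C" "dist (x n) y < e / 4" using C(2) by blast
    obtain z where z: "z \<in> k" "dist z y < e / 4" using k(2) y(1) by auto
    have "dist z (x n) \<le> e / 2"
      using dist_triangle[of z "x n" y] y z by (simp add: dist_commute)
    then show "a \<in> (\<Union>z\<in>k. cball z (e / 2))" using z a by auto
  qed
  then have "closure (range x) \<subseteq> (\<Union>z\<in>k. cball z (e / 2))"
    using k(1) by (intro closure_minimal closed_UN) auto
  also have "\<dots> \<subseteq> (\<Union>z\<in>k. ball z e)" using e by force
  finally show "\<exists>k. finite k \<and> closure (range x) \<subseteq> (\<Union>z\<in>k. ball z e)" using k(1) by blast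
qed

lemma compact_closure_subsequence:
  fixes x :: "nat \<Rightarrow> 'a::metric_space"
  assumes "compact (closure (range x))"
  shows "\<exists>r. strict_mono r \<and> convergent (\<lambda>n. x (r n))"
proof -
  have "seq_compact (closure (range x))" using assms by (simp add: compact_imp_seq_compact)
  moreover have "\<forall>n. x n \<in> closure (range x)" using closure_subset[of "range x"] by blast
  ultimately obtain l r where "strict_mono r" "(x \<circ> r) \<longlonglongrightarrow> l"
    unfolding seq_compact_def by meson
  then show ?thesis by (auto simp: convergent_def o_def)
qed

lemma diagonal_convergent:
  fixes x :: "nat \<Rightarrow> nat \<Rightarrow> 'a::metric_space"
  assumes comp: "\<And>i. compact (closure (range (x i)))"
  shows "\<exists>r. strict_mono r \<and> (\<forall>i. convergent (\<lambda>n. x i (r n)))"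
proof -
  interpret subseqs "\<lambda>i s. convergent (\<lambda>n. x i (s n))"
  proof
    fix i and s :: "nat \<Rightarrow> nat" assume "strict_mono s"
    have "closure (range (\<lambda>n. x i (s n))) \<subseteq> closure (range (x i))"
      by (intro closure_mono) auto
    then have "compact (closure (range (\<lambda>n. x i (s n))))"
      using compact_Int_closed[OF comp[of i] closed_closure[of "range (\<lambda>n. x i (s n))"]] by (simp add: inf.absorb2)
    from compact_closure_subsequence[OF this]
    show "\<exists>r'. strict_mono r' \<and> convergent (\<lambda>n. x i ((s \<circ> r') n))" by simp
  qed
  have "convergent (\<lambda>n. x i (diagseq n))" for i
  proof -
    have "convergent (\<lambda>n. x i ((diagseq \<circ> (+) (Suc i)) n))"
    proof (rule diagseq_holds)
      fix r s :: "nat \<Rightarrow> nat" and n assume "strict_mono r" "convergent (\<lambda>k. x n (s k))"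
      then show "convergent (\<lambda>k. x n ((s \<circ> r) k))"
        using convergent_subseq_convergent[of "\<lambda>k. x n (s k)" r] by (simp add: o_def)
    qed
    then have "convergent (\<lambda>n. x i (diagseq (n + Suc i)))" by (simp add: o_def add.commute)
    then show ?thesis using convergent_ignore_initial_segment[of "\<lambda>n. x i (diagseq n)" "Suc i"] by simp
  qed
  then show ?thesis using subseq_diagseq by blast
qed

text \<open>T \<delta> is bounded from E_0 into X, so the approximants T \<delta> (y n) are Cauchy
  in X whenever y converges in E_0. The sequence x is uniformly close to them, hence Cauchy in X,
  and the embedding identifies its limit.\<close>

lemma (in smoothing_target) converges_in:
  assumes x: "\<And>n. x n \<in> carr X" and lim: "x \<longlonglongrightarrow> l"
    and approx: "\<And>e. e > 0 \<Longrightarrow> \<exists>\<delta>>0. \<exists>y. convergent y \<and> (\<forall>n. nrm X (x n - T \<delta> (y n)) \<le> e)"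
  shows "l \<in> carr X" "(\<lambda>n. nrm X (x n - l)) \<longlonglongrightarrow> 0"
proof -
  have "\<exists>l\<in>carr X. (\<lambda>n. nrm X (x n - l)) \<longlonglongrightarrow> 0"
  proof (rule complete[OF x])
    fix e :: real assume e: "e > 0"
    then obtain \<delta> y where \<delta>: "\<delta> > 0" "convergent y" "\<And>n. nrm X (x n - T \<delta> (y n)) \<le> e / 4"
      using approx[of "e / 4"] by auto
    obtain C where C: "C \<ge> 0" "\<And>x. nrm X (T \<delta> x) \<le> C * norm x" using T_bounded_into[OF \<delta>(1)] by auto
    have "e / (2 * (C + 1)) > 0" using e C(1) by simp
    then obtain N where N: "\<And>m n. m \<ge> N \<Longrightarrow> n \<ge> N \<Longrightarrow> norm (y m - y n) < e / (2 * (C + 1))"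
      using convergent_Cauchy[OF \<delta>(2)] unfolding Cauchy_def dist_norm by meson
    have "nrm X (x m - x n) < e" if "m \<ge> N" "n \<ge> N" for m n
    proof -
      have in_X: "x m - T \<delta> (y m) \<in> carr X" "x n - T \<delta> (y n) \<in> carr X" "T \<delta> (y m - y n) \<in> carr X"
        using x T_in[OF \<delta>(1)] by blast+
      have eq: "x m - x n = (x m - T \<delta> (y m)) + T \<delta> (y m - y n) - (x n - T \<delta> (y n))"
        by (simp add: blinfun.diff_right)
      have "nrm X (x m - x n) \<le> nrm X (x m - T \<delta> (y m)) + nrm X (T \<delta> (y m - y n)) + nrm X (x n - T \<delta> (y n))"
        using nrm_triangle_diff[OF carr_add[OF in_X(1,3)] in_X(2)] nrm_triangle[OF in_X(1,3)]
          arg_cong[OF eq, of "nrm X"] by linarith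
      moreover have "nrm X (T \<delta> (y m - y n)) < e / 2"
      proof -
        have "nrm X (T \<delta> (y m - y n)) \<le> (C + 1) * norm (y m - y n)"
          using C(2)[of "y m - y n"] norm_ge_zero[of "y m - y n"] unfolding distrib_right by linarith
        also have "\<dots> < (C + 1) * (e / (2 * (C + 1)))"
          using N[OF that] C(1) by (intro mult_strict_left_mono) auto
        also have "\<dots> = e / 2" using C(1) by (simp add: field_simps)
        finally show ?thesis .
      qed
      ultimately show ?thesis using \<delta>(3)[of m] \<delta>(3)[of n] by linarith
    qed
    then show "\<exists>N. \<forall>m\<ge>N. \<forall>n\<ge>N. nrm X (x m - x n) < e" by blast
  qed
  then obtain l' where l': "l' \<in> carr X" "(\<lambda>n. nrm X (x n - l')) \<longlonglongrightarrow> 0" by blast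
  have "x \<longlonglongrightarrow> l'" using x l' by (intro embed_tendsto) auto
  then have "l' = l" using lim LIMSEQ_unique by blast
  then show "l \<in> carr X" "(\<lambda>n. nrm X (x n - l)) \<longlonglongrightarrow> 0" using l' by auto
qed

text \<open>The forcings are abstract continuous functions with a common weighted bound, so the
  compactness argument is separated from the nonlinearity. The weight s^(-\<kappa>) allows for the
  singularity of the approximate solutions at time 0.\<close>

locale mild_family = analytic_generator K sc E1 A T
  for K :: "complex set" and sc :: "complex \<Rightarrow> 'e::banach \<Rightarrow> 'e"
    and E1 :: "'e nspace" and A :: "'e \<Rightarrow> 'e" and T :: "real \<Rightarrow> 'e \<Rightarrow>\<^sub>L 'e" +
  fixes u g :: "nat \<Rightarrow> real \<Rightarrow> 'e" and x0 :: 'e and \<kappa> :: real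
  assumes g_cont: "\<And>n b. continuous_on {0..b} (g n)"
    and u_eq: "\<And>n t. 0 \<le> t \<Longrightarrow> u n t = T t x0 + integral {0..t} (\<lambda>s. T (t - s) (g n s))"
    and \<kappa>: "0 \<le> \<kappa>" "\<kappa> < 1"
    and g_bound: "\<And>\<tau>. \<tau> > 0 \<Longrightarrow> \<exists>L\<ge>0. \<forall>n s. 0 < s \<and> s \<le> \<tau> \<longrightarrow> norm (g n s) \<le> L * s powr (- \<kappa>)"
begin

lemma g_cont': "0 \<le> a \<Longrightarrow> continuous_on {a..b} (g n)"
  by (rule continuous_on_subset[OF g_cont[of b n]]) auto

lemma u_mild:
  assumes "0 \<le> q" "q \<le> t"
  shows "u n t - T (t - q) (u n q) = integral {q..t} (\<lambda>s. T (t - s) (g n s))"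
proof -
  interpret W: smoothing_target K sc E1 A T whole_space 0
    using interpolation_space_whole by (simp add: interpolation_space_def)
  have "T (t - q) (u n q) = T t x0 + integral {0..q} (\<lambda>s. T (t - s) (g n s))"
    using u_eq[OF assms(1)] W.convolution_split[OF g_cont, of q t] T_add[of "t - q" q x0] assms
    by (simp add: blinfun.add_right)
  moreover have "integral {0..q} (\<lambda>s. T (t - s) (g n s)) + integral {q..t} (\<lambda>s. T (t - s) (g n s)) = integral {0..t} (\<lambda>s. T (t - s) (g n s))"
    using assms by (intro Henstock_Kurzweil_Integration.integral_combine integrable_continuous_interval continuous_intros g_cont)
  ultimately show ?thesis using u_eq[of t n] assms by (simp add: algebra_simps)
qed

text \<open>From time 0 on, both ends of the integrand are singular, whence the Beta type majorant.
  If 1 - \<theta> - \<kappa> is positive, the bound shows that u n - T t x0 tends to 0 in Y as t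
  tends to 0, uniformly in n.\<close>

lemma remainder_bound_0:
  assumes Y: "smoothing_target K sc E1 A T Y \<theta>" and \<theta>: "\<theta> < 1" and \<tau>: "\<tau> > 0"
  shows "\<exists>C\<ge>0. \<forall>n t. 0 < t \<and> t \<le> \<tau> \<longrightarrow> u n t - T t x0 \<in> carr Y \<and> nrm Y (u n t - T t x0) \<le> C * t powr (1 - \<theta> - \<kappa>)"
proof -
  interpret Y: smoothing_target K sc E1 A T Y \<theta> by (rule Y)
  obtain L where L: "L \<ge> 0" "\<forall>n s. 0 < s \<and> s \<le> \<tau> \<longrightarrow> norm (g n s) \<le> L * s powr (- \<kappa>)" using g_bound[OF \<tau>] by blast
  obtain C where C: "C \<ge> 0" "\<And>t x. 0 < t \<Longrightarrow> t \<le> \<tau> \<Longrightarrow> nrm Y (T t x) \<le> C * t powr (- \<theta>) * norm x"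
    using Y.smooth_bound[where \<tau> = \<tau>] by blast
  define B where "B = C * L * beta_const \<theta> \<kappa>"
  have "u n t - T t x0 \<in> carr Y \<and> nrm Y (u n t - T t x0) \<le> B * t powr (1 - \<theta> - \<kappa>)" if t: "0 < t" "t \<le> \<tau>" for n t
  proof -
    have "integral {0..t} (\<lambda>s. T (t - s) (g n s)) \<in> carr Y \<and>
        nrm Y (integral {0..t} (\<lambda>s. T (t - s) (g n s))) \<le> C * L * (beta_const \<theta> \<kappa> * t powr (1 - \<theta> - \<kappa>))"
    proof (rule Y.convolution_in[OF g_cont])
      show "((\<lambda>s. C * L * beta_majorant \<theta> \<kappa> t s) has_integral C * L * (beta_const \<theta> \<kappa> * t powr (1 - \<theta> - \<kappa>))) {0..t}"
        by (intro has_integral_mult_right beta_majorant_has_integral \<theta> \<kappa> t)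
      fix s assume s: "s \<in> {0<..<t}"
      have "nrm Y (T (t - s) (g n s)) \<le> C * (t - s) powr (- \<theta>) * norm (g n s)"
        using C(2)[of "t - s" "g n s"] s t by simp
      also have "\<dots> \<le> C * (t - s) powr (- \<theta>) * (L * s powr (- \<kappa>))"
        using L(2) s t C(1) by (intro mult_left_mono) auto
      also have "\<dots> = C * L * ((t - s) powr (- \<theta>) * s powr (- \<kappa>))" by (simp add: mult_ac)
      also have "\<dots> \<le> C * L * beta_majorant \<theta> \<kappa> t s"
        using beta_majorant_ge[OF Y.\<theta>_nonneg \<kappa>(1), of s t] s C(1) L(1) by (intro mult_left_mono) auto
      finally show "nrm Y (T (t - s) (g n s)) \<le> C * L * beta_majorant \<theta> \<kappa> t s" .
    qed (use t in simp)
    then show ?thesis using u_eq[of t n] t by (simp add: B_def mult.assoc)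
  qed
  moreover have "B \<ge> 0" using C(1) L(1) beta_const_nonneg[OF \<theta> \<kappa>(2)] by (simp add: B_def)
  ultimately show ?thesis by (intro exI[of _ B]) simp
qed

text \<open>Away from 0 the weight is at most a^(-\<kappa>) and only the kernel is singular. Being
  uniform in n, the estimate replaces equicontinuity: u n t is close to T (t - q) (u n q) for q
  close to t.\<close>

lemma remainder_bound:
  assumes Y: "smoothing_target K sc E1 A T Y \<theta>" and \<theta>: "\<theta> < 1" and a: "0 < a" "a < \<tau>"
  shows "\<exists>C\<ge>0. \<forall>n q t. a \<le> q \<and> q < t \<and> t \<le> \<tau> \<longrightarrow>
    u n t - T (t - q) (u n q) \<in> carr Y \<and> nrm Y (u n t - T (t - q) (u n q)) \<le> C * (t - q) powr (1 - \<theta>)"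
proof -
  interpret Y: smoothing_target K sc E1 A T Y \<theta> by (rule Y)
  have \<tau>: "\<tau> > 0" using a by simp
  obtain L where L: "L \<ge> 0" "\<forall>n s. 0 < s \<and> s \<le> \<tau> \<longrightarrow> norm (g n s) \<le> L * s powr (- \<kappa>)" using g_bound[OF \<tau>] by blast
  obtain C where C: "C \<ge> 0" "\<And>t x. 0 < t \<Longrightarrow> t \<le> \<tau> \<Longrightarrow> nrm Y (T t x) \<le> C * t powr (- \<theta>) * norm x"
    using Y.smooth_bound[where \<tau> = \<tau>] by blast
  define B where "B = C * L * a powr (- \<kappa>)"
  have B: "B \<ge> 0" using C(1) L(1) by (simp add: B_def)
  have "u n t - T (t - q) (u n q) \<in> carr Y \<and> nrm Y (u n t - T (t - q) (u n q)) \<le> B * ((t - q) powr (1 - \<theta>) / (1 - \<theta>))"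
    if t: "a \<le> q" "q < t" "t \<le> \<tau>" for n q t
  proof -
    have q: "0 \<le> q" "q \<le> t" using t a by auto
    show ?thesis unfolding u_mild[OF q]
    proof (rule Y.convolution_in[OF g_cont'[OF q(1)] q(2)])
      show "((\<lambda>s. B * (t - s) powr (- \<theta>)) has_integral B * ((t - q) powr (1 - \<theta>) / (1 - \<theta>))) {q..t}"
        by (intro has_integral_mult_right has_integral_powr_reflected \<theta> q)
      fix s assume s: "s \<in> {q<..<t}"
      have "norm (g n s) \<le> L * a powr (- \<kappa>)"
      proof -
        have "norm (g n s) \<le> L * s powr (- \<kappa>)" using L(2) s t a by auto
        also have "\<dots> \<le> L * a powr (- \<kappa>)"
          using s t a L(1) \<kappa>(1) by (intro mult_left_mono powr_mono2') auto
        finally show ?thesis .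
      qed
      then have "C * (t - s) powr (- \<theta>) * norm (g n s) \<le> C * (t - s) powr (- \<theta>) * (L * a powr (- \<kappa>))"
        using C(1) by (intro mult_left_mono) auto
      moreover have "nrm Y (T (t - s) (g n s)) \<le> C * (t - s) powr (- \<theta>) * norm (g n s)"
        using C(2)[of "t - s" "g n s"] s t q by simp
      ultimately show "nrm Y (T (t - s) (g n s)) \<le> B * (t - s) powr (- \<theta>)"
        by (simp add: B_def mult_ac)
    qed
  qed
  then show ?thesis using B \<theta> by (intro exI[of _ "B / (1 - \<theta>)"]) simp
qed

lemma whole_target: "smoothing_target K sc E1 A T whole_space 0"
  using interpolation_space_whole by (simp add: interpolation_space_def)

lemma u_bounded: "\<exists>M\<ge>0. \<forall>n t. 0 < t \<and> t \<le> \<tau> \<longrightarrow> norm (u n t) \<le> M"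
proof (cases "\<tau> > 0")
  case True
  obtain C where C: "C \<ge> 0" "\<forall>n t. 0 < t \<and> t \<le> \<tau> \<longrightarrow> norm (u n t - T t x0) \<le> C * t powr (1 - \<kappa>)"
    using remainder_bound_0[OF whole_target _ True] by auto
  obtain M where M: "M \<ge> 1" "\<And>t x. t \<le> \<tau> \<Longrightarrow> norm (T t x) \<le> M * norm x" using T_bound by blast
  have "norm (u n t) \<le> M * norm x0 + C * \<tau> powr (1 - \<kappa>)" if t: "0 < t" "t \<le> \<tau>" for n t
  proof -
    have "norm (u n t - T t x0) \<le> C * t powr (1 - \<kappa>)" using C(2) t by blast
    also have "\<dots> \<le> C * \<tau> powr (1 - \<kappa>)" using C(1) t \<kappa> by (intro mult_left_mono powr_mono2) auto
    finally show ?thesis using M(2)[OF t(2), of x0] norm_triangle_ineq[of "u n t - T t x0" "T t x0"] by simp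
  qed
  moreover have "0 \<le> M * norm x0 + C * \<tau> powr (1 - \<kappa>)" using M(1) C(1) by simp
  ultimately show ?thesis by blast
qed (auto intro: exI[of _ 0])

text \<open>T \<epsilon> is bounded into E_1, so the image of a ball lies in a multiple of the unit
  ball of E_1, which is relatively compact in E_0.\<close>

lemma T_image_compact:
  assumes "\<epsilon> > 0"
  shows "\<exists>C. compact C \<and> (\<forall>x. norm x \<le> M \<longrightarrow> T \<epsilon> x \<in> C)"
proof -
  interpret E: smoothing_target K sc E1 A T E1 1 by (rule smoothing_target_E1)
  obtain B where B: "B \<ge> 0" "\<And>x. nrm E1 (T \<epsilon> x) \<le> B * norm x" using E.T_bounded_into[OF assms] by auto
  define \<rho> where "\<rho> = B * \<bar>M\<bar> + 1"
  have \<rho>: "\<rho> > 0" using B(1) by (simp add: \<rho>_def add_nonneg_pos)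
  have "compact (closure (nball E1 1))"
    using E1_compact by (simp add: compactly_embedded_def compactin_euclidean_iff)
  then have "compact ((\<lambda>y. \<rho> *\<^sub>R y) ` closure (nball E1 1))" by (rule compact_scaling)
  moreover have "T \<epsilon> x \<in> (\<lambda>y. \<rho> *\<^sub>R y) ` closure (nball E1 1)" if "norm x \<le> M" for x
  proof
    show "T \<epsilon> x = \<rho> *\<^sub>R ((1 / \<rho>) *\<^sub>R T \<epsilon> x)" using \<rho> by simp
    have "B * norm x \<le> B * \<bar>M\<bar>" using that B(1) by (intro mult_left_mono) auto
    then have "nrm E1 (T \<epsilon> x) \<le> \<rho>" using B(2)[of x] by (simp add: \<rho>_def)
    then have "(1 / \<rho>) * nrm E1 (T \<epsilon> x) \<le> (1 / \<rho>) * \<rho>" using \<rho> by (intro mult_left_mono) auto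
    then have "nrm E1 ((1 / \<rho>) *\<^sub>R T \<epsilon> x) \<le> 1"
      using E1.nrm_scale[OF T_smooth[OF assms], of "1 / \<rho>" x] \<rho> by simp
    then have "(1 / \<rho>) *\<^sub>R T \<epsilon> x \<in> nball E1 1"
      using T_smooth[OF assms] by (auto simp: nball_def)
    then show "(1 / \<rho>) *\<^sub>R T \<epsilon> x \<in> closure (nball E1 1)" using closure_subset by blast
  qed
  ultimately show ?thesis by blast
qed

text \<open>The values u n (t - \<epsilon>) are bounded, so their images under T \<epsilon> lie in a
  compact set, and they differ from u n t by at most C\<epsilon>, uniformly in n.\<close>

lemma u_compact:
  assumes t: "t > 0"
  shows "compact (closure (range (\<lambda>n. u n t)))"
proof (rule compact_closure_approx)
  fix e :: real assume e: "e > 0"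
  have at: "0 < t/2" "t/2 < t" using t by auto
  obtain C where C: "C \<ge> 0" "\<And>n q s. t/2 \<le> q \<Longrightarrow> q < s \<Longrightarrow> s \<le> t \<Longrightarrow> norm (u n s - T (s - q) (u n q)) \<le> C * (s - q) powr (1 - 0)"
    using remainder_bound[OF whole_target _ at] by auto
  obtain M where M: "M \<ge> 0" "\<forall>n s. 0 < s \<and> s \<le> t \<longrightarrow> norm (u n s) \<le> M" using u_bounded by blast
  define \<epsilon> where "\<epsilon> = min (t/2) (e / (C + 1) / 2)"
  have "\<epsilon> > 0" using t e C(1) by (simp add: \<epsilon>_def)
    moreover have "\<epsilon> \<le> t/2" "\<epsilon> \<le> e / (C + 1) / 2"
      by (simp_all only: \<epsilon>_def min.cobounded1 min.cobounded2)
    ultimately have \<epsilon>: "\<epsilon> > 0" "\<epsilon> \<le> t/2" "\<epsilon> \<le> e / (C + 1) / 2" .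
  obtain D where D: "compact D" "\<And>x. norm x \<le> M \<Longrightarrow> T \<epsilon> x \<in> D" using T_image_compact[OF \<epsilon>(1)] by blast
  have "dist (u n t) (T \<epsilon> (u n (t - \<epsilon>))) < e" for n
  proof -
    have "norm (u n t - T \<epsilon> (u n (t - \<epsilon>))) \<le> C * \<epsilon>"
      using C(2)[of "t - \<epsilon>" t n] \<epsilon> by simp
    also have "\<dots> \<le> (C + 1) * \<epsilon>" using \<epsilon> by (simp add: distrib_right)
    also have "\<dots> \<le> (C + 1) * (e / (C + 1) / 2)" using C(1) by (intro mult_left_mono \<epsilon>(3)) simp
    also have "\<dots> = e / 2" using C(1) by (intro mult_div_cancel) simp
    finally show ?thesis using e by (simp add: dist_norm)
  qed
  moreover have "T \<epsilon> (u n (t - \<epsilon>)) \<in> D" for n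
    using \<epsilon> t M(2) by (intro D(2)) auto
  ultimately show "\<exists>C. compact C \<and> (\<forall>n. \<exists>y\<in>C. dist (u n t) y < e)"
    using D(1) by blast
qed

text \<open>A diagonal sequence converges at the positive rationals. For other t > 0 a rational q
  slightly below t is used: T (t - q) (u n q) converges along the subsequence and is uniformly close
  to u n t. At 0 all members agree.\<close>

lemma subsequence_limit: "\<exists>r v. strict_mono r \<and> v 0 = x0 \<and> (\<forall>t\<ge>0. (\<lambda>n. u (r n) t) \<longlonglongrightarrow> v t)"
proof -
  define Q :: "real set" where "Q = \<rat> \<inter> {0<..}"
  have "1 \<in> Q" by (simp add: Q_def)
  then have Q: "countable Q" "Q \<noteq> {}" using countable_rat by (auto simp: Q_def)
  have rQ: "range (from_nat_into Q) = Q" using Q by (intro range_from_nat_into)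
  then have "from_nat_into Q i > 0" for i unfolding Q_def by (metis IntD2 greaterThan_iff rangeI)
  then have "compact (closure (range (\<lambda>n. u n (from_nat_into Q i))))" for i by (rule u_compact)
  then obtain r where r: "strict_mono r" "\<And>i. convergent (\<lambda>n. u (r n) (from_nat_into Q i))"
    using diagonal_convergent[of "\<lambda>i n. u n (from_nat_into Q i)"] by blast
  have convQ: "convergent (\<lambda>n. u (r n) q)" if "q \<in> Q" for q
    using r(2) that rQ by (metis imageE)
  have conv: "convergent (\<lambda>n. u (r n) t)" if t: "t > 0" for t
  proof -
    have at: "0 < t/2" "t/2 < t" using t by auto
    obtain C where C: "C \<ge> 0" "\<And>n q s. t/2 \<le> q \<Longrightarrow> q < s \<Longrightarrow> s \<le> t \<Longrightarrow> norm (u n s - T (s - q) (u n q)) \<le> C * (s - q) powr (1 - 0)"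
      using remainder_bound[OF whole_target _ at] by auto
    obtain M where M: "M \<ge> 1" "\<And>s x. s \<le> t \<Longrightarrow> norm (T s x) \<le> M * norm x" using T_bound by blast
    have "Cauchy (\<lambda>n. u (r n) t)"
      unfolding Cauchy_def dist_norm
    proof (intro allI impI)
      fix e :: real assume e: "e > 0"
      define \<epsilon> where "\<epsilon> = min (t/2) (e / (C + 1) / 4)"
      have "\<epsilon> > 0" using t e C(1) by (simp add: \<epsilon>_def)
    moreover have "\<epsilon> \<le> t/2" "\<epsilon> \<le> e / (C + 1) / 4"
      by (simp_all only: \<epsilon>_def min.cobounded1 min.cobounded2)
    ultimately have \<epsilon>: "\<epsilon> > 0" "\<epsilon> \<le> t/2" "\<epsilon> \<le> e / (C + 1) / 4" .
      obtain q where q: "q \<in> \<rat>" "t - \<epsilon> < q" "q < t" using Rats_dense_in_real[of "t - \<epsilon>" t] \<epsilon> by auto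
      then have "q \<in> Q" using \<epsilon> t by (auto simp: Q_def)
      then have "Cauchy (\<lambda>n. u (r n) q)" using convQ convergent_Cauchy by blast
      moreover have "e / (2 * M) > 0" using e M(1) by simp
      ultimately obtain N where N: "\<And>m n. m \<ge> N \<Longrightarrow> n \<ge> N \<Longrightarrow> norm (u (r m) q - u (r n) q) < e / (2 * M)"
        unfolding Cauchy_def dist_norm by meson
      have R: "norm (u n t - T (t - q) (u n q)) \<le> e / 4" for n
      proof -
        have "norm (u n t - T (t - q) (u n q)) \<le> C * (t - q)"
          using C(2)[of q t n] q \<epsilon> by simp
        also have "\<dots> \<le> C * \<epsilon>" using q C(1) by (intro mult_left_mono) auto
        also have "\<dots> \<le> (C + 1) * \<epsilon>" using \<epsilon> by (simp add: distrib_right)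
        also have "\<dots> \<le> (C + 1) * (e / (C + 1) / 4)" using C(1) by (intro mult_left_mono \<epsilon>(3)) simp
        also have "\<dots> = e / 4" using C(1) by (intro mult_div_cancel) simp
        finally show ?thesis .
      qed
      have "norm (u (r m) t - u (r n) t) < e" if "m \<ge> N" "n \<ge> N" for m n
      proof -
        have eq: "u (r m) t - u (r n) t = (u (r m) t - T (t - q) (u (r m) q)) + T (t - q) (u (r m) q - u (r n) q) - (u (r n) t - T (t - q) (u (r n) q))"
          by (simp add: blinfun.diff_right)
        have "norm (T (t - q) (u (r m) q - u (r n) q)) \<le> M * norm (u (r m) q - u (r n) q)"
          using q \<epsilon> t by (intro M(2)) auto
        also have "\<dots> < M * (e / (2 * M))" using N[OF that] M(1) by (intro mult_strict_left_mono) auto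
        also have "\<dots> = e / 2" using M(1) by simp
        finally have "norm (T (t - q) (u (r m) q - u (r n) q)) < e / 2" .
        then show ?thesis
          using R[of "r m"] R[of "r n"] arg_cong[OF eq, of norm]
            norm_triangle_ineq4[of "(u (r m) t - T (t - q) (u (r m) q)) + T (t - q) (u (r m) q - u (r n) q)" "u (r n) t - T (t - q) (u (r n) q)"]
            norm_triangle_ineq[of "u (r m) t - T (t - q) (u (r m) q)" "T (t - q) (u (r m) q - u (r n) q)"] by linarith
      qed
      then show "\<exists>N. \<forall>m\<ge>N. \<forall>n\<ge>N. norm (u (r m) t - u (r n) t) < e" by blast
    qed
    then show ?thesis by (rule Cauchy_convergent)
  qed
  define v where "v t = (if t = 0 then x0 else lim (\<lambda>n. u (r n) t))" for t
  have "(\<lambda>n. u (r n) t) \<longlonglongrightarrow> v t" if "t \<ge> 0" for t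
  proof (cases "t = 0")
    case True
    then show ?thesis using u_eq[of 0] by (simp add: v_def)
  next
    case False
    then show ?thesis using conv[of t] that by (simp add: v_def convergent_LIMSEQ_iff)
  qed
  moreover have "v 0 = x0" by (simp add: v_def)
  ultimately show ?thesis using r(1) by blast
qed

end

section \<open>Existence of mild solutions\<close>

text \<open>Applied to y = \<omega>(s - r), it trades the decay of an exponential weight for a
  slightly stronger singularity and the factor \<omega>^(-\<delta>), which is small for large
  \<omega>.\<close>

lemma exp_minus_le_powr:
  fixes y \<delta> :: real
  assumes "y > 0" "0 < \<delta>" "\<delta> < 1"
  shows "exp (- y) \<le> y powr (- \<delta>)"
proof -
  have "\<delta> * ln y \<le> y"
  proof (cases "ln y \<ge> 0")
    case True
    then have "\<delta> * ln y \<le> 1 * ln y" using assms by (intro mult_right_mono) auto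
    also have "\<dots> \<le> y" using ln_le_minus_one[OF assms(1)] by simp
    finally show ?thesis .
  next
    case False
    then have "\<delta> * ln y \<le> 0" using assms by (simp add: mult_nonneg_nonpos)
    then show ?thesis using assms by simp
  qed
  then have "exp (- y) \<le> exp (- (\<delta> * ln y))" by simp
  also have "\<dots> = y powr (- \<delta>)" using assms by (simp add: powr_def)
  finally show ?thesis .
qed

text \<open>The initial value enters through \<open>orbit\<close> alone: \<kappa> is the order of
  the singularity of its orbit in X, so one existence argument covers u0 inside and outside X.
  Continuity and growth of f are stated with values in E_0; finer properties of f are reserved for
  the regularity step.\<close>

locale cauchy_problem = interpolation_space K sc E1 A T X \<xi>
  for K :: "complex set" and sc :: "complex \<Rightarrow> 'e::banach \<Rightarrow> 'e"
    and E1 :: "'e nspace" and A :: "'e \<Rightarrow> 'e" and T :: "real \<Rightarrow> 'e \<Rightarrow>\<^sub>L 'e" and X :: "'e nspace" and \<xi> :: real +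
  fixes f :: "real \<Rightarrow> 'e \<Rightarrow> 'e" and u0 :: 'e and \<kappa> :: real
  assumes f_cont: "continuous_map (prod_topology (top_of_set {0..}) (ntop X)) euclidean (\<lambda>(t, x). f t x)"
    and growth: "\<And>\<tau>. \<tau> > 0 \<Longrightarrow> \<exists>C\<ge>0. \<forall>t x. 0 \<le> t \<and> t \<le> \<tau> \<and> x \<in> carr X \<longrightarrow> norm (f t x) \<le> C * (1 + nrm X x)"
    and \<kappa>: "0 \<le> \<kappa>" "\<kappa> < 1"
    and orbit: "\<And>\<tau>. \<tau> > 0 \<Longrightarrow> \<exists>C\<ge>0. \<forall>t. 0 < t \<and> t \<le> \<tau> \<longrightarrow> nrm X (T t u0) \<le> C * t powr (- \<kappa>)"
begin

lemma f_tendsto: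
  assumes "(tn \<longlongrightarrow> t) F" "\<forall>\<^sub>F n in F. 0 \<le> tn n" "0 \<le> t"
    and "\<forall>\<^sub>F n in F. xn n \<in> carr X" "x \<in> carr X" "((\<lambda>n. nrm X (xn n - x)) \<longlongrightarrow> 0) F"
  shows "((\<lambda>n. f (tn n) (xn n)) \<longlongrightarrow> f t x) F"
proof -
  have "limitin (prod_topology (top_of_set {0..}) (ntop X)) (\<lambda>n. (tn n, xn n)) (t, x) F"
    unfolding limitin_pairwise limitin_subtopology o_def using assms by (simp add: limitin_ntop)
  from continuous_map_limit[OF f_cont this] show ?thesis by (simp add: o_def)
qed

lemma f_continuous_on:
  assumes S: "S \<subseteq> {0..}" and v: "\<And>s. s \<in> S \<Longrightarrow> v s \<in> carr X" "\<And>s. s \<in> S \<Longrightarrow> ((\<lambda>s'. nrm X (v s' - v s)) \<longlongrightarrow> 0) (at s within S)"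
  shows "continuous_on S (\<lambda>s. f s (v s))"
  unfolding continuous_on_def
proof
  fix s assume s: "s \<in> S"
  have ev: "\<forall>\<^sub>F s' in at s within S. s' \<in> S" by (simp add: eventually_at_filter)
  show "((\<lambda>s. f s (v s)) \<longlongrightarrow> f s (v s)) (at s within S)"
  proof (rule f_tendsto)
    show "\<forall>\<^sub>F s' in at s within S. 0 \<le> s'" using ev by (rule eventually_mono) (use S in auto)
    show "\<forall>\<^sub>F s' in at s within S. v s' \<in> carr X" using ev by (rule eventually_mono) (use v in auto)
  qed (use v s S in \<open>auto intro: tendsto_ident_at\<close>)
qed

text \<open>T h moves u (s - h) into X, the domain of f at fixed time. For s > h the integral
  equation turns this into T s u0 plus an integral over [0, s - h] with kernel T (s - r), as in the
  undelayed problem; for s \<le> h the value is T h u0.\<close>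

definition delayed :: "real \<Rightarrow> (real \<Rightarrow> 'e) \<Rightarrow> real \<Rightarrow> 'e" where
  "delayed h u s = T h (u (max (s - h) 0))"

text \<open>The limit h \<le> 1 lets bounds for the semigroup on [0, 1] and on [0, \<tau> + 1] apply
  to T h.\<close>

definition approximate_solution :: "real \<Rightarrow> (real \<Rightarrow> 'e) \<Rightarrow> bool" where
  "approximate_solution h u \<longleftrightarrow> 0 < h \<and> h \<le> 1 \<and> (\<forall>b. continuous_on {0..b} u) \<and>
     (\<forall>t\<ge>0. u t = T t u0 + integral {0..t} (\<lambda>s. T (t - s) (f s (delayed h u s))))"

lemma f_T_continuous:
  assumes h: "h > 0" and v: "continuous_on {0..b} v"
  shows "continuous_on {0..b} (\<lambda>s. f s (T h (v s)))"
proof (rule f_continuous_on)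
  show "T h (v s) \<in> carr X" for s by (rule T_in[OF h])
  fix s assume s: "s \<in> {0..b}"
  show "((\<lambda>s'. nrm X (T h (v s') - T h (v s))) \<longlongrightarrow> 0) (at s within {0..b})"
    using v s h by (intro T_tendsto_into tendsto_const) (auto simp: continuous_on_def)
qed auto

lemma ex_approximate_solution: "0 < h \<Longrightarrow> h \<le> 1 \<Longrightarrow> \<exists>u. approximate_solution h u"
  unfolding approximate_solution_def delayed_def
  using delayed_solution[of "\<lambda>s y. f s (T h y)" h u0] f_T_continuous by blast

lemma delayed_forcing_continuous:
  assumes "approximate_solution h u"
  shows "continuous_on {0..b} (\<lambda>s. f s (delayed h u s))"
  unfolding delayed_def
proof (rule f_T_continuous)
  show h: "h > 0" using assms by (simp add: approximate_solution_def)
  have "continuous_on {0..max b 0} u" using assms unfolding approximate_solution_def by blast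
  then show "continuous_on {0..b} (\<lambda>s. u (max (s - h) 0))"
    by (rule continuous_on_compose2) (use h in \<open>auto intro!: continuous_intros\<close>)
qed

text \<open>The weight \<open>s\<^sup>-\<^sup>\<kappa>e\<^sup>\<omega>\<^sup>s\<close> makes the linear part of the Volterra
  operator a contraction; because of the delay the bound propagates in steps of length \<open>h\<close>.\<close>

lemma a_priori_bound:
  assumes \<tau>: "\<tau> > 0"
  shows "\<exists>B\<ge>0. \<forall>h u s. approximate_solution h u \<and> 0 < s \<and> s \<le> \<tau> \<longrightarrow> nrm X (delayed h u s) \<le> B * s powr (- \<kappa>)"
proof -
  obtain C0 where C0: "C0 \<ge> 0" "\<forall>t. 0 < t \<and> t \<le> \<tau> + 1 \<longrightarrow> nrm X (T t u0) \<le> C0 * t powr (- \<kappa>)"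
    using orbit[of "\<tau> + 1"] \<tau> by auto
  obtain C1 where C1: "C1 \<ge> 0" "\<And>t x. 0 < t \<Longrightarrow> t \<le> \<tau> \<Longrightarrow> nrm X (T t x) \<le> C1 * t powr (- \<xi>) * norm x"
    using smooth_bound[where \<tau> = \<tau>] by blast
  obtain Cf where Cf: "Cf \<ge> 0" "\<forall>t x. 0 \<le> t \<and> t \<le> \<tau> \<and> x \<in> carr X \<longrightarrow> norm (f t x) \<le> Cf * (1 + nrm X x)"
    using growth[OF \<tau>] by blast
  define D where "D = C1 * Cf"
  have D: "D \<ge> 0" using C1(1) Cf(1) by (simp add: D_def)
  \<comment> \<open>Half of the gap between \<xi> and 1 pays for the exponential weight; the raised
    exponent \<beta> = \<xi> + \<delta> is still integrable.\<close>
  define \<delta> where "\<delta> = (1 - \<xi>) / 2"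
  define \<beta> where "\<beta> = \<xi> + \<delta>"
  have \<delta>: "0 < \<delta>" "\<delta> < 1" and \<beta>: "0 \<le> \<beta>" "\<beta> < 1"
    using \<theta>_nonneg \<theta>_less_1 by (auto simp: \<delta>_def \<beta>_def field_simps)
  define E where "E = D * beta_const \<beta> \<kappa> * \<tau> powr (1 - \<beta>)"
  have E: "E \<ge> 0" using D beta_const_nonneg[OF \<beta>(2) \<kappa>(2)] by (simp add: E_def)
  \<comment> \<open>Chosen to make \<omega>^(-\<delta>) = 1/(2E + 1), so that the factor E
    \<omega>^(-\<delta>) of the integral operator is at most 1/2.\<close>
  define \<omega> where "\<omega> = (2 * E + 1) powr (1 / \<delta>)"
  have \<omega>: "\<omega> > 0" using E by (simp add: \<omega>_def)
  have "\<omega> powr (- \<delta>) = (2 * E + 1) powr (1 / \<delta> * - \<delta>)" unfolding \<omega>_def by (rule powr_powr)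
  also have "1 / \<delta> * - \<delta> = - 1" using \<delta> by simp
  finally have \<omega>\<delta>: "\<omega> powr (- \<delta>) = inverse (2 * E + 1)" using E by (simp add: powr_minus)
  have E\<omega>: "E * \<omega> powr (- \<delta>) \<le> 1 / 2" unfolding \<omega>\<delta> using E by (simp add: field_simps)
  \<comment> \<open>The solution of B = C0 + (\<tau>^\<kappa> + B)/2: this is the bound that one
    step of the argument reproduces.\<close>
  define B where "B = 2 * C0 + \<tau> powr \<kappa>"
  have B: "B \<ge> 0" using C0(1) by (simp add: B_def)
  have step: "nrm X (delayed h u s) \<le> B * (s powr (- \<kappa>) * exp (\<omega> * s))"
    if sol: "approximate_solution h u" and s: "0 < s" "s \<le> \<tau>"
      and IH: "\<And>r. 0 < r \<Longrightarrow> r \<le> s - h \<Longrightarrow> nrm X (delayed h u r) \<le> B * (r powr (- \<kappa>) * exp (\<omega> * r))" for h u s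
  proof -
    have h: "0 < h" "h \<le> 1" and u: "\<And>t. t \<ge> 0 \<Longrightarrow> u t = T t u0 + integral {0..t} (\<lambda>s. T (t - s) (f s (delayed h u s)))"
      using sol by (auto simp: approximate_solution_def)
    have exp1: "exp (\<omega> * s) \<ge> 1" using \<omega> s by simp
    show ?thesis
    proof (cases "s \<le> h")
      \<comment> \<open>On the first delay interval the argument is T h u0, and h \<ge> s lets
        s^(-\<kappa>) dominate h^(-\<kappa>).\<close>
      case True
      have "delayed h u s = T h u0" using True u[of 0] by (simp add: delayed_def)
      then have "nrm X (delayed h u s) \<le> C0 * h powr (- \<kappa>)" using C0(2) h \<tau> by simp
      also have "\<dots> \<le> C0 * s powr (- \<kappa>)"
        using True s h C0(1) \<kappa> by (intro mult_left_mono powr_mono2') auto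
      also have "\<dots> \<le> B * (s powr (- \<kappa>) * exp (\<omega> * s))"
        using C0(1) exp1 mult_left_mono[OF exp1, of "s powr (- \<kappa>)"] by (intro mult_mono) (auto simp: B_def)
      finally show ?thesis .
    next
      case False
      define w where "w = s - h"
      have w: "0 < w" "w < s" "w \<le> \<tau>" "s - w = h" using False h s by (auto simp: w_def)
      define k where "k r = T (w - r) (f r (delayed h u r))" for r
      have "delayed h u s = T h (u w)" using w by (simp add: delayed_def w_def max_def)
      also have "\<dots> = T s u0 + T h (integral {0..w} k)"
      proof -
        have hw: "h + w = s" by (simp add: w_def)
        have "T (h + w) u0 = T h (T w u0)" using h w by (intro T_add) auto
        then have "T s u0 = T h (T w u0)" unfolding hw .
        then show ?thesis using u[of w] w by (simp add: blinfun.add_right k_def[abs_def])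
      qed
      finally have eq: "delayed h u s = T s u0 + T h (integral {0..w} k)" .
      define G where "G = exp (\<omega> * s) * \<omega> powr (- \<delta>) * D * (\<tau> powr \<kappa> + B)"
      have G: "G \<ge> 0" using D B by (simp add: G_def)
      have maj_int: "beta_majorant \<beta> \<kappa> s integrable_on {0..w}"
        by (rule integrable_on_subinterval[OF has_integral_integrable[OF beta_majorant_has_integral[OF \<beta>(2) \<kappa>(2) s(1)]]])
          (use w in auto)
      have "nrm X (T h (integral {0..w} k)) \<le> G * integral {0..w} (beta_majorant \<beta> \<kappa> s)"
      proof (rule seminorm_integral_bound[where p = "\<lambda>y. nrm X (T h y)"])
        show "nrm X (T h (y + z)) \<le> nrm X (T h y) + nrm X (T h z)"
          "nrm X (T h (c *\<^sub>R y)) = \<bar>c\<bar> * nrm X (T h y)" for y z c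
          using seminorm_T[OF h(1)] by auto
        show "nrm X (T h y) \<le> (C1 * h powr (- \<xi>)) * norm y" for y
          using C1(2)[of h y] h w s by simp
        show "(k has_integral integral {0..w} k) {0..w}"
          unfolding k_def by (intro integrable_integral integrable_continuous_interval continuous_intros delayed_forcing_continuous sol)
        show "((\<lambda>r. G * beta_majorant \<beta> \<kappa> s r) has_integral G * integral {0..w} (beta_majorant \<beta> \<kappa> s)) {0..w}"
          by (intro has_integral_mult_right integrable_integral maj_int)
        fix r assume r: "r \<in> {0<..<w}"
        have in_X: "delayed h u r \<in> carr X" unfolding delayed_def by (rule T_in[OF h(1)])
        have "norm (f r (delayed h u r)) \<le> Cf * (1 + nrm X (delayed h u r))" using Cf(2) r w in_X by simp
        also have "\<dots> \<le> Cf * ((\<tau> powr \<kappa> + B) * (r powr (- \<kappa>) * exp (\<omega> * r)))"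
        proof (intro mult_left_mono Cf(1))
          have "1 = r powr \<kappa> * r powr (- \<kappa>)" using r by (simp flip: powr_add)
          also have "\<dots> \<le> \<tau> powr \<kappa> * (r powr (- \<kappa>) * exp (\<omega> * r))"
          proof -
            have "r powr \<kappa> \<le> \<tau> powr \<kappa>" using r w \<kappa> by (intro powr_mono2) auto
            moreover have "r powr (- \<kappa>) * 1 \<le> r powr (- \<kappa>) * exp (\<omega> * r)" using r \<omega> by (intro mult_left_mono) auto
            ultimately show ?thesis by (intro mult_mono) auto
          qed
          finally have "1 \<le> \<tau> powr \<kappa> * (r powr (- \<kappa>) * exp (\<omega> * r))" .
          moreover have "nrm X (delayed h u r) \<le> B * (r powr (- \<kappa>) * exp (\<omega> * r))"
            using r w by (intro IH) auto
          ultimately show "1 + nrm X (delayed h u r) \<le> (\<tau> powr \<kappa> + B) * (r powr (- \<kappa>) * exp (\<omega> * r))"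
            unfolding distrib_right by linarith
        qed
        finally have f_le: "norm (f r (delayed h u r)) \<le> Cf * ((\<tau> powr \<kappa> + B) * (r powr (- \<kappa>) * exp (\<omega> * r)))" .
        have "T h (k r) = T (s - r) (f r (delayed h u r))"
          unfolding k_def using T_add[of h "w - r" "f r (delayed h u r)"] r h w by (simp add: w_def)
        then have "nrm X (T h (k r)) \<le> C1 * (s - r) powr (- \<xi>) * norm (f r (delayed h u r))"
          using C1(2)[of "s - r"] r w s by simp
        also have "\<dots> \<le> C1 * (s - r) powr (- \<xi>) * (Cf * ((\<tau> powr \<kappa> + B) * (r powr (- \<kappa>) * exp (\<omega> * r))))"
          using C1(1) by (intro mult_left_mono f_le) auto
        also have "\<dots> = D * (\<tau> powr \<kappa> + B) * ((s - r) powr (- \<xi>) * exp (\<omega> * r) * r powr (- \<kappa>))"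
          by (simp add: D_def mult_ac)
        also have "\<dots> \<le> D * (\<tau> powr \<kappa> + B) * (exp (\<omega> * s) * \<omega> powr (- \<delta>) * beta_majorant \<beta> \<kappa> s r)"
        proof (intro mult_left_mono)
          \<comment> \<open>The weight at r is the weight at s times exp (- \<omega>(s - r)); this
            last factor is turned into (\<omega>(s - r))^(-\<delta>), which raises the kernel
            exponent from \<xi> to \<beta>.\<close>
          have "exp (\<omega> * r) = exp (\<omega> * s) * exp (- (\<omega> * (s - r)))"
          proof -
            have "\<omega> * r = \<omega> * s + - (\<omega> * (s - r))" by (simp add: algebra_simps)
            then show ?thesis by (simp only: exp_add[symmetric])
          qed
          also have "\<dots> \<le> exp (\<omega> * s) * (\<omega> * (s - r)) powr (- \<delta>)"
            using \<omega> r w \<delta> by (intro mult_left_mono exp_minus_le_powr) auto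
          also have "(\<omega> * (s - r)) powr (- \<delta>) = \<omega> powr (- \<delta>) * (s - r) powr (- \<delta>)"
            by (rule powr_mult)
          finally have "(s - r) powr (- \<xi>) * exp (\<omega> * r) * r powr (- \<kappa>) \<le>
              (s - r) powr (- \<xi>) * (exp (\<omega> * s) * (\<omega> powr (- \<delta>) * (s - r) powr (- \<delta>))) * r powr (- \<kappa>)"
            by (intro mult_right_mono mult_left_mono) auto
          also have "\<dots> = exp (\<omega> * s) * \<omega> powr (- \<delta>) * (((s - r) powr (- \<xi>) * (s - r) powr (- \<delta>)) * r powr (- \<kappa>))"
            by (simp add: mult_ac)
          also have "(s - r) powr (- \<xi>) * (s - r) powr (- \<delta>) = (s - r) powr (- \<beta>)"
          proof -
            have "- \<xi> + - \<delta> = - \<beta>" by (simp add: \<beta>_def)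
            then show ?thesis by (simp only: powr_add[symmetric])
          qed
          also have "exp (\<omega> * s) * \<omega> powr (- \<delta>) * ((s - r) powr (- \<beta>) * r powr (- \<kappa>)) \<le> exp (\<omega> * s) * \<omega> powr (- \<delta>) * beta_majorant \<beta> \<kappa> s r"
            using r w by (intro mult_left_mono beta_majorant_ge \<beta> \<kappa>) auto
          finally show "(s - r) powr (- \<xi>) * exp (\<omega> * r) * r powr (- \<kappa>) \<le> exp (\<omega> * s) * \<omega> powr (- \<delta>) * beta_majorant \<beta> \<kappa> s r" .
        qed (use D B in auto)
        also have "\<dots> = G * beta_majorant \<beta> \<kappa> s r" by (simp add: G_def mult_ac)
        finally show "nrm X (T h (k r)) \<le> G * beta_majorant \<beta> \<kappa> s r" .
      qed
      \<comment> \<open>Extending the integral of the nonnegative majorant from [0, s - h] to [0, s]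
        makes the bound independent of h.\<close>
      also have "\<dots> \<le> G * integral {0..s} (beta_majorant \<beta> \<kappa> s)"
        using beta_majorant_has_integral[OF \<beta>(2) \<kappa>(2) s(1)] w
        by (intro mult_left_mono G integral_subset_le maj_int) (auto intro: beta_majorant_nonneg)
      also have "integral {0..s} (beta_majorant \<beta> \<kappa> s) = beta_const \<beta> \<kappa> * s powr (1 - \<beta> - \<kappa>)"
        by (rule integral_unique[OF beta_majorant_has_integral[OF \<beta>(2) \<kappa>(2) s(1)]])
      also have "s powr (1 - \<beta> - \<kappa>) = s powr (1 - \<beta>) * s powr (- \<kappa>)"
        by (simp flip: powr_add)
      also have "G * (beta_const \<beta> \<kappa> * (s powr (1 - \<beta>) * s powr (- \<kappa>))) \<le> G * (beta_const \<beta> \<kappa> * (\<tau> powr (1 - \<beta>) * s powr (- \<kappa>)))"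
        using s \<beta> beta_const_nonneg[OF \<beta>(2) \<kappa>(2)] by (intro mult_left_mono mult_right_mono powr_mono2 G) auto
      also have "\<dots> = (E * \<omega> powr (- \<delta>)) * ((\<tau> powr \<kappa> + B) * (s powr (- \<kappa>) * exp (\<omega> * s)))"
        by (simp add: G_def E_def mult_ac)
      also have "\<dots> \<le> (1 / 2) * ((\<tau> powr \<kappa> + B) * (s powr (- \<kappa>) * exp (\<omega> * s)))"
        using B by (intro mult_right_mono E\<omega>) auto
      finally have int_le: "nrm X (T h (integral {0..w} k)) \<le> (1 / 2) * ((\<tau> powr \<kappa> + B) * (s powr (- \<kappa>) * exp (\<omega> * s)))" .
      have "nrm X (T s u0) \<le> C0 * s powr (- \<kappa>)" using C0(2) s by simp
      also have "\<dots> \<le> C0 * (s powr (- \<kappa>) * exp (\<omega> * s))"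
        using C0(1) exp1 mult_left_mono[OF exp1, of "s powr (- \<kappa>)"] by (intro mult_left_mono) auto
      finally have "nrm X (delayed h u s) \<le> C0 * (s powr (- \<kappa>) * exp (\<omega> * s)) + (1 / 2) * ((\<tau> powr \<kappa> + B) * (s powr (- \<kappa>) * exp (\<omega> * s)))"
        using nrm_triangle[OF T_in[OF s(1), of u0] T_in[OF h(1), of "integral {0..w} k"]] int_le by (simp add: eq)
      also have "\<dots> = (C0 + (1 / 2) * (\<tau> powr \<kappa> + B)) * (s powr (- \<kappa>) * exp (\<omega> * s))"
        by (simp only: distrib_right mult.assoc)
      also have "C0 + (1 / 2) * (\<tau> powr \<kappa> + B) = B" by (simp add: B_def)
      finally show ?thesis .
    qed
  qed
  have bound: "nrm X (delayed h u s) \<le> B * (s powr (- \<kappa>) * exp (\<omega> * s))"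
    if sol: "approximate_solution h u" and s: "0 < s" "s \<le> \<tau>" "s \<le> real n * h" for h u s n
    using s
  proof (induction n arbitrary: s)
    case (Suc n)
    show ?case
    proof (rule step[OF sol Suc.prems(1,2)])
      fix r assume r: "0 < r" "r \<le> s - h"
      have "h > 0" using sol by (simp add: approximate_solution_def)
      then show "nrm X (delayed h u r) \<le> B * (r powr (- \<kappa>) * exp (\<omega> * r))"
        using Suc.prems r by (intro Suc.IH) (auto simp: algebra_simps)
    qed
  qed simp
  have "nrm X (delayed h u s) \<le> (B * exp (\<omega> * \<tau>)) * s powr (- \<kappa>)"
    if sol: "approximate_solution h u" and s: "0 < s" "s \<le> \<tau>" for h u s
  proof -
    have h: "h > 0" using sol by (simp add: approximate_solution_def)
    obtain n :: nat where "s / h \<le> real n" using real_arch_simple by blast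
    then have "s \<le> real n * h" using h by (simp add: field_simps)
    then have "nrm X (delayed h u s) \<le> B * (s powr (- \<kappa>) * exp (\<omega> * s))" by (rule bound[OF sol s])
    also have "\<dots> \<le> B * (s powr (- \<kappa>) * exp (\<omega> * \<tau>))"
      using s \<omega> B by (intro mult_left_mono) auto
    finally show ?thesis by (simp add: mult_ac)
  qed
  then show ?thesis using B by (intro exI[of _ "B * exp (\<omega> * \<tau>)"]) auto
qed

lemma forcing_bound:
  assumes \<tau>: "\<tau> > 0"
  shows "\<exists>L\<ge>0. \<forall>h u s. approximate_solution h u \<and> 0 < s \<and> s \<le> \<tau> \<longrightarrow> norm (f s (delayed h u s)) \<le> L * s powr (- \<kappa>)"
proof -
  obtain B where B: "B \<ge> 0" "\<forall>h u s. approximate_solution h u \<and> 0 < s \<and> s \<le> \<tau> \<longrightarrow> nrm X (delayed h u s) \<le> B * s powr (- \<kappa>)"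
    using a_priori_bound[OF \<tau>] by blast
  obtain Cf where Cf: "Cf \<ge> 0" "\<forall>t x. 0 \<le> t \<and> t \<le> \<tau> \<and> x \<in> carr X \<longrightarrow> norm (f t x) \<le> Cf * (1 + nrm X x)"
    using growth[OF \<tau>] by blast
  have "norm (f s (delayed h u s)) \<le> (Cf * (\<tau> powr \<kappa> + B)) * s powr (- \<kappa>)"
    if sol: "approximate_solution h u" and s: "0 < s" "s \<le> \<tau>" for h u s
  proof -
    have "h > 0" using sol by (simp add: approximate_solution_def)
    then have "delayed h u s \<in> carr X" unfolding delayed_def by (rule T_in)
    then have "norm (f s (delayed h u s)) \<le> Cf * (1 + nrm X (delayed h u s))" using Cf(2) s by simp
    also have "\<dots> \<le> Cf * ((\<tau> powr \<kappa> + B) * s powr (- \<kappa>))"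
    proof (intro mult_left_mono Cf(1))
      have "1 = s powr \<kappa> * s powr (- \<kappa>)" using s by (simp flip: powr_add)
      also have "\<dots> \<le> \<tau> powr \<kappa> * s powr (- \<kappa>)" using s \<kappa> by (intro mult_right_mono powr_mono2) auto
      finally show "1 + nrm X (delayed h u s) \<le> (\<tau> powr \<kappa> + B) * s powr (- \<kappa>)"
        using B(2)[rule_format, of h u s] sol s unfolding distrib_right by simp
    qed
    finally show ?thesis by (simp add: mult.assoc)
  qed
  then show ?thesis using B(1) Cf(1) by (intro exI[of _ "Cf * (\<tau> powr \<kappa> + B)"]) auto
qed

end

lemma small_powr:
  fixes C e p :: real
  assumes "C \<ge> 0" "e > 0" "p > 0"
  obtains d where "d > 0" "\<And>x. 0 \<le> x \<Longrightarrow> x \<le> d \<Longrightarrow> C * x powr p \<le> e"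
proof (rule that[of "(e / (C + 1)) powr (1 / p)"])
  show "(e / (C + 1)) powr (1 / p) > 0" using assms by simp
  fix x assume x: "0 \<le> x" "x \<le> (e / (C + 1)) powr (1 / p)"
  have "x powr p \<le> ((e / (C + 1)) powr (1 / p)) powr p"
    using x assms by (intro powr_mono2) auto
  also have "\<dots> = (e / (C + 1)) powr (1 / p * p)" by (rule powr_powr)
  also have "\<dots> = e / (C + 1)" using assms by simp
  finally have "C * x powr p \<le> C * (e / (C + 1))" using assms by (intro mult_left_mono) auto
  also have "\<dots> \<le> (C + 1) * (e / (C + 1))" using assms by (intro mult_right_mono) auto
  also have "\<dots> = e" using assms by simp
  finally show "C * x powr p \<le> e" .
qed

section \<open>Passing to the limit in the remainders\<close>

context mild_family
begin

lemma u_0: "u n 0 = x0"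
  using u_eq[of 0 n] by simp

text \<open>The functions converge in E_0 only. The remainder over [q, t] equals T (t - p) applied
  to the remainder over [q, p] plus the small remainder over [p, t], which is the situation of
  \<open>converges_in\<close>; so convergence, and with it the bound B, holds in Y.\<close>

lemma limit_in:
  assumes v: "\<And>t. t \<ge> 0 \<Longrightarrow> (\<lambda>n. u (r n) t) \<longlonglongrightarrow> v t"
    and Y: "smoothing_target K sc E1 A T Y \<theta>" and \<theta>: "\<theta> < 1" and q: "0 \<le> q" "q < t"
    and B: "\<And>n. nrm Y (u n t - T (t - q) (u n q)) \<le> B"
  shows "v t - T (t - q) (v q) \<in> carr Y" "nrm Y (v t - T (t - q) (v q)) \<le> B"
proof -
  interpret Y: smoothing_target K sc E1 A T Y \<theta> by (rule Y)
  have lim: "(\<lambda>n. u (r n) s - T (s - q) (u (r n) q)) \<longlonglongrightarrow> v s - T (s - q) (v q)" if "s \<ge> 0" for s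
    using v q that by (intro tendsto_diff T_tendsto tendsto_const) auto
  define a where "a = (q + t) / 2"
  have a: "0 < a" "a < t" "q < a" using q by (auto simp: a_def)
  obtain C where C: "C \<ge> 0" "\<forall>n p s. a \<le> p \<and> p < s \<and> s \<le> t \<longrightarrow>
      u n s - T (s - p) (u n p) \<in> carr Y \<and> nrm Y (u n s - T (s - p) (u n p)) \<le> C * (s - p) powr (1 - \<theta>)"
    using remainder_bound[OF Y \<theta> a(1,2)] by blast
  have split: "(u n t - T (t - q) (u n q)) - T (t - p) (u n p - T (p - q) (u n q)) = u n t - T (t - p) (u n p)"
    if "q < p" "p < t" for n p
    using T_add[of "t - p" "p - q" "u n q"] that by (simp add: blinfun.diff_right)
  have in_Y: "u (r n) t - T (t - q) (u (r n) q) \<in> carr Y" for n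
  proof -
    have "(u (r n) t - T (t - a) (u (r n) a)) + T (t - a) (u (r n) a - T (a - q) (u (r n) q)) \<in> carr Y"
      using C(2) a by (intro Y.carr_add Y.T_in) auto
    then show ?thesis using split[of a "r n"] a by (metis diff_add_cancel)
  qed
  have approx: "\<exists>\<delta>>0. \<exists>y. convergent y \<and> (\<forall>n. nrm Y ((u (r n) t - T (t - q) (u (r n) q)) - T \<delta> (y n)) \<le> e)"
    if e: "e > 0" for e
  proof -
    obtain d where d: "d > 0" "\<And>x. 0 \<le> x \<Longrightarrow> x \<le> d \<Longrightarrow> C * x powr (1 - \<theta>) \<le> e"
      using small_powr[OF C(1) e, of "1 - \<theta>"] \<theta> by auto
    define p where "p = max a (t - d)"
    have p: "a \<le> p" "p < t" "q < p" "0 < t - p" "t - p \<le> d" using a d by (auto simp: p_def)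
    have "convergent (\<lambda>n. u (r n) p - T (p - q) (u (r n) q))"
      using lim[of p] p q unfolding convergent_def by auto
    moreover have "nrm Y ((u (r n) t - T (t - q) (u (r n) q)) - T (t - p) (u (r n) p - T (p - q) (u (r n) q))) \<le> e" for n
      unfolding split[OF p(3,2)]
      using C(2)[rule_format, of p t "r n"] d(2)[of "t - p"] p by linarith
    ultimately show ?thesis using p(4) by blast
  qed
  have t: "t \<ge> 0" using q by simp
  note conv = Y.converges_in[OF in_Y lim[OF t] approx]
  show *: "v t - T (t - q) (v q) \<in> carr Y" by (rule conv(1))
  show "nrm Y (v t - T (t - q) (v q)) \<le> B"
    by (rule Y.nrm_lim_le[OF conv(2)]) (use in_Y * B in auto)
qed

end

context cauchy_problem
begin

text \<open>The integral equation is asserted from positive times on, where the forcing is bounded.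
  Contact with u0 is made by the last clause; it is quantified over target spaces because the
  initial value is to be attained in E_\<alpha>, while the equation lives in X.\<close>

lemma mild_solution:
  "\<exists>u. u 0 = u0 \<and> (\<forall>t>0. u t \<in> carr X \<and> ((\<lambda>s. nrm X (u s - u t)) \<longlongrightarrow> 0) (at t)) \<and>
    continuous_on {0<..} (\<lambda>s. f s (u s)) \<and>
    (\<forall>q t. 0 < q \<and> q \<le> t \<longrightarrow> u t - T (t - q) (u q) = integral {q..t} (\<lambda>s. T (t - s) (f s (u s)))) \<and>
    (\<forall>Y \<theta> \<tau>. smoothing_target K sc E1 A T Y \<theta> \<and> \<theta> < 1 \<and> \<tau> > 0 \<longrightarrow>
      (\<exists>C\<ge>0. \<forall>t. 0 < t \<and> t \<le> \<tau> \<longrightarrow> u t - T t u0 \<in> carr Y \<and> nrm Y (u t - T t u0) \<le> C * t powr (1 - \<theta> - \<kappa>)))"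
proof -
  define h :: "nat \<Rightarrow> real" where "h n = inverse (real (Suc n))" for n
  have "\<exists>u. approximate_solution (h n) u" for n
    by (rule ex_approximate_solution) (auto simp: h_def inverse_le_1_iff)
  then obtain a where a: "\<And>n. approximate_solution (h n) (a n)" by metis
  define g where "g n s = f s (delayed (h n) (a n) s)" for n s
  interpret M: mild_family K sc E1 A T a g u0 \<kappa>
  proof
    show "continuous_on {0..b} (g n)" for n b
      unfolding g_def by (rule delayed_forcing_continuous[OF a])
    show "0 \<le> t \<Longrightarrow> a n t = T t u0 + integral {0..t} (\<lambda>s. T (t - s) (g n s))" for n t
      using a[of n] by (simp add: approximate_solution_def g_def)
    show "\<exists>L\<ge>0. \<forall>n s. 0 < s \<and> s \<le> \<tau> \<longrightarrow> norm (g n s) \<le> L * s powr - \<kappa>" if "\<tau> > 0" for \<tau>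
      using forcing_bound[OF that] a unfolding g_def by meson
  qed (rule \<kappa>)+
  obtain r v where r: "strict_mono r" and v0: "v 0 = u0" and v: "\<And>t. t \<ge> 0 \<Longrightarrow> (\<lambda>n. a (r n) t) \<longlonglongrightarrow> v t"
    using M.subsequence_limit by blast
  note limit_in = M.limit_in[where r = r and v = v, OF v]
  have X: "smoothing_target K sc E1 A T X \<xi>" by unfold_locales
  \<comment> \<open>One constant serves the limit v and all approximations, because the two are
    compared with each other in \<open>delayed_lim\<close>.\<close>
  have v_bound: "\<exists>C\<ge>0. \<forall>q t. b \<le> q \<and> q < t \<and> t \<le> \<tau> \<longrightarrow> v t - T (t - q) (v q) \<in> carr X \<and>
      nrm X (v t - T (t - q) (v q)) \<le> C * (t - q) powr (1 - \<xi>) \<and>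
      (\<forall>n. a n t - T (t - q) (a n q) \<in> carr X \<and> nrm X (a n t - T (t - q) (a n q)) \<le> C * (t - q) powr (1 - \<xi>))"
    if b: "0 < b" "b < \<tau>" for b \<tau>
  proof -
    obtain C where C: "C \<ge> 0" "\<forall>n q t. b \<le> q \<and> q < t \<and> t \<le> \<tau> \<longrightarrow>
      a n t - T (t - q) (a n q) \<in> carr X \<and> nrm X (a n t - T (t - q) (a n q)) \<le> C * (t - q) powr (1 - \<xi>)"
      using M.remainder_bound[OF X \<theta>_less_1 b] by blast
    have "v t - T (t - q) (v q) \<in> carr X \<and> nrm X (v t - T (t - q) (v q)) \<le> C * (t - q) powr (1 - \<xi>)"
      if "b \<le> q" "q < t" "t \<le> \<tau>" for q t
      using limit_in[OF _ X \<theta>_less_1, of q t "C * (t - q) powr (1 - \<xi>)"] C(2) that b by auto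
    then show ?thesis using C by blast
  qed
  have v_in: "v s - T (s - q) (v q) \<in> carr X" if "0 < q" "q < s" for q s
    using v_bound[of q s] that by auto
  have v_X: "v t \<in> carr X" "((\<lambda>s. nrm X (v s - v t)) \<longlongrightarrow> 0) (at t)" if t: "t > 0" for t
  proof -
    have small: "\<exists>d>0. \<forall>q s. 0 < q \<and> t - d < q \<and> q < s \<and> s < t + d \<longrightarrow> nrm X (v s - T (s - q) (v q)) < e" if e: "e > 0" for e
    proof -
      obtain C where C: "C \<ge> 0" "\<forall>q s. t/2 \<le> q \<and> q < s \<and> s \<le> 2 * t \<longrightarrow> nrm X (v s - T (s - q) (v q)) \<le> C * (s - q) powr (1 - \<xi>)"
        using v_bound[of "t/2" "2 * t"] t by auto
      obtain d where d: "d > 0" "\<And>x. 0 \<le> x \<Longrightarrow> x \<le> d \<Longrightarrow> C * x powr (1 - \<xi>) \<le> e / 2"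
        using small_powr[OF C(1), of "e / 2" "1 - \<xi>"] e \<theta>_less_1 by auto
      have "nrm X (v s - T (s - q) (v q)) < e" if "0 < q" "t - min (t/2) (d/2) < q" "q < s" "s < t + min (t/2) (d/2)" for q s
      proof -
        have "t/2 \<le> q" "s \<le> 2 * t" "s - q \<le> d" using that by (auto simp: min_def split: if_splits)
        then have "nrm X (v s - T (s - q) (v q)) \<le> e / 2" using C(2)[rule_format, of q s] d(2)[of "s - q"] that by simp
        then show ?thesis using e by simp
      qed
      then show ?thesis using t d(1) by (intro exI[of _ "min (t/2) (d/2)"]) auto
    qed
    show "v t \<in> carr X" "((\<lambda>s. nrm X (v s - v t)) \<longlongrightarrow> 0) (at t)"
      by (rule mild_tendsto[OF v_in small t]; assumption)+
  qed
  have g_cont: "continuous_on {0<..} (\<lambda>s. f s (v s))"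
    by (rule f_continuous_on) (use v_X in \<open>auto intro: tendsto_within_subset\<close>)
  have h0: "(\<lambda>n. h (r n)) \<longlonglongrightarrow> 0"
    using LIMSEQ_subseq_LIMSEQ[OF LIMSEQ_inverse_real_of_nat r] by (simp add: h_def o_def)
  \<comment> \<open>A time q slightly below s is fixed. Once h < s - q, the delayed value differs
    from T (s - q) (w q) by T h applied to a remainder on [q, s - h], and v s from T (s - q) (v q)
    by a remainder on [q, s]. Both are small, and convergence at q is raised to X by T (s -
    q).\<close>
  have delayed_lim: "(\<lambda>n. nrm X (delayed (h (r n)) (a (r n)) s - v s)) \<longlonglongrightarrow> 0" if s: "s > 0" for s
  proof (rule LIMSEQ_I)
    fix e :: real assume e: "e > 0"
    obtain B where B: "B \<ge> 0" "\<forall>t x. 0 \<le> t \<and> t \<le> 1 \<and> x \<in> carr X \<longrightarrow> T t x \<in> carr X \<and> nrm X (T t x) \<le> B * nrm X x"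
      using T_bounded_X[of 1] by auto
    obtain C where C: "C \<ge> 0" "\<forall>q t. s/2 \<le> q \<and> q < t \<and> t \<le> s \<longrightarrow> v t - T (t - q) (v q) \<in> carr X \<and>
      nrm X (v t - T (t - q) (v q)) \<le> C * (t - q) powr (1 - \<xi>) \<and>
      (\<forall>n. a n t - T (t - q) (a n q) \<in> carr X \<and> nrm X (a n t - T (t - q) (a n q)) \<le> C * (t - q) powr (1 - \<xi>))"
      using v_bound[of "s/2" s] s by auto
    obtain d where d: "d > 0" "\<And>x. 0 \<le> x \<Longrightarrow> x \<le> d \<Longrightarrow> ((B + 1) * C) * x powr (1 - \<xi>) \<le> e / 4"
      using small_powr[of "(B + 1) * C" "e / 4" "1 - \<xi>"] e \<theta>_less_1 B(1) C(1) by auto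
    define q where "q = max (s/2) (s - d)"
    have q: "s/2 \<le> q" "q < s" "0 < q" "0 < s - q" "s - q \<le> d" using s d by (auto simp: q_def)
    have "(\<lambda>n. nrm X (T (s - q) (a (r n) q) - T (s - q) (v q))) \<longlonglongrightarrow> 0"
      using v q by (intro T_tendsto_into tendsto_const) auto
    then have "\<forall>\<^sub>F n in sequentially. nrm X (T (s - q) (a (r n) q) - T (s - q) (v q)) < e / 4"
      by (rule order_tendstoD(2)) (use e in simp)
    moreover have "\<forall>\<^sub>F n in sequentially. h (r n) < s - q"
      by (rule order_tendstoD(2)[OF h0 q(4)])
    ultimately have "\<forall>\<^sub>F n in sequentially. norm (nrm X (delayed (h (r n)) (a (r n)) s - v s) - 0) < e"
    proof eventually_elim
      case (elim n)
      define \<eta> w where "\<eta> = h (r n)" and "w = a (r n)"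
      have \<eta>: "0 < \<eta>" "\<eta> \<le> 1" "\<eta> < s - q"
        using a[of "r n"] elim by (auto simp: \<eta>_def approximate_solution_def)
      have W: "w (s - \<eta>) - T (s - \<eta> - q) (w q) \<in> carr X" "nrm X (w (s - \<eta>) - T (s - \<eta> - q) (w q)) \<le> C * (s - \<eta> - q) powr (1 - \<xi>)"
        using C(2)[rule_format, of q "s - \<eta>"] \<eta> q by (auto simp: w_def)
      have "delayed \<eta> w s - T (s - q) (w q) = T \<eta> (w (s - \<eta>) - T (s - \<eta> - q) (w q))"
        using T_add[of \<eta> "s - \<eta> - q" "w q"] \<eta> q by (simp add: delayed_def blinfun.diff_right max_def)
      then have 1: "delayed \<eta> w s - T (s - q) (w q) \<in> carr X" "nrm X (delayed \<eta> w s - T (s - q) (w q)) \<le> B * nrm X (w (s - \<eta>) - T (s - \<eta> - q) (w q))"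
        using B(2)[rule_format, of \<eta> "w (s - \<eta>) - T (s - \<eta> - q) (w q)"] W(1) \<eta> by auto
      have "C * (s - \<eta> - q) powr (1 - \<xi>) \<le> C * (s - q) powr (1 - \<xi>)"
        using \<eta> \<theta>_less_1 C(1) by (intro mult_left_mono powr_mono2) auto
      with W(2) have "B * nrm X (w (s - \<eta>) - T (s - \<eta> - q) (w q)) \<le> B * (C * (s - q) powr (1 - \<xi>))"
        using B(1) by (intro mult_left_mono) auto
      moreover have 2: "v s - T (s - q) (v q) \<in> carr X" "nrm X (v s - T (s - q) (v q)) \<le> C * (s - q) powr (1 - \<xi>)"
        using C(2)[rule_format, of q s] q by auto
      moreover have "B * (C * (s - q) powr (1 - \<xi>)) + C * (s - q) powr (1 - \<xi>) \<le> e / 4"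
        using d(2)[of "s - q"] q by (simp add: algebra_simps)
      ultimately have 3: "nrm X (delayed \<eta> w s - T (s - q) (w q)) + nrm X (v s - T (s - q) (v q)) \<le> e / 4"
        using 1(2) by linarith
      have 4: "T (s - q) (w q) - T (s - q) (v q) \<in> carr X" using T_in[OF q(4)] by blast
      have eq: "delayed \<eta> w s - v s = (delayed \<eta> w s - T (s - q) (w q)) + (T (s - q) (w q) - T (s - q) (v q)) - (v s - T (s - q) (v q))"
        by simp
      have "nrm X (delayed \<eta> w s - v s) \<le> nrm X (delayed \<eta> w s - T (s - q) (w q)) + nrm X (T (s - q) (w q) - T (s - q) (v q)) + nrm X (v s - T (s - q) (v q))"
        using nrm_triangle_diff[OF carr_add[OF 1(1) 4] 2(1)] nrm_triangle[OF 1(1) 4] arg_cong[OF eq, of "nrm X"] by linarith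
      then have "nrm X (delayed \<eta> w s - v s) < e" using 3 elim(1) e by (simp add: w_def)
      then show ?case by (simp add: \<eta>_def w_def)
    qed
    then show "\<exists>N. \<forall>n\<ge>N. norm (nrm X (delayed (h (r n)) (a (r n)) s - v s) - 0) < e"
      by (simp add: eventually_sequentially)
  qed
  have g_lim: "(\<lambda>n. g (r n) s) \<longlonglongrightarrow> f s (v s)" if s: "s > 0" for s
  proof -
    have "h n > 0" for n by (simp add: h_def)
    then have "delayed (h (r n)) (a (r n)) s \<in> carr X" for n unfolding delayed_def by (intro T_in)
    then show ?thesis
      unfolding g_def using s v_X(1)[OF s] delayed_lim[OF s] by (intro f_tendsto tendsto_const) auto
  qed
  have mild: "v t - T (t - q) (v q) = integral {q..t} (\<lambda>s. T (t - s) (f s (v s)))" if q: "0 < q" "q \<le> t" for q t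
  proof -
    obtain L where L: "L \<ge> 0" "\<forall>n s. 0 < s \<and> s \<le> t \<longrightarrow> norm (g n s) \<le> L * s powr (- \<kappa>)"
      using M.g_bound[of t] q by auto
    have gL: "norm (g n s) \<le> L * q powr (- \<kappa>)" if "s \<in> {q..t}" for n s
    proof -
      have "norm (g n s) \<le> L * s powr (- \<kappa>)" using L(2) that q by simp
      also have "\<dots> \<le> L * q powr (- \<kappa>)" using that q \<kappa> L(1) by (intro mult_left_mono powr_mono2') auto
      finally show ?thesis .
    qed
    have fL: "norm (f s (v s)) \<le> L * q powr (- \<kappa>)" if "s \<in> {q..t}" for s
    proof (rule tendsto_upperbound[OF tendsto_norm[OF g_lim]])
      show "s > 0" using that q by simp
      show "\<forall>\<^sub>F n in sequentially. norm (g (r n) s) \<le> L * q powr (- \<kappa>)" using gL[OF that] by simp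
    qed simp
    obtain B where B: "B \<ge> 1" "\<And>s x. s \<le> t \<Longrightarrow> norm (T s x) \<le> B * norm x" using T_bound by blast
    have fc: "continuous_on {q..t} (\<lambda>s. f s (v s))"
      by (rule continuous_on_subset[OF g_cont]) (use q in auto)
    have gc: "continuous_on {q..t} (g n)" for n by (rule M.g_cont') (use q in simp)
    \<comment> \<open>The forcings converge pointwise; since q > 0, the weighted bound supplies a
      constant majorant on [q, t].\<close>
    have "(\<lambda>n. integral {q..t} (\<lambda>s. norm (g (r n) s - f s (v s)))) \<longlonglongrightarrow> integral {q..t} (\<lambda>s. 0::real)"
    proof (rule dominated_convergence(2))
      show "(\<lambda>s. norm (g (r n) s - f s (v s))) integrable_on {q..t}" for n
        by (intro integrable_continuous_interval continuous_on_norm continuous_on_diff gc fc)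
      show "(\<lambda>s. 2 * (L * q powr (- \<kappa>))) integrable_on {q..t}" by (rule integrable_const_ivl)
      show "norm (norm (g (r n) s - f s (v s))) \<le> 2 * (L * q powr (- \<kappa>))" if "s \<in> {q..t}" for n s
        using gL[OF that, of "r n"] fL[OF that] norm_triangle_ineq4[of "g (r n) s" "f s (v s)"] by simp
      show "(\<lambda>n. norm (g (r n) s - f s (v s))) \<longlonglongrightarrow> 0" if "s \<in> {q..t}" for s
        using g_lim[of s] that q by (intro tendsto_norm_zero LIM_zero) auto
    qed
    then have int0: "(\<lambda>n. B * integral {q..t} (\<lambda>s. norm (g (r n) s - f s (v s)))) \<longlonglongrightarrow> 0"
      by (intro tendsto_mult_right_zero) simp
    have le: "norm (integral {q..t} (\<lambda>s. T (t - s) (g (r n) s)) - integral {q..t} (\<lambda>s. T (t - s) (f s (v s)))) \<le>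
        B * integral {q..t} (\<lambda>s. norm (g (r n) s - f s (v s)))" for n
    proof -
      have "integral {q..t} (\<lambda>s. T (t - s) (g (r n) s)) - integral {q..t} (\<lambda>s. T (t - s) (f s (v s))) =
          integral {q..t} (\<lambda>s. T (t - s) (g (r n) s) - T (t - s) (f s (v s)))"
        by (rule Henstock_Kurzweil_Integration.integral_diff[symmetric])
          (intro integrable_continuous_interval continuous_intros gc fc)+
      also have "\<dots> = integral {q..t} (\<lambda>s. T (t - s) (g (r n) s - f s (v s)))"
        by (simp add: blinfun.diff_right)
      also have "norm \<dots> \<le> integral {q..t} (\<lambda>s. B * norm (g (r n) s - f s (v s)))"
      proof (rule Henstock_Kurzweil_Integration.integral_norm_bound_integral)
        show "(\<lambda>s. T (t - s) (g (r n) s - f s (v s))) integrable_on {q..t}"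
          by (intro integrable_continuous_interval continuous_intros gc fc)
        show "(\<lambda>s. B * norm (g (r n) s - f s (v s))) integrable_on {q..t}"
          by (intro integrable_continuous_interval continuous_intros gc fc)
        show "norm (T (t - s) (g (r n) s - f s (v s))) \<le> B * norm (g (r n) s - f s (v s))" if "s \<in> {q..t}" for s
          using that q by (intro B(2)) auto
      qed
      finally show ?thesis by simp
    qed
    have "(\<lambda>n. integral {q..t} (\<lambda>s. T (t - s) (g (r n) s)) - integral {q..t} (\<lambda>s. T (t - s) (f s (v s)))) \<longlonglongrightarrow> 0"
      by (rule Lim_null_comparison[OF always_eventually[OF allI[OF le]] int0])
    then have "(\<lambda>n. integral {q..t} (\<lambda>s. T (t - s) (g (r n) s))) \<longlonglongrightarrow> integral {q..t} (\<lambda>s. T (t - s) (f s (v s)))"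
      by (simp add: LIM_zero_iff)
    moreover have "(\<lambda>n. a (r n) t - T (t - q) (a (r n) q)) \<longlonglongrightarrow> v t - T (t - q) (v q)"
      using v q by (intro tendsto_diff T_tendsto tendsto_const) auto
    moreover have "a (r n) t - T (t - q) (a (r n) q) = integral {q..t} (\<lambda>s. T (t - s) (g (r n) s))" for n
      by (rule M.u_mild) (use q in auto)
    ultimately show ?thesis using LIMSEQ_unique by simp
  qed
  have bound_0: "\<exists>C\<ge>0. \<forall>t. 0 < t \<and> t \<le> \<tau> \<longrightarrow> v t - T t u0 \<in> carr Y \<and> nrm Y (v t - T t u0) \<le> C * t powr (1 - \<theta> - \<kappa>)"
    if Y: "smoothing_target K sc E1 A T Y \<theta>" and \<theta>: "\<theta> < 1" and \<tau>: "\<tau> > 0" for Y \<theta> \<tau>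
  proof -
    obtain C where C: "C \<ge> 0" "\<forall>n t. 0 < t \<and> t \<le> \<tau> \<longrightarrow> a n t - T t u0 \<in> carr Y \<and> nrm Y (a n t - T t u0) \<le> C * t powr (1 - \<theta> - \<kappa>)"
      using M.remainder_bound_0[OF Y \<theta> \<tau>] by blast
    have "v t - T t u0 \<in> carr Y \<and> nrm Y (v t - T t u0) \<le> C * t powr (1 - \<theta> - \<kappa>)" if "0 < t" "t \<le> \<tau>" for t
      using limit_in[OF _ Y \<theta>, of 0 t "C * t powr (1 - \<theta> - \<kappa>)"] C(2) that by (simp add: v0 M.u_0)
    then show ?thesis using C(1) by blast
  qed
  show ?thesis
    by (intro exI[of _ v] conjI allI impI) (use v0 v_X g_cont mild bound_0 in auto)
qed

end

section \<open>Regularity of mild solutions\<close>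

text \<open>A linear problem in which g stands for f(s, u(s)). Starting from positive times keeps
  the possible singularity at 0 out of the regularity theory.\<close>

locale mild_solution = analytic_generator K sc E1 A T
  for K :: "complex set" and sc :: "complex \<Rightarrow> 'e::banach \<Rightarrow> 'e"
    and E1 :: "'e nspace" and A :: "'e \<Rightarrow> 'e" and T :: "real \<Rightarrow> 'e \<Rightarrow>\<^sub>L 'e" +
  fixes u g :: "real \<Rightarrow> 'e"
  assumes g_cont: "continuous_on {0<..} g"
    and mild: "\<And>q t. 0 < q \<Longrightarrow> q \<le> t \<Longrightarrow> u t - T (t - q) (u q) = integral {q..t} (\<lambda>s. T (t - s) (g s))"
begin

lemma g_cont': "0 < a \<Longrightarrow> continuous_on {a..b} g"
  by (rule continuous_on_subset[OF g_cont]) auto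

lemma g_isCont: "0 < t \<Longrightarrow> isCont g t"
  using g_cont by (simp add: continuous_on_eq_continuous_at)

lemma g_bounded: "0 < a \<Longrightarrow> \<exists>G\<ge>0. \<forall>s\<in>{a..b}. norm (g s) \<le> G"
proof -
  assume "0 < a"
  then have "bounded (g ` {a..b})"
    by (intro compact_imp_bounded compact_continuous_image g_cont') auto
  then obtain G where "\<forall>s\<in>{a..b}. norm (g s) \<le> G" by (auto simp: bounded_iff)
  then have "\<forall>s\<in>{a..b}. norm (g s) \<le> \<bar>G\<bar>" by force
  then show ?thesis by (intro exI[of _ "\<bar>G\<bar>"]) auto
qed

text \<open>Local boundedness of T separates the variation of r from that of s. It is used for w = g
  and for w = A u, to replace values under an integral by the value at t0.\<close>

lemma near:
  assumes w: "isCont w t0" and e: "e > 0"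
  shows "\<exists>d>0. \<forall>r s. \<bar>r - t0\<bar> < d \<and> 0 \<le> s \<and> s < d \<longrightarrow> norm (T s (w r) - w t0) < e"
proof -
  obtain M where M: "M \<ge> 1" "\<And>t x. t \<le> 1 \<Longrightarrow> norm (T t x) \<le> M * norm x" using T_bound by blast
  have "e / (2 * M) > 0" using e M(1) by simp
  then obtain d1 where d1: "d1 > 0" "\<And>r. \<bar>r - t0\<bar> < d1 \<Longrightarrow> norm (w r - w t0) < e / (2 * M)"
    using w unfolding continuous_at_eps_delta dist_norm by (auto simp: dist_real_def)
  have e2: "e / 2 > 0" using e by simp
  obtain d2 where d2: "d2 > 0" "\<And>s. \<bar>s\<bar> < d2 \<Longrightarrow> norm (T s (w t0) - w t0) < e / 2"
    using T_isCont_0[of "w t0", unfolded continuous_at_eps_delta, rule_format, OF e2]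
    by (auto simp: dist_norm dist_real_def)
  define d where "d = min 1 (min d1 d2)"
  have "norm (T s (w r) - w t0) < e" if "\<bar>r - t0\<bar> < d" "0 \<le> s" "s < d" for r s
  proof -
    have "norm (T s (w r - w t0)) \<le> M * norm (w r - w t0)" using that by (intro M(2)) (simp add: d_def)
    also have "\<dots> < M * (e / (2 * M))"
      using M(1) d1(2)[of r] that by (intro mult_strict_left_mono) (auto simp: d_def)
    also have "\<dots> = e / 2" using M(1) by simp
    finally have 1: "norm (T s (w r - w t0)) < e / 2" .
    have eq: "T s (w r) - w t0 = T s (w r - w t0) + (T s (w t0) - w t0)" by (simp add: blinfun.diff_right)
    have "norm (T s (w r) - w t0) \<le> norm (T s (w r - w t0)) + norm (T s (w t0) - w t0)"
      unfolding eq by (rule norm_triangle_ineq)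
    then show ?thesis using 1 d2(2)[of s] that by (simp add: d_def)
  qed
  moreover have "d > 0" using d1(1) d2(1) by (simp add: d_def)
  ultimately show ?thesis by blast
qed

lemma strong_solution:
  assumes dini: "\<And>a b. 0 < a \<Longrightarrow> a < b \<Longrightarrow> \<exists>C\<ge>0. \<exists>\<delta>>0. \<forall>s t. a \<le> s \<and> s < t \<and> t \<le> b \<longrightarrow>
      nrm E1 (T (t - s) (g s - g t)) \<le> C * (t - s) powr (\<delta> - 1)"
    and t0: "t0 > 0"
  shows "u t0 \<in> carr E1" "((\<lambda>s. nrm E1 (u s - u t0)) \<longlongrightarrow> 0) (at t0)"
    "isCont (\<lambda>t. A (u t)) t0" "(u has_vector_derivative (A (u t0) + g t0)) (at t0)"
proof -
  interpret E: smoothing_target K sc E1 A T E1 1 by (rule smoothing_target_E1)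
  obtain C1 where C1: "C1 \<ge> 0" "\<And>x. x \<in> carr E1 \<Longrightarrow> nrm E1 x \<le> C1 * (norm x + norm (A x))"
    "\<And>x. x \<in> carr E1 \<Longrightarrow> norm (A x) \<le> C1 * nrm E1 x" "\<And>x. x \<in> carr E1 \<Longrightarrow> norm x \<le> C1 * nrm E1 x"
    by (rule E1_graph_norm) (rule that)
  have R: "\<exists>C\<ge>0. \<exists>\<delta>>0. \<exists>M\<ge>0. \<forall>q t. a \<le> q \<and> q < t \<and> t \<le> b \<longrightarrow> u t - T (t - q) (u q) \<in> carr E1 \<and>
      nrm E1 (u t - T (t - q) (u q)) \<le> C * (t - q) powr \<delta> + C1 * (M * (t - q) + norm (T (t - q) (g t) - g t))"
    if ab: "0 < a" "a < b" for a b
  proof -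
    obtain C \<delta> where C: "C \<ge> 0" "\<delta> > 0" "\<forall>s t. a \<le> s \<and> s < t \<and> t \<le> b \<longrightarrow>
      nrm E1 (T (t - s) (g s - g t)) \<le> C * (t - s) powr (\<delta> - 1)" using dini[OF ab] by blast
    obtain G where G: "G \<ge> 0" "\<forall>s\<in>{a..b}. norm (g s) \<le> G" using g_bounded[OF ab(1)] by blast
    obtain M where M: "M \<ge> 1" "\<And>t x. t \<le> b \<Longrightarrow> norm (T t x) \<le> M * norm x" using T_bound by blast
    have "u t - T (t - q) (u q) \<in> carr E1 \<and>
      nrm E1 (u t - T (t - q) (u q)) \<le> (C / \<delta>) * (t - q) powr \<delta> + C1 * ((M * G) * (t - q) + norm (T (t - q) (g t) - g t))"
      if qt: "a \<le> q" "q < t" "t \<le> b" for q t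
    proof -
      have q: "0 < q" "q \<le> t" using ab qt by auto
      have gc: "continuous_on {q..t} g" using g_cont'[OF q(1)] .
      have 1: "integral {q..t} (\<lambda>s. T (t - s) (g s - g t)) \<in> carr E1 \<and>
          nrm E1 (integral {q..t} (\<lambda>s. T (t - s) (g s - g t))) \<le> C * ((t - q) powr (1 - (1 - \<delta>)) / (1 - (1 - \<delta>)))"
      proof (rule E.convolution_in)
        show "continuous_on {q..t} (\<lambda>s. g s - g t)" by (intro continuous_intros gc)
        show "((\<lambda>s. C * (t - s) powr (- (1 - \<delta>))) has_integral C * ((t - q) powr (1 - (1 - \<delta>)) / (1 - (1 - \<delta>)))) {q..t}"
          by (intro has_integral_mult_right has_integral_powr_reflected) (use C(2) q in auto)
        fix s assume s: "s \<in> {q<..<t}"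
        then show "nrm E1 (T (t - s) (g s - g t)) \<le> C * (t - s) powr (- (1 - \<delta>))"
          using C(3)[rule_format, of s t] qt by simp
      qed (use q in auto)
      define J where "J = integral {0..t - q} (\<lambda>s. T s (g t))"
      have J: "J \<in> carr E1" "A J = T (t - q) (g t) - g t"
        unfolding J_def using integral_T_E1[of "t - q" "g t"] q by auto
      have "((\<lambda>s. T s (g t)) has_integral J) {0..t - q}"
        unfolding J_def by (intro integrable_integral integrable_continuous_interval continuous_intros)
      then have "((\<lambda>s. T (- s) (g t)) has_integral J) {- (t - q)..- 0}"
        by (subst has_integral_reflect_real)
      from has_integral_shift_real_ivl[OF this, of "- t"]
      have J_eq: "((\<lambda>s. T (t - s) (g t)) has_integral J) {q..t}" by simp
      have "norm J \<le> (M * G) * (t - q - 0)"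
        unfolding J_def
      proof (rule integral_bound)
        show "continuous_on {0..t - q} (\<lambda>s. T s (g t))" by (intro continuous_intros)
        fix s assume s: "s \<in> {0..t - q}"
        have "norm (T s (g t)) \<le> M * norm (g t)" using s qt ab by (intro M(2)) auto
        also have "\<dots> \<le> M * G" using G(2) qt M(1) by (intro mult_left_mono) auto
        finally show "norm (T s (g t)) \<le> M * G" .
      qed (use q in simp)
      then have "norm J + norm (A J) \<le> (M * G) * (t - q) + norm (T (t - q) (g t) - g t)" using J(2) by simp
      then have "C1 * (norm J + norm (A J)) \<le> C1 * ((M * G) * (t - q) + norm (T (t - q) (g t) - g t))"
        using C1(1) by (rule mult_left_mono)
      then have nJ: "nrm E1 J \<le> C1 * ((M * G) * (t - q) + norm (T (t - q) (g t) - g t))"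
        using C1(2)[OF J(1)] by simp
      have "integral {q..t} (\<lambda>s. T (t - s) (g s)) = integral {q..t} (\<lambda>s. T (t - s) (g s - g t) + T (t - s) (g t))"
        by (simp add: blinfun.diff_right)
      also have "\<dots> = integral {q..t} (\<lambda>s. T (t - s) (g s - g t)) + integral {q..t} (\<lambda>s. T (t - s) (g t))"
        by (rule Henstock_Kurzweil_Integration.integral_add) (intro integrable_continuous_interval continuous_intros gc)+
      also have "integral {q..t} (\<lambda>s. T (t - s) (g t)) = J" by (rule integral_unique[OF J_eq])
      finally have "u t - T (t - q) (u q) = integral {q..t} (\<lambda>s. T (t - s) (g s - g t)) + J"
        using mild[OF q] by simp
      then show ?thesis
        using E1.nrm_triangle[OF conjunct1[OF 1] J(1)] E1.carr_add[OF conjunct1[OF 1] J(1)] conjunct2[OF 1] nJ by simp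
    qed
    moreover have "C / \<delta> \<ge> 0" "M * G \<ge> 0" using C M(1) G(1) by auto
    ultimately show ?thesis using C(2) by blast
  qed
  have R_in: "u t - T (t - q) (u q) \<in> carr E1" if "0 < q" "q < t" for q t
    using R[OF that] that by auto
  have small: "\<exists>d>0. \<forall>q s. 0 < q \<and> t - d < q \<and> q < s \<and> s < t + d \<longrightarrow> nrm E1 (u s - T (s - q) (u q)) < e"
    if t: "t > 0" and e: "e > 0" for t e
  proof -
    obtain C \<delta> M where C: "C \<ge> 0" "\<delta> > 0" "M \<ge> 0" "\<forall>q s. t/2 \<le> q \<and> q < s \<and> s \<le> 2 * t \<longrightarrow>
      nrm E1 (u s - T (s - q) (u q)) \<le> C * (s - q) powr \<delta> + C1 * (M * (s - q) + norm (T (s - q) (g s) - g s))"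
      using R[of "t/2" "2 * t"] t by auto
    obtain d1 where d1: "d1 > 0" "\<And>x. 0 \<le> x \<Longrightarrow> x \<le> d1 \<Longrightarrow> C * x powr \<delta> \<le> e / 4"
      using small_powr[OF C(1), of "e / 4" \<delta>] e C(2) by auto
    obtain d2 where d2: "d2 > 0" "\<And>x. 0 \<le> x \<Longrightarrow> x \<le> d2 \<Longrightarrow> (C1 * M) * x powr 1 \<le> e / 4"
      using small_powr[of "C1 * M" "e / 4" 1] e C1(1) C(3) by auto
    define c1 where "c1 = C1 + 1"
    have c1: "c1 > 0" "C1 \<le> c1" using C1(1) by (auto simp: c1_def)
    \<comment> \<open>Both T (s - q) (g s) and g s are within c of g t, so they differ by at most
      2c, and c1 * 2c = e/4. Adding 1 in c1 avoids division by a possibly vanishing C1.\<close>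
    define c where "c = e / 4 / c1 / 2"
    have c: "c > 0" using e c1(1) by (simp add: c_def)
    obtain d3 where d3: "d3 > 0" "\<forall>r s. \<bar>r - t\<bar> < d3 \<and> 0 \<le> s \<and> s < d3 \<longrightarrow> norm (T s (g r) - g t) < c"
      using near[OF g_isCont[OF t] c] by blast
    define d where "d = min (t/2) (min (d1/2) (min (d2/2) (d3/2)))"
    have d: "d \<le> t/2" "2 * d \<le> d1" "2 * d \<le> d2" "2 * d \<le> d3" by (auto simp: d_def min_def)
    have d0: "d > 0" using t d1(1) d2(1) d3(1) by (simp add: d_def)
    have "nrm E1 (u s - T (s - q) (u q)) < e" if qs: "0 < q" "t - d < q" "q < s" "s < t + d" for q s
    proof -
      have b: "t/2 \<le> q" "s \<le> 2 * t" "s - q < 2 * d" "\<bar>s - t\<bar> < d3" "0 \<le> s - q" using qs d t d0 by auto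
      have "norm (T (s - q) (g s) - g t) < c" "norm (T 0 (g s) - g t) < c"
        using d3(2)[rule_format, of s "s - q"] d3(2)[rule_format, of s 0] b d d3(1) by auto
      then have "norm (T (s - q) (g s) - g s) \<le> 2 * c"
        using norm_triangle_ineq4[of "T (s - q) (g s) - g t" "g s - g t"] by simp
      then have "C1 * norm (T (s - q) (g s) - g s) \<le> c1 * (2 * c)"
        using c1 by (intro mult_mono) auto
      also have "2 * c = e / 4 / c1" by (simp add: c_def)
      also have "c1 * (e / 4 / c1) = e / 4" using c1(1) by simp
      finally have 3: "C1 * norm (T (s - q) (g s) - g s) \<le> e / 4" .
      have 1: "C * (s - q) powr \<delta> \<le> e / 4" using d1(2)[of "s - q"] b d by simp
      have 2: "C1 * (M * (s - q)) \<le> e / 4" using d2(2)[of "s - q"] b d by (simp add: mult.assoc)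
      have "nrm E1 (u s - T (s - q) (u q)) \<le> C * (s - q) powr \<delta> + C1 * (M * (s - q) + norm (T (s - q) (g s) - g s))"
        using C(4) b qs by blast
      then show ?thesis using 1 2 3 e unfolding distrib_left by linarith
    qed
    then show ?thesis using d0 by blast
  qed
  have u_E1: "u t \<in> carr E1" "((\<lambda>s. nrm E1 (u s - u t)) \<longlongrightarrow> 0) (at t)" if t: "t > 0" for t
    by (rule E.mild_tendsto[OF R_in small[OF t] t]; assumption)+
  show "u t0 \<in> carr E1" "((\<lambda>s. nrm E1 (u s - u t0)) \<longlongrightarrow> 0) (at t0)" using u_E1[OF t0] by auto
  show Au: "isCont (\<lambda>t. A (u t)) t0"
  proof -
    have "((\<lambda>s. A (u s) - A (u t0)) \<longlongrightarrow> 0) (at t0)"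
    proof (rule Lim_null_comparison)
      show "((\<lambda>s. C1 * nrm E1 (u s - u t0)) \<longlongrightarrow> 0) (at t0)"
        by (rule tendsto_mult_right_zero[OF u_E1(2)[OF t0]])
      have "\<forall>\<^sub>F s in at t0. 0 < s" using order_tendstoD(1)[OF tendsto_ident_at t0] .
      then show "\<forall>\<^sub>F s in at t0. norm (A (u s) - A (u t0)) \<le> C1 * nrm E1 (u s - u t0)"
      proof eventually_elim
        case (elim s)
        have "u s - u t0 \<in> carr E1" using u_E1(1) elim t0 by blast
        then show ?case using C1(3)[of "u s - u t0"] A_diff[OF u_E1(1)[OF elim] u_E1(1)[OF t0]] by simp
      qed
    qed
    then show ?thesis by (simp add: isCont_def LIM_zero_iff)
  qed
  define D where "D = A (u t0) + g t0"
  \<comment> \<open>Stated for arbitrary q \<le> t near t0, so that q = t0 yields the right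
    derivative and t = t0 the left one.\<close>
  have quot: "\<exists>d>0. \<forall>q t. 0 < q \<and> t0 - d < q \<and> q \<le> t \<and> t < t0 + d \<longrightarrow> norm (u t - u q - (t - q) *\<^sub>R D) \<le> e * (t - q)"
    if e: "e > 0" for e
  proof -
    obtain d1 where d1: "d1 > 0" "\<forall>r s. \<bar>r - t0\<bar> < d1 \<and> 0 \<le> s \<and> s < d1 \<longrightarrow> norm (T s (A (u r)) - A (u t0)) < e / 2"
      using near[OF Au, of "e / 2"] e by auto
    obtain d2 where d2: "d2 > 0" "\<forall>r s. \<bar>r - t0\<bar> < d2 \<and> 0 \<le> s \<and> s < d2 \<longrightarrow> norm (T s (g r) - g t0) < e / 2"
      using near[OF g_isCont[OF t0], of "e / 2"] e by auto
    define d where "d = min d1 d2 / 2"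
    have d: "2 * d \<le> d1" "2 * d \<le> d2" "d > 0" using d1(1) d2(1) by (auto simp: d_def)
    have "norm (u t - u q - (t - q) *\<^sub>R D) \<le> e * (t - q)" if qt: "0 < q" "t0 - d < q" "q \<le> t" "t < t0 + d" for q t
    proof -
      have uq: "u q \<in> carr E1" using u_E1(1)[OF qt(1)] .
      have I1: "((\<lambda>s. T s (A (u q)) - A (u t0)) has_integral (T (t - q) (u q) - T 0 (u q)) - (t - q - 0) *\<^sub>R A (u t0)) {0..t - q}"
        by (intro has_integral_diff T_diff_integral_E1 uq has_integral_const_real[of "A (u t0)" 0 "t - q", simplified, THEN has_integral_eq_rhs]) (use qt in auto)
      have I2: "((\<lambda>s. T (t - s) (g s) - g t0) has_integral (u t - T (t - q) (u q)) - (t - q) *\<^sub>R g t0) {q..t}"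
      proof (rule has_integral_diff)
        show "((\<lambda>s. T (t - s) (g s)) has_integral u t - T (t - q) (u q)) {q..t}"
          unfolding mild[OF qt(1,3)]
          by (intro integrable_integral integrable_continuous_interval continuous_intros g_cont' qt)
        show "((\<lambda>s. g t0) has_integral (t - q) *\<^sub>R g t0) {q..t}"
          using has_integral_const_real[of "g t0" q t] qt by simp
      qed
      have n1: "norm ((T (t - q) (u q) - T 0 (u q)) - (t - q - 0) *\<^sub>R A (u t0)) \<le> e / 2 * measure lborel {0..t - q}"
      proof (rule has_integral_bound_real[OF _ _ I1, of _ "{}"])
        fix s assume "s \<in> {0..t - q} - {}"
        then show "norm (T s (A (u q)) - A (u t0)) \<le> e / 2"
          using d1(2)[rule_format, of q s] qt d by fastforce
      qed (use e in auto)
      have n2: "norm ((u t - T (t - q) (u q)) - (t - q) *\<^sub>R g t0) \<le> e / 2 * measure lborel {q..t}"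
      proof (rule has_integral_bound_real[OF _ _ I2, of _ "{}"])
        fix s assume "s \<in> {q..t} - {}"
        then show "norm (T (t - s) (g s) - g t0) \<le> e / 2"
          using d2(2)[rule_format, of s "t - s"] qt d by fastforce
      qed (use e in auto)
      have eq: "u t - u q - (t - q) *\<^sub>R D = ((T (t - q) (u q) - T 0 (u q)) - (t - q - 0) *\<^sub>R A (u t0)) + ((u t - T (t - q) (u q)) - (t - q) *\<^sub>R g t0)"
        by (simp add: D_def scaleR_add_right)
      have "norm (u t - u q - (t - q) *\<^sub>R D) \<le> e / 2 * (t - q) + e / 2 * (t - q)"
        unfolding eq by (rule norm_triangle_le, rule add_mono) (use n1 n2 qt in auto)
      then show ?thesis by simp
    qed
    then show ?thesis using d(3) by blast
  qed
  show "(u has_vector_derivative (A (u t0) + g t0)) (at t0)"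
    unfolding has_vector_derivative_def has_derivative_at_alt
  proof (intro conjI allI impI)
    show "bounded_linear (\<lambda>x. x *\<^sub>R (A (u t0) + g t0))" by (rule bounded_linear_scaleR_left)
    fix e :: real assume "e > 0"
    then obtain d where d: "d > 0" "\<forall>q t. 0 < q \<and> t0 - d < q \<and> q \<le> t \<and> t < t0 + d \<longrightarrow> norm (u t - u q - (t - q) *\<^sub>R D) \<le> e * (t - q)"
      using quot by blast
    have "norm (u y - u t0 - (y - t0) *\<^sub>R (A (u t0) + g t0)) \<le> e * norm (y - t0)" if y: "norm (y - t0) < min d t0" for y
    proof (cases "t0 \<le> y")
      case True
      then show ?thesis using d(2)[rule_format, of t0 y] y t0 d(1) by (simp add: D_def)
    next
      case False
      have "u y - u t0 - (y - t0) *\<^sub>R D = - (u t0 - u y - (t0 - y) *\<^sub>R D)"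
        by (simp add: algebra_simps)
      then have "norm (u y - u t0 - (y - t0) *\<^sub>R D) = norm (u t0 - u y - (t0 - y) *\<^sub>R D)"
        by (simp only: norm_minus_cancel)
      also have "\<dots> \<le> e * (t0 - y)" using d(2)[rule_format, of y t0] y False t0 d(1) by simp
      finally show ?thesis using False by (simp add: D_def)
    qed
    then show "\<exists>d>0. \<forall>y. norm (y - t0) < d \<longrightarrow> norm (u y - u t0 - (y - t0) *\<^sub>R (A (u t0) + g t0)) \<le> e * norm (y - t0)"
      using d(1) t0 by (intro exI[of _ "min d t0"]) auto
  qed
qed

end

section \<open>Hoelder continuity in time of mild solutions\<close>

context analytic_generator
begin

text \<open>For h \<le> \<sigma> the increment is an integral of A T and hence O(h/\<sigma>), which
  is at most (h/\<sigma>)^\<delta> up to constants; for h > \<sigma> boundedness suffices because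
  (h/\<sigma>)^\<delta> \<ge> 1.\<close>

lemma T_increment_bound:
  assumes \<tau>: "\<tau> > 0" and \<delta>: "0 < \<delta>" "\<delta> < 1"
  shows "\<exists>C\<ge>0. \<forall>h \<sigma> y. 0 < h \<and> h \<le> \<tau> \<and> 0 < \<sigma> \<and> \<sigma> \<le> \<tau> \<longrightarrow> norm (T h (T \<sigma> y) - T \<sigma> y) \<le> C * h powr \<delta> * \<sigma> powr (- \<delta>) * norm y"
proof -
  obtain M where M: "M \<ge> 1" "\<And>t x. t \<le> \<tau> \<Longrightarrow> norm (T t x) \<le> M * norm x" using T_bound by blast
  obtain B where B: "B \<ge> 0" "\<And>t x. 0 < t \<Longrightarrow> t \<le> \<tau> \<Longrightarrow> norm (A (T t x)) \<le> B * t powr -1 * norm x"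
    by (rule AT_bound[OF \<tau>]) (rule that)
  define C where "C = (M + 1) * M + M * B"
  have C: "C \<ge> 0" using M(1) B(1) by (simp add: C_def)
  have "norm (T h (T \<sigma> y) - T \<sigma> y) \<le> C * h powr \<delta> * \<sigma> powr (- \<delta>) * norm y"
    if h: "0 < h" "h \<le> \<tau>" and \<sigma>: "0 < \<sigma>" "\<sigma> \<le> \<tau>" for h \<sigma> y
  proof -
    have ratio: "h powr \<delta> * \<sigma> powr (- \<delta>) = (h / \<sigma>) powr \<delta>"
      using powr_divide[of h \<sigma> \<delta>] by (simp add: powr_minus divide_inverse)
    show ?thesis
    proof (cases "h \<le> \<sigma>")
      case True
      have "norm (T h (T \<sigma> y) - T 0 (T \<sigma> y)) \<le> (M * (B * \<sigma> powr -1 * norm y)) * measure lborel {0..h}"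
      proof (rule has_integral_bound_real[OF _ _ T_diff_integral_E1[OF T_smooth[OF \<sigma>(1)]], of _ "{}"])
        fix s assume "s \<in> {0..h} - {}"
        then have "norm (T s (A (T \<sigma> y))) \<le> M * norm (A (T \<sigma> y))" using h by (intro M(2)) auto
        also have "\<dots> \<le> M * (B * \<sigma> powr -1 * norm y)" using B(2)[OF \<sigma>] M(1) by (intro mult_left_mono) auto
        finally show "norm (T s (A (T \<sigma> y))) \<le> M * (B * \<sigma> powr -1 * norm y)" .
      qed (use M(1) B(1) h in auto)
      also have "\<dots> = (M * B) * (h / \<sigma>) * norm y"
        using h \<sigma> by (simp add: powr_minus divide_inverse)
      also have "\<dots> \<le> C * (h / \<sigma>) powr \<delta> * norm y"
      proof (intro mult_right_mono mult_mono)
        have "(h / \<sigma>) powr 1 \<le> (h / \<sigma>) powr \<delta>" using True h \<sigma> \<delta> by (intro powr_mono') auto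
        then show "h / \<sigma> \<le> (h / \<sigma>) powr \<delta>" using h \<sigma> by simp
      qed (use M(1) B(1) h \<sigma> C in \<open>auto simp: C_def\<close>)
      finally show ?thesis by (simp only: T_zero mult.assoc ratio[symmetric])
    next
      case False
      have "norm (T h (T \<sigma> y) - T \<sigma> y) \<le> M * norm (T \<sigma> y) + norm (T \<sigma> y)"
        using norm_triangle_ineq4[of "T h (T \<sigma> y)" "T \<sigma> y"] M(2)[OF h(2), of "T \<sigma> y"] by linarith
      also have "\<dots> = (M + 1) * norm (T \<sigma> y)" by (simp add: distrib_right)
      also have "\<dots> \<le> (M + 1) * (M * norm y)" using M(1) M(2)[OF \<sigma>(2)] by (intro mult_left_mono) auto
      also have "\<dots> = ((M + 1) * M) * 1 * norm y" by simp
      also have "\<dots> \<le> C * (h / \<sigma>) powr \<delta> * norm y"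
      proof (intro mult_right_mono mult_mono)
        show "1 \<le> (h / \<sigma>) powr \<delta>" using False h \<sigma> \<delta> by (intro ge_one_powr_ge_zero) auto
      qed (use M(1) B(1) C in \<open>auto simp: C_def\<close>)
      finally show ?thesis by (simp only: mult.assoc ratio[symmetric])
    qed
  qed
  then show ?thesis using C by (intro exI[of _ C]) simp
qed

end

lemma (in smoothing_target) T_increment_bound_into:
  assumes \<tau>: "\<tau> > 0" and \<delta>: "0 < \<delta>" "\<delta> < 1"
  shows "\<exists>C\<ge>0. \<forall>h \<sigma> y. 0 < h \<and> h \<le> \<tau> \<and> 0 < \<sigma> \<and> \<sigma> \<le> \<tau> \<longrightarrow>
    nrm X (T h (T \<sigma> y) - T \<sigma> y) \<le> C * h powr \<delta> * \<sigma> powr (- (\<theta> + \<delta>)) * norm y"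
proof -
  obtain C where C: "C \<ge> 0" "\<forall>h \<sigma> y. 0 < h \<and> h \<le> \<tau> \<and> 0 < \<sigma> \<and> \<sigma> \<le> \<tau> \<longrightarrow> norm (T h (T \<sigma> y) - T \<sigma> y) \<le> C * h powr \<delta> * \<sigma> powr (- \<delta>) * norm y"
    using T_increment_bound[OF \<tau> \<delta>] by blast
  obtain B where B: "B \<ge> 0" "\<And>t x. 0 < t \<Longrightarrow> t \<le> \<tau> \<Longrightarrow> nrm X (T t x) \<le> B * t powr (- \<theta>) * norm x"
    using smooth_bound[where \<tau> = \<tau>] by blast
  have "nrm X (T h (T \<sigma> y) - T \<sigma> y) \<le> (B * C * 2 powr (\<theta> + \<delta>)) * h powr \<delta> * \<sigma> powr (- (\<theta> + \<delta>)) * norm y"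
    if h: "0 < h" "h \<le> \<tau>" and \<sigma>: "0 < \<sigma>" "\<sigma> \<le> \<tau>" for h \<sigma> y
  proof -
    have "T h (T \<sigma> y) - T \<sigma> y = T (\<sigma>/2) (T h (T (\<sigma>/2) y) - T (\<sigma>/2) y)"
      using T_add[of "\<sigma>/2" "\<sigma>/2" y] T_commute[of h "\<sigma>/2" "T (\<sigma>/2) y"] h \<sigma> by (simp add: blinfun.diff_right)
    then have "nrm X (T h (T \<sigma> y) - T \<sigma> y) \<le> B * (\<sigma>/2) powr (- \<theta>) * norm (T h (T (\<sigma>/2) y) - T (\<sigma>/2) y)"
      using B(2)[of "\<sigma>/2"] \<sigma> by simp
    also have "\<dots> \<le> B * (\<sigma>/2) powr (- \<theta>) * (C * h powr \<delta> * (\<sigma>/2) powr (- \<delta>) * norm y)"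
      using C(2)[rule_format, of h "\<sigma>/2" y] h \<sigma> B(1) by (intro mult_left_mono) auto
    also have "\<dots> = B * C * h powr \<delta> * ((\<sigma>/2) powr (- \<theta>) * (\<sigma>/2) powr (- \<delta>)) * norm y"
      by (simp add: mult_ac)
    also have "(\<sigma>/2) powr (- \<theta>) * (\<sigma>/2) powr (- \<delta>) = (\<sigma>/2) powr (- (\<theta> + \<delta>))"
    proof -
      have "- \<theta> + - \<delta> = - (\<theta> + \<delta>)" by simp
      then show ?thesis by (simp only: powr_add[symmetric])
    qed
    also have "\<dots> = 2 powr (\<theta> + \<delta>) * \<sigma> powr (- (\<theta> + \<delta>))" using \<sigma>(1) by (rule powr_half)
    finally show ?thesis by (simp only: mult_ac)
  qed
  then show ?thesis using B(1) C(1) by (intro exI[of _ "B * C * 2 powr (\<theta> + \<delta>)"]) simp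
qed

text \<open>With h = t - s, the difference is (u t - T h (u s)) + (T h (u s) - u s). The first part
  is O(h^(1 - \<xi>)). In the second, \<open>T_increment_bound_into\<close> gains h^\<delta> and
  raises the kernel exponent to \<xi> + \<delta>; for \<delta> = (1 - \<xi>)/2 this is below 1,
  hence integrable.\<close>

lemma (in mild_solution) holder:
  assumes X: "smoothing_target K sc E1 A T X \<xi>" and \<xi>: "\<xi> < 1" and ab: "0 < a" "a < b"
  shows "\<exists>H\<ge>0. \<forall>s t. a \<le> s \<and> s < t \<and> t \<le> b \<longrightarrow> nrm X (u t - u s) \<le> H * (t - s) powr ((1 - \<xi>) / 2)"
proof -
  interpret X: smoothing_target K sc E1 A T X \<xi> by (rule X)
  define \<delta> where "\<delta> = (1 - \<xi>) / 2"
  have \<delta>: "0 < \<delta>" "\<delta> < 1" "\<xi> + \<delta> < 1" "1 - \<xi> = \<delta> + \<delta>" using \<xi> X.\<theta>_nonneg by (auto simp: \<delta>_def field_simps)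
  \<comment> \<open>An auxiliary initial time: for s \<ge> a the distance s - q is at least q, so
    the free part T (s - q) (u q) is estimated away from its singularity.\<close>
  define q where "q = a / 2"
  have q: "0 < q" "q < a" "q < b" using ab by (auto simp: q_def)
  have b: "b > 0" using ab by simp
  obtain C where C: "C \<ge> 0" "\<forall>h \<sigma> y. 0 < h \<and> h \<le> b \<and> 0 < \<sigma> \<and> \<sigma> \<le> b \<longrightarrow>
    nrm X (T h (T \<sigma> y) - T \<sigma> y) \<le> C * h powr \<delta> * \<sigma> powr (- (\<xi> + \<delta>)) * norm y"
    using X.T_increment_bound_into[OF b \<delta>(1,2)] by blast
  obtain B where B: "B \<ge> 0" "\<And>t x. 0 < t \<Longrightarrow> t \<le> b \<Longrightarrow> nrm X (T t x) \<le> B * t powr (- \<xi>) * norm x"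
    using X.smooth_bound[where \<tau> = b] by blast
  obtain G where G: "G \<ge> 0" "\<forall>s\<in>{q..b}. norm (g s) \<le> G" using g_bounded[OF q(1)] by blast
  define H where "H = B * G / (1 - \<xi>) * b powr \<delta> + (C * q powr (- (\<xi> + \<delta>)) * norm (u q) + C * G * (b powr (1 - (\<xi> + \<delta>)) / (1 - (\<xi> + \<delta>))))"
  have H: "H \<ge> 0" using B(1) G(1) C(1) \<xi> \<delta> by (simp add: H_def)
  have "nrm X (u t - u s) \<le> H * (t - s) powr \<delta>" if st: "a \<le> s" "s < t" "t \<le> b" for s t
  proof -
    define h where "h = t - s"
    have h: "0 < h" "h \<le> b" using st ab by (auto simp: h_def)
    have s: "0 < s" "q < s" "s \<le> t" "s \<le> b" using st ab q by auto
    have 1: "u t - T (t - s) (u s) \<in> carr X \<and> nrm X (u t - T (t - s) (u s)) \<le> B * G * ((t - s) powr (1 - \<xi>) / (1 - \<xi>))"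
      unfolding mild[OF s(1,3)]
    proof (rule X.convolution_in[OF g_cont'[OF s(1)] s(3)])
      show "((\<lambda>r. B * G * (t - r) powr (- \<xi>)) has_integral B * G * ((t - s) powr (1 - \<xi>) / (1 - \<xi>))) {s..t}"
        by (intro has_integral_mult_right has_integral_powr_reflected \<xi> s)
      fix r assume r: "r \<in> {s<..<t}"
      have "nrm X (T (t - r) (g r)) \<le> B * (t - r) powr (- \<xi>) * norm (g r)" using r s st ab by (intro B(2)) auto
      also have "\<dots> \<le> B * (t - r) powr (- \<xi>) * G" using G(2) r s st B(1) by (intro mult_left_mono) auto
      finally show "nrm X (T (t - r) (g r)) \<le> B * G * (t - r) powr (- \<xi>)" by (simp add: mult_ac)
    qed
    have gc: "continuous_on {q..s} g" by (rule g_cont'[OF q(1)])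
    have 2: "integral {q..s} (\<lambda>r. T (s - r) (T h (g r) - g r)) \<in> carr X \<and>
        nrm X (integral {q..s} (\<lambda>r. T (s - r) (T h (g r) - g r))) \<le> (C * h powr \<delta> * G) * ((s - q) powr (1 - (\<xi> + \<delta>)) / (1 - (\<xi> + \<delta>)))"
    proof (rule X.convolution_in)
      show "continuous_on {q..s} (\<lambda>r. T h (g r) - g r)" by (intro continuous_intros gc)
      show "((\<lambda>r. (C * h powr \<delta> * G) * (s - r) powr (- (\<xi> + \<delta>))) has_integral (C * h powr \<delta> * G) * ((s - q) powr (1 - (\<xi> + \<delta>)) / (1 - (\<xi> + \<delta>)))) {q..s}"
        by (intro has_integral_mult_right has_integral_powr_reflected \<delta>) (use s in auto)
      fix r assume r: "r \<in> {q<..<s}"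
      have "T (s - r) (T h (g r) - g r) = T h (T (s - r) (g r)) - T (s - r) (g r)"
        using T_commute[of "s - r" h "g r"] r h by (simp add: blinfun.diff_right)
      then have "nrm X (T (s - r) (T h (g r) - g r)) \<le> C * h powr \<delta> * (s - r) powr (- (\<xi> + \<delta>)) * norm (g r)"
        using C(2)[rule_format, of h "s - r" "g r"] r s h q by simp
      also have "\<dots> \<le> C * h powr \<delta> * (s - r) powr (- (\<xi> + \<delta>)) * G"
        using G(2) r s C(1) by (intro mult_left_mono) auto
      finally show "nrm X (T (s - r) (T h (g r) - g r)) \<le> (C * h powr \<delta> * G) * (s - r) powr (- (\<xi> + \<delta>))"
        by (simp add: mult_ac)
    qed (use s in simp)
    have "u s = T (s - q) (u q) + integral {q..s} (\<lambda>r. T (s - r) (g r))"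
      using mild[OF q(1), of s] s by (simp add: algebra_simps)
    moreover have "T h (integral {q..s} (\<lambda>r. T (s - r) (g r))) - integral {q..s} (\<lambda>r. T (s - r) (g r)) = integral {q..s} (\<lambda>r. T (s - r) (T h (g r) - g r))"
    proof -
      have int: "(\<lambda>r. T (s - r) (g r)) integrable_on {q..s}" "(\<lambda>r. T h (T (s - r) (g r))) integrable_on {q..s}"
        by (intro integrable_continuous_interval continuous_intros gc)+
      have "T h (integral {q..s} (\<lambda>r. T (s - r) (g r))) - integral {q..s} (\<lambda>r. T (s - r) (g r)) = integral {q..s} (\<lambda>r. T h (T (s - r) (g r)) - T (s - r) (g r))"
        unfolding T_integral[OF int(1)] by (rule Henstock_Kurzweil_Integration.integral_diff[symmetric, OF int(2,1)])
      also have "\<dots> = integral {q..s} (\<lambda>r. T (s - r) (T h (g r) - g r))"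
        by (rule integral_cong) (use T_commute[of h] h in \<open>simp add: blinfun.diff_right\<close>)
      finally show ?thesis .
    qed
    ultimately have split: "T h (u s) - u s = (T h (T (s - q) (u q)) - T (s - q) (u q)) + integral {q..s} (\<lambda>r. T (s - r) (T h (g r) - g r))"
      by (simp add: blinfun.add_right algebra_simps)
    have 3: "T h (T (s - q) (u q)) - T (s - q) (u q) \<in> carr X"
      using T_add[of h "s - q" "u q"] X.T_in[of "h + (s - q)" "u q"] X.T_in[of "s - q" "u q"] h s by auto
    have 4: "nrm X (T h (T (s - q) (u q)) - T (s - q) (u q)) \<le> C * h powr \<delta> * q powr (- (\<xi> + \<delta>)) * norm (u q)"
    proof -
      have "nrm X (T h (T (s - q) (u q)) - T (s - q) (u q)) \<le> C * h powr \<delta> * (s - q) powr (- (\<xi> + \<delta>)) * norm (u q)"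
        using C(2)[rule_format, of h "s - q" "u q"] h s q by simp
      also have "\<dots> \<le> C * h powr \<delta> * q powr (- (\<xi> + \<delta>)) * norm (u q)"
        using q st C(1) \<delta> X.\<theta>_nonneg by (intro mult_right_mono mult_left_mono powr_mono2') (auto simp: q_def)
      finally show ?thesis .
    qed
    have "(s - q) powr (1 - (\<xi> + \<delta>)) / (1 - (\<xi> + \<delta>)) \<le> b powr (1 - (\<xi> + \<delta>)) / (1 - (\<xi> + \<delta>))"
      using s q \<delta> by (intro divide_right_mono powr_mono2) auto
    then have "(C * h powr \<delta> * G) * ((s - q) powr (1 - (\<xi> + \<delta>)) / (1 - (\<xi> + \<delta>))) \<le> (C * h powr \<delta> * G) * (b powr (1 - (\<xi> + \<delta>)) / (1 - (\<xi> + \<delta>)))"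
      using C(1) G(1) by (intro mult_left_mono) auto
    then have 5: "nrm X (T h (u s) - u s) \<le> C * h powr \<delta> * q powr (- (\<xi> + \<delta>)) * norm (u q) + (C * h powr \<delta> * G) * (b powr (1 - (\<xi> + \<delta>)) / (1 - (\<xi> + \<delta>)))"
      unfolding split using X.nrm_triangle[OF 3 conjunct1[OF 2]] 4 conjunct2[OF 2] by linarith
    have 6: "T h (u s) - u s \<in> carr X" unfolding split using 3 conjunct1[OF 2] by (rule X.carr_add)
    have "(t - s) powr (1 - \<xi>) = h powr \<delta> * h powr \<delta>" unfolding h_def[symmetric] \<delta>(4) by (rule powr_add)
    also have "\<dots> \<le> h powr \<delta> * b powr \<delta>" using h \<delta> by (intro mult_left_mono powr_mono2) auto
    finally have "B * G / (1 - \<xi>) * (t - s) powr (1 - \<xi>) \<le> B * G / (1 - \<xi>) * (h powr \<delta> * b powr \<delta>)"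
      using B(1) G(1) \<xi> by (intro mult_left_mono) auto
    then have 7: "nrm X (u t - T h (u s)) \<le> B * G / (1 - \<xi>) * (h powr \<delta> * b powr \<delta>)"
      using conjunct2[OF 1] by (simp add: h_def)
    have "u t - u s = (u t - T h (u s)) + (T h (u s) - u s)" by simp
    then have "nrm X (u t - u s) \<le> nrm X (u t - T h (u s)) + nrm X (T h (u s) - u s)"
      using X.nrm_triangle[OF _ 6, of "u t - T h (u s)"] conjunct1[OF 1] by (simp add: h_def)
    also have "\<dots> \<le> H * h powr \<delta>"
      using 5 7 by (simp add: H_def algebra_simps)
    finally show ?thesis by (simp add: h_def)
  qed
  then show ?thesis using H unfolding \<delta>_def by blast
qed

section \<open>Global strong solutions\<close>

lemma bounded_bilinear_scalars:
  assumes "scalar_structure UNIV sc"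
  shows "bounded_bilinear sc"
proof -
  interpret scalars UNIV sc by unfold_locales (rule assms)
  note s = assms[unfolded scalar_structure_def]
  show ?thesis
  proof
    show "sc (a + b) x = sc a x + sc b x" "sc a (x + y) = sc a x + sc a y" for a b x y
      using s by auto
    have mult: "sc (a * b) x = sc a (sc b x)" for a b x using s by auto
    show "sc (r *\<^sub>R a) x = r *\<^sub>R sc a x" for r a x
      using mult[of "of_real r" a x] by (simp add: sc_of_real scaleR_conv_of_real)
    show "sc a (r *\<^sub>R x) = r *\<^sub>R sc a x" for r a x
      using mult[of "of_real r" a x] mult[of a "of_real r" x] by (simp add: sc_of_real mult.commute)
    show "\<exists>k. \<forall>a x. norm (sc a x) \<le> norm a * norm x * k"
      by (intro exI[of _ 1]) (simp add: norm_sc)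
  qed
qed

text \<open>The factor 4 is crude; the parameter k of \<open>cauchy_estimate\<close> accommodates
  it, as the product norm is not homogeneous under complex scalars.\<close>

lemma norm_complexified_scale: "norm (complexified_scale a p) \<le> 4 * cmod a * norm p"
proof -
  have le: "norm (r *\<^sub>R fst p + s *\<^sub>R snd p) \<le> 2 * cmod a * norm p"
    if "\<bar>r\<bar> \<le> cmod a" "\<bar>s\<bar> \<le> cmod a" for r s
  proof -
    have "norm (r *\<^sub>R fst p + s *\<^sub>R snd p) \<le> \<bar>r\<bar> * norm (fst p) + \<bar>s\<bar> * norm (snd p)"
      using norm_triangle_ineq[of "r *\<^sub>R fst p" "s *\<^sub>R snd p"] by simp
    also have "\<dots> \<le> cmod a * norm p + cmod a * norm p"
      using norm_fst_le[of "fst p" "snd p"] norm_snd_le[of "snd p" "fst p"] that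
      by (intro add_mono mult_mono) auto
    finally show ?thesis by simp
  qed
  have "norm (complexified_scale a p)
      \<le> norm (Re a *\<^sub>R fst p + (- Im a) *\<^sub>R snd p) + norm (Im a *\<^sub>R fst p + Re a *\<^sub>R snd p)"
    using norm_Pair_le[of "Re a *\<^sub>R fst p - Im a *\<^sub>R snd p" "Re a *\<^sub>R snd p + Im a *\<^sub>R fst p"]
    by (simp add: complexified_scale_def add.commute)
  also have "\<dots> \<le> 2 * cmod a * norm p + 2 * cmod a * norm p"
    by (intro add_mono le) (auto simp: abs_Re_le_cmod abs_Im_le_cmod)
  finally show ?thesis by simp
qed

lemma bounded_bilinear_complexified_scale: "bounded_bilinear complexified_scale"
proof
  show "\<exists>k. \<forall>a p. norm (complexified_scale a p) \<le> norm a * norm p * k"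
    by (rule exI[of _ 4]) (use norm_complexified_scale in \<open>auto simp: algebra_simps\<close>)
qed (auto simp: complexified_scale_def algebra_simps)

text \<open>By the semigroup law the right difference quotient of the orbit at t is the generator's
  quotient at the point T t x. Existence of its limit therefore puts T t x into the domain, and the
  derivative bound is the bound on A (T t x).\<close>

lemma smoothing_of_analytic:
  assumes sc: "scalar_structure K sc" and C0: "C0_semigroup K sc T" and gen: "is_generator T D A"
    and an: "if K = \<real> then analytic_semigroup complexified_scale (\<lambda>t. map_prod (T t) (T t))
      else analytic_semigroup sc (\<lambda>t. blinfun_apply (T t))"
  shows "\<exists>r>0. \<exists>C. \<forall>t\<in>{0<..r}. \<forall>x. T t x \<in> D \<and> norm (A (T t x)) \<le> C / t * norm x"
proof -
  have "\<exists>r>0. \<exists>C. \<forall>t\<in>{0<..r}. \<forall>x. \<exists>y.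
      ((\<lambda>h. (T (t + h) x - T t x) /\<^sub>R h) \<longlongrightarrow> y) (at_right 0) \<and> norm y \<le> C / t * norm x"
  proof (cases "K = \<real>")
    case True
    have "analytic_semigroup complexified_scale (\<lambda>t. map_prod (T t) (T t))" using an True by simp
    from analytic_semigroup_derivative_bound[OF this bounded_bilinear_complexified_scale _ _ norm_complexified_scale]
    obtain r C where r: "r > 0" and C: "\<forall>t\<in>{0<..r}. \<forall>p. \<exists>y.
        ((\<lambda>h. (map_prod (T (t + h)) (T (t + h)) p - map_prod (T t) (T t) p) /\<^sub>R h) \<longlongrightarrow> y) (at_right 0) \<and>
        norm y \<le> C / t * norm p"
      by (auto simp: complexified_scale_def algebra_simps)
    have "\<exists>y. ((\<lambda>h. (T (t + h) x - T t x) /\<^sub>R h) \<longlongrightarrow> y) (at_right 0) \<and> norm y \<le> C / t * norm x"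
      if "t \<in> {0<..r}" for t x
    proof -
      \<comment> \<open>Over the reals the estimate is proved on the complexification; the real
        orbit sits there as (x, 0) and is recovered as the first component.\<close>
      obtain y where y: "((\<lambda>h. (map_prod (T (t + h)) (T (t + h)) (x, 0) - map_prod (T t) (T t) (x, 0)) /\<^sub>R h) \<longlongrightarrow> y) (at_right 0)"
        "norm y \<le> C / t * norm (x, 0 :: 'a)"
        using C \<open>t \<in> {0<..r}\<close> by blast
      have "((\<lambda>h. (T (t + h) x - T t x) /\<^sub>R h) \<longlongrightarrow> fst y) (at_right 0)"
        using tendsto_fst[OF y(1)] by simp
      moreover have "norm (fst y) \<le> C / t * norm x"
        using y(2) norm_fst_le[of "fst y" "snd y"] by (simp add: norm_Pair)
      ultimately show ?thesis by blast
    qed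
    then show ?thesis using r by blast
  next
    case False
    then have K: "K = UNIV" using sc by (auto simp: scalar_structure_def)
    interpret scalars K sc by unfold_locales (rule sc)
    have "analytic_semigroup sc (\<lambda>t. blinfun_apply (T t))" using an False by simp
    then show ?thesis
    proof (rule analytic_semigroup_derivative_bound)
      show "bounded_bilinear sc" using sc K by (auto intro: bounded_bilinear_scalars)
      show "sc (a * b) x = sc a (sc b x)" for a b x using sc K by (auto simp: scalar_structure_def)
      show "norm (sc a x) \<le> 1 * cmod a * norm x" for a x using norm_sc[of a x] K by simp
    qed (auto simp: sc_of_real)
  qed
  then obtain r C where r: "r > 0" and C: "\<forall>t\<in>{0<..r}. \<forall>x. \<exists>y.
      ((\<lambda>h. (T (t + h) x - T t x) /\<^sub>R h) \<longlongrightarrow> y) (at_right 0) \<and> norm y \<le> C / t * norm x" by blast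
  have "T t x \<in> D \<and> norm (A (T t x)) \<le> C / t * norm x" if t: "t \<in> {0<..r}" for t x
  proof -
    obtain y where y: "((\<lambda>h. (T (t + h) x - T t x) /\<^sub>R h) \<longlongrightarrow> y) (at_right 0)" "norm y \<le> C / t * norm x"
      using C t by blast
    have "\<forall>\<^sub>F h in at_right 0. (T (t + h) x - T t x) /\<^sub>R h = (T h (T t x) - T t x) /\<^sub>R h"
      using eventually_at_right_less[of 0]
    proof eventually_elim
      case (elim h)
      then have "T (h + t) = T h o\<^sub>L T t" using C0 t by (auto simp: C0_semigroup_def)
      then show ?case by (simp add: add.commute)
    qed
    then have lim: "((\<lambda>h. (T h (T t x) - T t x) /\<^sub>R h) \<longlongrightarrow> y) (at_right 0)"
      using y(1) by (rule Lim_transform_eventually[rotated])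
    then have D: "T t x \<in> D" using gen by (auto simp: is_generator_def)
    then have "((\<lambda>h. (T h (T t x) - T t x) /\<^sub>R h) \<longlongrightarrow> A (T t x)) (at_right 0)"
      using gen by (auto simp: is_generator_def)
    then have "A (T t x) = y" by (rule tendsto_unique[OF _ _ lim, rotated]) simp
    then show ?thesis using D y(2) by simp
  qed
  then show ?thesis using r by blast
qed

lemma obtain_analytic_generator:
  assumes sc: "scalar_structure K sc" and E1: "banach_subspace K sc E1"
    and "compactly_embedded E1 whole_space" "dense_in E1 whole_space"
    and gen: "generates_analytic_C0_semigroup K sc (carr E1) A"
  obtains T where "analytic_generator K sc E1 A T"
proof -
  obtain S where S: "C0_semigroup K sc S" "is_generator S (carr E1) A"
    and an: "if K = \<real> then analytic_semigroup complexified_scale (\<lambda>t. map_prod (S t) (S t))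
      else analytic_semigroup sc (\<lambda>t. blinfun_apply (S t))"
    using gen unfolding generates_analytic_C0_semigroup_def by blast
  define T where "T t = (if t \<le> 0 then id_blinfun else S t)" for t
  have T: "T t = S t" if "t \<ge> 0" for t
    using that S(1) by (auto simp: T_def C0_semigroup_def)
  have ev: "\<forall>\<^sub>F t in at_right 0. S t = T t"
    using eventually_at_right_less[of "0::real"] by eventually_elim (simp add: T)
  have lim: "((\<lambda>t. G t (S t)) \<longlongrightarrow> y) (at_right 0) \<longleftrightarrow> ((\<lambda>t. G t (T t)) \<longlongrightarrow> y) (at_right 0)"
    for G :: "real \<Rightarrow> ('a \<Rightarrow>\<^sub>L 'a) \<Rightarrow> 'a" and y
    by (rule filterlim_cong[OF refl refl]) (use ev in eventually_elim, simp)
  have "analytic_generator K sc E1 A T"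
  proof
    show "scalar_structure K sc" "banach_subspace K sc E1" "compactly_embedded E1 whole_space" "dense_in E1 whole_space"
      by fact+
    show "C0_semigroup K sc T"
      using S(1) lim[of "\<lambda>_ t. t x" for x] unfolding C0_semigroup_def by (simp add: T)
    show "is_generator T (carr E1) A"
      using S(2) unfolding is_generator_def lim[of "\<lambda>h s. (s x - x) /\<^sub>R h" for x] .
    show "T t = id_blinfun" if "t \<le> 0" for t using that by (simp add: T_def)
    show "\<exists>r>0. \<exists>C. \<forall>t\<in>{0<..r}. \<forall>x. T t x \<in> carr E1 \<and> norm (A (T t x)) \<le> C / t * norm x"
      using smoothing_of_analytic[OF sc S an] by (auto simp: T)
  qed
  then show thesis by (rule that)
qed

section \<open>Strong solutions of the nonlinear problem\<close>

context analytic_generator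
begin

text \<open>Different exponents are the case of \<open>orbit_bound\<close>. Equal exponents mean
  equal spaces, and boundedness of the semigroup on X replaces the logarithm that integration would
  give.\<close>

lemma orbit_in_space:
  assumes X: "interpolation_space K sc E1 A T X \<xi>" and Y: "interpolation_space K sc E1 A T Y \<alpha>"
    and eq: "\<alpha> = \<xi> \<Longrightarrow> Y = X" and x: "x \<in> carr Y" and \<tau>: "\<tau> > 0"
  shows "\<exists>C\<ge>0. \<forall>t. 0 < t \<and> t \<le> \<tau> \<longrightarrow> nrm X (T t x) \<le> C * t powr (- max (\<xi> - \<alpha>) 0)"
proof -
  interpret X: interpolation_space K sc E1 A T X \<xi> by (rule X)
  interpret Y: interpolation_space K sc E1 A T Y \<alpha> by (rule Y)
  show ?thesis
  proof (cases "\<alpha> = \<xi>")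
    case True
    obtain C where "C \<ge> 0" "\<forall>t x. 0 \<le> t \<and> t \<le> \<tau> \<and> x \<in> carr X \<longrightarrow> T t x \<in> carr X \<and> nrm X (T t x) \<le> C * nrm X x"
      using X.T_bounded_X[OF \<tau>] by blast
    then show ?thesis
      using x eq[OF True] True by (intro exI[of _ "C * nrm X x"]) auto
  next
    case False
    show ?thesis by (rule Y.orbit_bound[OF X.smoothing_target_axioms \<tau> x False])
  qed
qed

text \<open>The condition \<open>dini\<close> is demanded of every mild solution continuous in X,
  because the solution to which it is applied is constructed only inside the proof.\<close>

lemma global_solution:
  assumes X: "interpolation_space K sc E1 A T X \<xi>" and Y: "interpolation_space K sc E1 A T Y \<alpha>"
    and eq: "\<alpha> = \<xi> \<Longrightarrow> Y = X" and u0: "u0 \<in> carr Y"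
    and f_cont: "continuous_map (prod_topology (top_of_set {0..}) (ntop X)) euclidean (\<lambda>(t, x). f t x)"
    and growth: "\<And>\<tau>. \<tau> > 0 \<Longrightarrow> \<exists>C\<ge>0. \<forall>t x. 0 \<le> t \<and> t \<le> \<tau> \<and> x \<in> carr X \<longrightarrow> norm (f t x) \<le> C * (1 + nrm X x)"
    and dini: "\<And>u a b. mild_solution K sc E1 A T u (\<lambda>s. f s (u s)) \<Longrightarrow>
      \<forall>t>0. u t \<in> carr X \<and> ((\<lambda>s. nrm X (u s - u t)) \<longlongrightarrow> 0) (at t) \<Longrightarrow> 0 < a \<Longrightarrow> a < b \<Longrightarrow>
      \<exists>C\<ge>0. \<exists>\<delta>>0. \<forall>s t. a \<le> s \<and> s < t \<and> t \<le> b \<longrightarrow>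
        nrm E1 (T (t - s) (f s (u s) - f t (u t))) \<le> C * (t - s) powr (\<delta> - 1)"
  shows "\<exists>u. global_strong_solution E1 Y A f u0 u"
proof -
  interpret X: interpolation_space K sc E1 A T X \<xi> by (rule X)
  interpret Y: interpolation_space K sc E1 A T Y \<alpha> by (rule Y)
  define \<kappa> where "\<kappa> = max (\<xi> - \<alpha>) 0"
  interpret cauchy_problem K sc E1 A T X \<xi> f u0 \<kappa>
  proof
    show "\<exists>C\<ge>0. \<forall>t. 0 < t \<and> t \<le> \<tau> \<longrightarrow> nrm X (T t u0) \<le> C * t powr (- \<kappa>)" if "\<tau> > 0" for \<tau>
      unfolding \<kappa>_def by (rule orbit_in_space[OF X Y eq u0 that])
    show "0 \<le> \<kappa>" "\<kappa> < 1"
      using X.\<theta>_less_1 Y.\<theta>_nonneg by (auto simp: \<kappa>_def)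
  qed (use f_cont growth in auto)
  obtain u where u_0: "u 0 = u0"
    and u_X: "\<forall>t>0. u t \<in> carr X \<and> ((\<lambda>s. nrm X (u s - u t)) \<longlongrightarrow> 0) (at t)"
    and g: "continuous_on {0<..} (\<lambda>s. f s (u s))"
    and mild: "\<forall>q t. 0 < q \<and> q \<le> t \<longrightarrow> u t - T (t - q) (u q) = integral {q..t} (\<lambda>s. T (t - s) (f s (u s)))"
    and initial: "\<forall>Y \<theta> \<tau>. smoothing_target K sc E1 A T Y \<theta> \<and> \<theta> < 1 \<and> \<tau> > 0 \<longrightarrow>
      (\<exists>C\<ge>0. \<forall>t. 0 < t \<and> t \<le> \<tau> \<longrightarrow> u t - T t u0 \<in> carr Y \<and> nrm Y (u t - T t u0) \<le> C * t powr (1 - \<theta> - \<kappa>))"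
    using mild_solution by blast
  have sol: "mild_solution K sc E1 A T u (\<lambda>s. f s (u s))"
    by unfold_locales (use g mild in auto)
  interpret sol: mild_solution K sc E1 A T u "\<lambda>s. f s (u s)" by (rule sol)
  have strong: "u t \<in> carr E1" "((\<lambda>s. nrm E1 (u s - u t)) \<longlongrightarrow> 0) (at t)"
      "isCont (\<lambda>t. A (u t)) t" "(u has_vector_derivative (A (u t) + f t (u t))) (at t)" if "t > 0" for t
    by (rule sol.strong_solution[OF dini[OF sol u_X]], assumption+, rule that)+
  have u_Y: "u t \<in> carr Y" if "t > 0" for t
    using strong(1)[OF that] Y.E1_embed by blast
  show ?thesis
    unfolding global_strong_solution_def
  proof (rule exI[of _ u], intro conjI)
    show "\<exists>u'. continuous_on {0<..} u' \<and>
        (\<forall>t>0. (u has_vector_derivative u' t) (at t) \<and> u' t = A (u t) + f t (u t))"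
    proof (intro exI[of _ "\<lambda>t. A (u t) + f t (u t)"] conjI allI impI refl)
      show "continuous_on {0<..} (\<lambda>t. A (u t) + f t (u t))"
        by (intro continuous_on_add g continuous_at_imp_continuous_on ballI strong(3)) auto
      show "(u has_vector_derivative (A (u t) + f t (u t))) (at t)" if "t > 0" for t
        by (rule strong(4)[OF that])
    qed
    show "continuous_map (top_of_set {0<..}) (ntop E1) u"
      unfolding E1.continuous_map_into
    proof (intro conjI ballI)
      fix t :: real assume "t \<in> {0<..}"
      then have t: "t > 0" by simp
      show "u t \<in> carr E1" by (rule strong(1)[OF t])
      show "((\<lambda>s. nrm E1 (u s - u t)) \<longlongrightarrow> 0) (at t within {0<..})"
        by (rule tendsto_within_subset[OF strong(2)[OF t]]) simp
    qed
    have at_0: "((\<lambda>s. nrm Y (u s - u 0)) \<longlongrightarrow> 0) (at_right 0)"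
    proof -
      obtain C where C: "C \<ge> 0" "\<And>t. 0 < t \<Longrightarrow> t \<le> 1 \<Longrightarrow>
          u t - T t u0 \<in> carr Y \<and> nrm Y (u t - T t u0) \<le> C * t powr (1 - \<alpha> - \<kappa>)"
        using initial Y.smoothing_target_axioms Y.\<theta>_less_1 by (metis zero_less_one)
      have "((\<lambda>t::real. t powr (1 - \<alpha> - \<kappa>)) \<longlongrightarrow> 0) (at_right 0)"
      proof (rule tendsto_zero_powrI[OF tendsto_ident_at tendsto_const])
        \<comment> \<open>The exponent equals 1 - max \<xi> \<alpha>, so it is positive and u t - T
          t u0 tends to 0 in Y; strong continuity on Y does the rest.\<close>
        show "0 < 1 - \<alpha> - \<kappa>"
          using X.\<theta>_less_1 Y.\<theta>_less_1 by (auto simp: \<kappa>_def)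
      qed (auto simp: eventually_at_filter)
      then have "((\<lambda>t. C * t powr (1 - \<alpha> - \<kappa>)) \<longlongrightarrow> 0) (at_right 0)"
        by (rule tendsto_mult_right_zero)
      from tendsto_add[OF this Y.T_right_cont_X[OF u0]]
      have lim: "((\<lambda>t. C * t powr (1 - \<alpha> - \<kappa>) + nrm Y (T t u0 - u0)) \<longlongrightarrow> 0) (at_right 0)" by simp
      have "\<forall>\<^sub>F t in at_right 0. 0 < t \<and> t < (1::real)"
        using eventually_at_right_real[of 0 "1::real"] by simp
      then have "\<forall>\<^sub>F t in at_right 0. norm (nrm Y (u t - u 0)) \<le> C * t powr (1 - \<alpha> - \<kappa>) + nrm Y (T t u0 - u0)"
      proof eventually_elim
        case (elim t)
        have "nrm Y ((u t - T t u0) + (T t u0 - u0)) \<le> nrm Y (u t - T t u0) + nrm Y (T t u0 - u0)"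
          using C(2)[of t] elim u0 Y.T_in[of t u0] by (intro Y.nrm_triangle) (auto intro: Y.carr_diff)
        then show ?case using C(2)[of t] elim u_0 by simp
      qed
      then show ?thesis using lim by (rule Lim_null_comparison)
    qed
    show "continuous_map (top_of_set {0..}) (ntop Y) u"
      unfolding Y.continuous_map_into
    proof (intro conjI ballI)
      fix t :: real assume t: "t \<in> {0..}"
      show "u t \<in> carr Y" using u_Y[of t] u_0 u0 t by (cases "t = 0") auto
      show "((\<lambda>s. nrm Y (u s - u t)) \<longlongrightarrow> 0) (at t within {0..})"
      proof (cases "t = 0")
        case True
        have "at (0::real) within {0..} = at_right 0" by (rule at_within_Ici_at_right)
        then show ?thesis using True at_0 by simp
      next
        case False
        then have t: "t > 0" using t by simp
        obtain C where C: "C \<ge> 0" "\<forall>x\<in>carr E1. x \<in> carr Y \<and> nrm Y x \<le> C * nrm E1 x"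
          using Y.E1_embed by blast
        have "((\<lambda>s. C * nrm E1 (u s - u t)) \<longlongrightarrow> 0) (at t)"
          by (rule tendsto_mult_right_zero[OF strong(2)[OF t]])
        moreover have "\<forall>\<^sub>F s in at t. s > 0"
          using order_tendstoD(1)[OF tendsto_ident_at t] .
        then have "\<forall>\<^sub>F s in at t. norm (nrm Y (u s - u t)) \<le> C * nrm E1 (u s - u t)"
          by eventually_elim (use C(2) strong(1) t E1.carr_diff in auto)
        ultimately have "((\<lambda>s. nrm Y (u s - u t)) \<longlongrightarrow> 0) (at t)"
          by (rule Lim_null_comparison[rotated])
        then show ?thesis by (rule tendsto_within_subset) simp
      qed
    qed
    show "u 0 = u0" by (rule u_0)
  qed
qed


lemma orbit_bounded_in:
  fixes u :: "real \<Rightarrow> 'e"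
  assumes X: "normed_subspace K sc X"
    and u: "\<forall>t>0. u t \<in> carr X \<and> ((\<lambda>s. nrm X (u s - u t)) \<longlongrightarrow> 0) (at t)" and a: "0 < a"
  shows "\<exists>R>0. \<forall>t\<in>{a..b}. nrm X (u t) \<le> R"
proof -
  interpret X: normed_subspace K sc X by (rule X)
  have "continuous_on {a..b} (\<lambda>t. nrm X (u t))"
  proof (intro continuous_at_imp_continuous_on ballI)
    fix t assume "t \<in> {a..b}"
    then have t: "t > 0" using a by auto
    have "\<forall>\<^sub>F s in at t. s > 0"
      using order_tendstoD(1)[OF tendsto_ident_at t] .
    then have "\<forall>\<^sub>F s in at t. u s \<in> carr X" by eventually_elim (use u in auto)
    then show "isCont (\<lambda>t. nrm X (u t)) t"
      using u t X.nrm_tendsto unfolding isCont_def by blast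
  qed
  then have "bounded ((\<lambda>t. nrm X (u t)) ` {a..b})"
    by (intro compact_imp_bounded compact_continuous_image) simp_all
  then obtain R where "R > 0" "\<forall>t\<in>{a..b}. \<bar>nrm X (u t)\<bar> \<le> R"
    by (auto simp: bounded_pos)
  then show ?thesis by auto
qed

text \<open>In the graph norm the term A (T t x) carries the singularity t^(\<gamma> - 1); the
  bounded term T t x is absorbed since \<tau>^(1 - \<gamma>) t^(\<gamma> - 1) \<ge> 1.\<close>

lemma T_into_E1_from:
  assumes Z: "interpolation_space K sc E1 A T Z \<gamma>" and \<tau>: "\<tau> > 0"
  shows "\<exists>C\<ge>0. \<forall>t x. 0 < t \<and> t \<le> \<tau> \<and> x \<in> carr Z \<longrightarrow> nrm E1 (T t x) \<le> C * t powr (\<gamma> - 1) * nrm Z x"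
proof -
  interpret Z: interpolation_space K sc E1 A T Z \<gamma> by (rule Z)
  obtain C1 where C1: "C1 \<ge> 0" "\<And>x. x \<in> carr E1 \<Longrightarrow> nrm E1 x \<le> C1 * (norm x + norm (A x))"
    "\<And>x. x \<in> carr E1 \<Longrightarrow> norm (A x) \<le> C1 * nrm E1 x" "\<And>x. x \<in> carr E1 \<Longrightarrow> norm x \<le> C1 * nrm E1 x"
    by (rule E1_graph_norm) (rule that)
  obtain M where M: "M \<ge> 1" "\<And>t x. t \<le> \<tau> \<Longrightarrow> norm (T t x) \<le> M * norm x" using T_bound by blast
  obtain C2 where C2: "C2 \<ge> 0" "\<forall>x\<in>carr Z. norm x \<le> C2 * nrm Z x" using Z.embed by blast
  obtain C3 where C3: "C3 \<ge> 0" "\<forall>t x. 0 < t \<and> t \<le> \<tau> \<and> x \<in> carr Z \<longrightarrow> norm (A (T t x)) \<le> C3 * t powr (\<gamma> - 1) * nrm Z x"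
    using Z.AT_from[OF \<tau>] by blast
  define C where "C = C1 * (M * C2 * \<tau> powr (1 - \<gamma>) + C3)"
  have "nrm E1 (T t x) \<le> C * t powr (\<gamma> - 1) * nrm Z x" if t: "0 < t" "t \<le> \<tau>" and x: "x \<in> carr Z" for t x
  proof -
    have "norm (T t x) \<le> M * norm x" by (rule M(2)[OF t(2)])
    also have "\<dots> \<le> M * (C2 * nrm Z x)" using C2(2) x M(1) by (intro mult_left_mono) auto
    also have "\<dots> \<le> M * (C2 * nrm Z x) * (\<tau> powr (1 - \<gamma>) * t powr (\<gamma> - 1))"
    proof -
      have "1 = \<tau> powr (1 - \<gamma>) * \<tau> powr (\<gamma> - 1)" using \<tau> by (simp flip: powr_add)
      also have "\<dots> \<le> \<tau> powr (1 - \<gamma>) * t powr (\<gamma> - 1)"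
        using t Z.\<theta>_less_1 by (intro mult_left_mono powr_mono2') auto
      finally show ?thesis
        using M(1) C2(1) mult_left_mono[of 1 _ "M * (C2 * nrm Z x)"] by simp
    qed
    finally have le: "norm (T t x) \<le> M * C2 * \<tau> powr (1 - \<gamma>) * t powr (\<gamma> - 1) * nrm Z x"
      by (simp add: mult_ac)
    have "nrm E1 (T t x) \<le> C1 * (norm (T t x) + norm (A (T t x)))"
      using T_smooth[OF t(1)] by (rule C1(2))
    also have "\<dots> \<le> C1 * (M * C2 * \<tau> powr (1 - \<gamma>) * t powr (\<gamma> - 1) * nrm Z x + C3 * t powr (\<gamma> - 1) * nrm Z x)"
      using C1(1) C3(2) t x le by (intro mult_left_mono add_mono) auto
    finally show ?thesis by (simp add: C_def algebra_simps)
  qed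
  moreover have "C \<ge> 0" using C1(1) C2(1) C3(1) M(1) by (simp add: C_def)
  ultimately show ?thesis by blast
qed

text \<open>No cancellation between the two values of f is used: each is bounded in Z, and the gain
  \<delta> = \<gamma> comes from the semigroup.\<close>

lemma regular_forcing:
  assumes X: "normed_subspace K sc X" and Z: "interpolation_space K sc E1 A T Z \<gamma>" and \<gamma>: "\<gamma> > 0"
    and growth: "\<And>\<tau>. \<tau> > 0 \<Longrightarrow> \<exists>C\<ge>0. \<forall>t x. 0 \<le> t \<and> t \<le> \<tau> \<and> x \<in> carr X \<longrightarrow> f t x \<in> carr Z \<and> nrm Z (f t x) \<le> C * (1 + nrm X x)"
    and u: "\<forall>t>0. u t \<in> carr X \<and> ((\<lambda>s. nrm X (u s - u t)) \<longlongrightarrow> 0) (at t)"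
    and ab: "0 < a" "a < b"
  shows "\<exists>C\<ge>0. \<exists>\<delta>>0. \<forall>s t. a \<le> s \<and> s < t \<and> t \<le> b \<longrightarrow>
    nrm E1 (T (t - s) (f s (u s) - f t (u t))) \<le> C * (t - s) powr (\<delta> - 1)"
proof -
  interpret Z: interpolation_space K sc E1 A T Z \<gamma> by (rule Z)
  have b: "b > 0" using ab by simp
  obtain R where R: "R > 0" "\<forall>t\<in>{a..b}. nrm X (u t) \<le> R" using orbit_bounded_in[OF X u ab(1)] by blast
  obtain G where G: "G \<ge> 0" "\<forall>t x. 0 \<le> t \<and> t \<le> b \<and> x \<in> carr X \<longrightarrow> f t x \<in> carr Z \<and> nrm Z (f t x) \<le> G * (1 + nrm X x)"
    using growth[OF b] by blast
  obtain C where C: "C \<ge> 0" "\<forall>t x. 0 < t \<and> t \<le> b \<and> x \<in> carr Z \<longrightarrow> nrm E1 (T t x) \<le> C * t powr (\<gamma> - 1) * nrm Z x"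
    using T_into_E1_from[OF Z b] by blast
  have g: "f t (u t) \<in> carr Z" "nrm Z (f t (u t)) \<le> G * (1 + R)" if "t \<in> {a..b}" for t
  proof -
    have *: "f t (u t) \<in> carr Z \<and> nrm Z (f t (u t)) \<le> G * (1 + nrm X (u t))" using G(2) u that ab by auto
    then show "f t (u t) \<in> carr Z" by simp
    have "G * (1 + nrm X (u t)) \<le> G * (1 + R)" using G(1) R(2) that by (intro mult_left_mono) auto
    then show "nrm Z (f t (u t)) \<le> G * (1 + R)" using * by linarith
  qed
  have "nrm E1 (T (t - s) (f s (u s) - f t (u t))) \<le> (C * (2 * (G * (1 + R)))) * (t - s) powr (\<gamma> - 1)"
    if st: "a \<le> s" "s < t" "t \<le> b" for s t
  proof -
    have in_Z: "f s (u s) \<in> carr Z" "f t (u t) \<in> carr Z" using st by (auto intro!: g(1))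
    have "nrm Z (f s (u s) - f t (u t)) \<le> nrm Z (f s (u s)) + nrm Z (f t (u t))"
      by (rule Z.nrm_triangle_diff[OF in_Z])
    also have "\<dots> \<le> 2 * (G * (1 + R))" using g(2)[of s] g(2)[of t] st by auto
    finally have le: "nrm Z (f s (u s) - f t (u t)) \<le> 2 * (G * (1 + R))" .
    have "nrm E1 (T (t - s) (f s (u s) - f t (u t))) \<le> C * (t - s) powr (\<gamma> - 1) * nrm Z (f s (u s) - f t (u t))"
      using C(2) st ab Z.carr_diff[OF in_Z] by auto
    also have "\<dots> \<le> C * (t - s) powr (\<gamma> - 1) * (2 * (G * (1 + R)))"
      using le C(1) by (intro mult_left_mono) auto
    finally show ?thesis by (simp add: mult_ac)
  qed
  moreover have "0 \<le> C * (2 * (G * (1 + R)))" using C(1) G(1) R(1) by auto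
  ultimately show ?thesis using \<gamma> by blast
qed

text \<open>Here the semigroup contributes the full 1/(t - s), and the gain comes from f: Hoelder
  continuity of u with exponent \<nu> = (1 - \<xi>)/2 composed with that of f with exponent \<eta>
  gives \<delta> = \<nu>\<eta>.\<close>

lemma holder_forcing:
  assumes X: "smoothing_target K sc E1 A T X \<xi>" and \<xi>: "\<xi> < 1" and \<eta>: "\<eta> > 0"
    and holder: "\<And>\<tau> R. \<tau> > 0 \<Longrightarrow> R > 0 \<Longrightarrow> \<exists>C>0. \<forall>t\<in>{0..\<tau>}. \<forall>s\<in>{0..\<tau>}. \<forall>x\<in>nball X R. \<forall>y\<in>nball X R.
      norm (f t x - f s y) \<le> C * (\<bar>t - s\<bar> powr \<eta> + nrm X (x - y) powr \<eta>)"
    and sol: "mild_solution K sc E1 A T u (\<lambda>s. f s (u s))"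
    and u: "\<forall>t>0. u t \<in> carr X \<and> ((\<lambda>s. nrm X (u s - u t)) \<longlongrightarrow> 0) (at t)"
    and ab: "0 < a" "a < b"
  shows "\<exists>C\<ge>0. \<exists>\<delta>>0. \<forall>s t. a \<le> s \<and> s < t \<and> t \<le> b \<longrightarrow>
    nrm E1 (T (t - s) (f s (u s) - f t (u t))) \<le> C * (t - s) powr (\<delta> - 1)"
proof -
  interpret X: smoothing_target K sc E1 A T X \<xi> by (rule X)
  interpret E: smoothing_target K sc E1 A T E1 1 by (rule smoothing_target_E1)
  define \<nu> where "\<nu> = (1 - \<xi>) / 2"
  have \<nu>: "0 < \<nu>" "\<nu> \<le> 1" using \<xi> X.\<theta>_nonneg by (auto simp: \<nu>_def)
  have b: "b > 0" using ab by simp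
  obtain R where R: "R > 0" "\<forall>t\<in>{a..b}. nrm X (u t) \<le> R"
    using orbit_bounded_in[OF X.normed_subspace_axioms u ab(1)] by blast
  obtain H where H: "H \<ge> 0" "\<forall>s t. a \<le> s \<and> s < t \<and> t \<le> b \<longrightarrow> nrm X (u t - u s) \<le> H * (t - s) powr \<nu>"
    using mild_solution.holder[OF sol X \<xi> ab] unfolding \<nu>_def by blast
  obtain G where G: "G > 0" "\<forall>t\<in>{0..b}. \<forall>s\<in>{0..b}. \<forall>x\<in>nball X R. \<forall>y\<in>nball X R.
      norm (f t x - f s y) \<le> G * (\<bar>t - s\<bar> powr \<eta> + nrm X (x - y) powr \<eta>)"
    using holder[OF b R(1)] by blast
  obtain C where C: "C \<ge> 0" "\<And>t x. 0 < t \<Longrightarrow> t \<le> b \<Longrightarrow> nrm E1 (T t x) \<le> C * t powr - 1 * norm x"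
    using E.smooth_bound[where \<tau> = b] by blast
  \<comment> \<open>As \<nu> \<le> 1, the direct time dependence of order \<eta> is at least as
    regular as \<nu>\<eta>; lowering its exponent costs b^(\<eta> - \<nu>\<eta>).\<close>
  define B where "B = G * (b powr (\<eta> - \<nu> * \<eta>) + H powr \<eta>)"
  have "nrm E1 (T (t - s) (f s (u s) - f t (u t))) \<le> (C * B) * (t - s) powr (\<nu> * \<eta> - 1)"
    if st: "a \<le> s" "s < t" "t \<le> b" for s t
  proof -
    have ball: "u s \<in> nball X R" "u t \<in> nball X R" using R(2) u st ab by (auto simp: nball_def)
    have "norm (f s (u s) - f t (u t)) \<le> G * (\<bar>s - t\<bar> powr \<eta> + nrm X (u s - u t) powr \<eta>)"
      by (rule G(2)[rule_format]) (use ball st ab in auto)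
    also have "\<dots> \<le> G * (b powr (\<eta> - \<nu> * \<eta>) * (t - s) powr (\<nu> * \<eta>) + H powr \<eta> * (t - s) powr (\<nu> * \<eta>))"
    proof (intro mult_left_mono add_mono)
      have "\<bar>s - t\<bar> powr \<eta> = (t - s) powr (\<eta> - \<nu> * \<eta>) * (t - s) powr (\<nu> * \<eta>)"
        using st by (simp flip: powr_add)
      also have "\<dots> \<le> b powr (\<eta> - \<nu> * \<eta>) * (t - s) powr (\<nu> * \<eta>)"
        using st ab \<eta> \<nu> by (intro mult_right_mono powr_mono2) auto
      finally show "\<bar>s - t\<bar> powr \<eta> \<le> b powr (\<eta> - \<nu> * \<eta>) * (t - s) powr (\<nu> * \<eta>)" .
      have "nrm X (u s - u t) powr \<eta> \<le> (H * (t - s) powr \<nu>) powr \<eta>"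
        using H(2) st \<eta> X.nrm_minus_commute[of "u s"] by (intro powr_mono2) auto
      also have "\<dots> = H powr \<eta> * (t - s) powr (\<nu> * \<eta>)"
        using H(1) by (simp add: powr_mult powr_powr)
      finally show "nrm X (u s - u t) powr \<eta> \<le> H powr \<eta> * (t - s) powr (\<nu> * \<eta>)" .
    qed (use G(1) in simp)
    also have "\<dots> = B * (t - s) powr (\<nu> * \<eta>)" by (simp add: B_def algebra_simps)
    finally have le: "norm (f s (u s) - f t (u t)) \<le> B * (t - s) powr (\<nu> * \<eta>)" .
    have "nrm E1 (T (t - s) (f s (u s) - f t (u t))) \<le> C * (t - s) powr - 1 * norm (f s (u s) - f t (u t))"
      using st ab by (intro C(2)) auto
    also have "\<dots> \<le> C * (t - s) powr - 1 * (B * (t - s) powr (\<nu> * \<eta>))"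
      using C(1) by (intro mult_left_mono le mult_nonneg_nonneg) auto
    also have "\<dots> = (C * B) * ((t - s) powr - 1 * (t - s) powr (\<nu> * \<eta>))" by (simp only: mult_ac)
    also have "(t - s) powr - 1 * (t - s) powr (\<nu> * \<eta>) = (t - s) powr (\<nu> * \<eta> - 1)"
      by (simp only: powr_add[symmetric] add.commute diff_conv_add_uminus)
    finally show ?thesis .
  qed
  moreover have "0 \<le> C * B" using C(1) G(1) by (auto simp: B_def)
  moreover have "0 < \<nu> * \<eta>" using \<nu> \<eta> by simp
  ultimately show ?thesis by blast
qed

end

lemma continuous_map_ntop_euclidean:
  assumes "smoothing_target K sc E1 A T Z \<gamma>" and f: "continuous_map S (ntop Z) f"
  shows "continuous_map S euclidean f"
proof -
  interpret smoothing_target K sc E1 A T Z \<gamma> by (rule assms)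
  have "continuous_map (ntop Z) euclidean (\<lambda>x. x)"
    unfolding continuous_map_atin
  proof
    fix x assume "x \<in> topspace (ntop Z)"
    then have "limitin (ntop Z) (\<lambda>x. x) x (atin (ntop Z) x)"
      using continuous_map_id[of "ntop Z"] unfolding continuous_map_atin id_def by blast
    then show "limitin euclidean (\<lambda>x. x) x (atin (ntop Z) x)"
      using embed_tendsto by (auto simp: limitin_ntop)
  qed
  from continuous_map_compose[OF f this] show ?thesis by (simp add: o_def)
qed

theorem corollary1p4:
  fixes K :: "complex set" and sc :: "complex \<Rightarrow> 'e::banach \<Rightarrow> 'e"
    and E1 :: "'e nspace"
    and F :: "real \<Rightarrow> 'e nspace \<Rightarrow> 'e nspace \<Rightarrow> 'e nspace"
    and E :: "real \<Rightarrow> 'e nspace"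
    and A :: "'e \<Rightarrow> 'e"
    and f :: "real \<Rightarrow> 'e \<Rightarrow> 'e"
    and \<gamma> \<xi> :: real
  assumes "scalar_structure K sc"
    and "banach_subspace K sc E1"
    and "compactly_embedded E1 whole_space" and "dense_in E1 whole_space"
    and "\<And>\<theta>. \<theta> \<in> {0<..<1} \<Longrightarrow> admissible_functor K sc \<theta> (F \<theta>)"
    and "E = interp_space F E1"
    and "generates_analytic_C0_semigroup K sc (carr E1) A"
    and "\<gamma> \<in> {0..<1}" and "\<xi> \<in> {0..<1}"
    and "continuous_map (prod_topology (top_of_set {0..}) (ntop (E \<xi>))) (ntop (E \<gamma>)) (\<lambda>(t, x). f t x)"
    and "\<And>T. T > 0 \<Longrightarrow>
           \<exists>C>0. \<forall>t\<in>{0..T}. \<forall>u\<in>carr (E \<xi>). nrm (E \<gamma>) (f t u) \<le> C * (1 + nrm (E \<xi>) u)"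
  shows
    "(\<gamma> > 0 \<longrightarrow>
       (\<forall>\<alpha> u0. u0 \<in> carr (E \<alpha>) \<and>
          (\<alpha> \<in> {\<xi>..<1} \<or>
           (\<exists>T0>0. condition_H \<gamma> \<xi> (E \<gamma>) (E \<xi>) f T0) \<and> \<alpha> \<in> {0..<min 1 (1 + \<gamma> - \<xi>)}) \<longrightarrow>
          (\<exists>u. global_strong_solution E1 (E \<alpha>) A f u0 u)))
     \<and>
     (\<gamma> = 0 \<and>
      (\<exists>\<eta>0\<in>{0<..<1}. \<forall>T>0. \<forall>R>0. \<exists>C>0.
         \<forall>t\<in>{0..T}. \<forall>s\<in>{0..T}. \<forall>u\<in>nball (E \<xi>) R. \<forall>v\<in>nball (E \<xi>) R.
           norm (f t u - f s v) \<le> C * (\<bar>t - s\<bar> powr \<eta>0 + nrm (E \<xi>) (u - v) powr \<eta>0)) \<longrightarrow>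
       (\<forall>\<alpha> u0. u0 \<in> carr (E \<alpha>) \<and>
          (\<alpha> \<in> {\<xi>..<1} \<or>
           (\<exists>T0>0. condition_H \<gamma> \<xi> (E \<gamma>) (E \<xi>) f T0 \<and> condition_H' (E \<xi>) f T0) \<and>
           \<alpha> \<in> {0..<1 - \<xi>}) \<longrightarrow>
          (\<exists>u. global_strong_solution E1 (E \<alpha>) A f u0 u)))"
proof -
  obtain T where "analytic_generator K sc E1 A T"
    by (rule obtain_analytic_generator[OF assms(1-4,7)])
  then interpret analytic_generator K sc E1 A T .
  have E: "interpolation_space K sc E1 A T (E \<theta>) \<theta>" if "\<theta> \<in> {0..<1}" for \<theta>
    using that interpolation_space_whole interpolation_space_functor[OF assms(5), of \<theta>]
    by (cases "\<theta> = 0") (auto simp: assms(6) interp_space_def)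
  interpret X: interpolation_space K sc E1 A T "E \<xi>" \<xi> by (rule E[OF assms(9)])
  interpret Z: interpolation_space K sc E1 A T "E \<gamma>" \<gamma> by (rule E[OF assms(8)])
  \<comment> \<open>The norm of E \<gamma> is 0 off its carrier, so the growth bound alone does not
    place f t x in E \<gamma>; this membership comes from continuity.\<close>
  have in_Z: "f t x \<in> carr (E \<gamma>)" if "0 \<le> t" "x \<in> carr (E \<xi>)" for t x
    using continuous_map_funspace[OF assms(10)] that
    by (auto simp: Pi_iff X.ntop_eq Z.ntop_eq)
  have growth_Z: "\<exists>C\<ge>0. \<forall>t x. 0 \<le> t \<and> t \<le> \<tau> \<and> x \<in> carr (E \<xi>) \<longrightarrow>
      f t x \<in> carr (E \<gamma>) \<and> nrm (E \<gamma>) (f t x) \<le> C * (1 + nrm (E \<xi>) x)" if \<tau>: "\<tau> > 0" for \<tau>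
  proof -
    obtain C where "C > 0" "\<forall>t\<in>{0..\<tau>}. \<forall>u\<in>carr (E \<xi>). nrm (E \<gamma>) (f t u) \<le> C * (1 + nrm (E \<xi>) u)"
      using assms(11)[OF \<tau>] by blast
    then show ?thesis using in_Z by (intro exI[of _ C]) auto
  qed
  have growth: "\<exists>C\<ge>0. \<forall>t x. 0 \<le> t \<and> t \<le> \<tau> \<and> x \<in> carr (E \<xi>) \<longrightarrow> norm (f t x) \<le> C * (1 + nrm (E \<xi>) x)"
    if \<tau>: "\<tau> > 0" for \<tau>
  proof -
    obtain C where C: "C \<ge> 0" "\<forall>t x. 0 \<le> t \<and> t \<le> \<tau> \<and> x \<in> carr (E \<xi>) \<longrightarrow>
        f t x \<in> carr (E \<gamma>) \<and> nrm (E \<gamma>) (f t x) \<le> C * (1 + nrm (E \<xi>) x)" using growth_Z[OF \<tau>] by blast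
    obtain D where D: "D \<ge> 0" "\<forall>x\<in>carr (E \<gamma>). norm x \<le> D * nrm (E \<gamma>) x" using Z.embed by blast
    have "norm (f t x) \<le> (D * C) * (1 + nrm (E \<xi>) x)" if "0 \<le> t \<and> t \<le> \<tau> \<and> x \<in> carr (E \<xi>)" for t x
    proof -
      have *: "f t x \<in> carr (E \<gamma>)" "nrm (E \<gamma>) (f t x) \<le> C * (1 + nrm (E \<xi>) x)" using C(2) that by blast+
      show ?thesis using D(2)[rule_format, OF *(1)] mult_left_mono[OF *(2) D(1)] by (simp add: mult.assoc)
    qed
    then show ?thesis using C(1) D(1) by (intro exI[of _ "D * C"]) auto
  qed
  have f_cont: "continuous_map (prod_topology (top_of_set {0..}) (ntop (E \<xi>))) euclidean (\<lambda>(t, x). f t x)"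
    by (rule continuous_map_ntop_euclidean[OF Z.smoothing_target_axioms assms(10)])
  note solution = global_solution[OF X.interpolation_space_axioms E _ _ f_cont growth]
  show ?thesis
  proof (intro conjI impI allI; elim conjE)
    fix \<alpha> u0
    assume \<gamma>: "\<gamma> > 0" and u0: "u0 \<in> carr (E \<alpha>)"
      and "\<alpha> \<in> {\<xi>..<1} \<or> (\<exists>T0>0. condition_H \<gamma> \<xi> (E \<gamma>) (E \<xi>) f T0) \<and> \<alpha> \<in> {0..<min 1 (1 + \<gamma> - \<xi>)}"
    \<comment> \<open>Either alternative puts \<alpha> into [0, 1), where E \<alpha> is an
      interpolation space; the position of \<alpha> relative to \<xi> is absorbed by \<kappa> in
      \<open>global_solution\<close>.\<close>
    then have \<alpha>: "\<alpha> \<in> {0..<1}" using assms(9) by auto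
    show "\<exists>u. global_strong_solution E1 (E \<alpha>) A f u0 u"
    proof (rule solution[OF \<alpha>])
      show "\<exists>C\<ge>0. \<exists>\<delta>>0. \<forall>s t. a \<le> s \<and> s < t \<and> t \<le> b \<longrightarrow>
          nrm E1 (T (t - s) (f s (u s) - f t (u t))) \<le> C * (t - s) powr (\<delta> - 1)"
        if "\<forall>t>0. u t \<in> carr (E \<xi>) \<and> ((\<lambda>s. nrm (E \<xi>) (u s - u t)) \<longlongrightarrow> 0) (at t)" "0 < a" "a < b" for u a b
        by (rule regular_forcing[OF X.normed_subspace_axioms Z.interpolation_space_axioms \<gamma> growth_Z that])
    qed (use u0 in auto)
  next
    fix \<alpha> u0
    assume "\<exists>\<eta>0\<in>{0<..<1}. \<forall>T>0. \<forall>R>0. \<exists>C>0.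
         \<forall>t\<in>{0..T}. \<forall>s\<in>{0..T}. \<forall>u\<in>nball (E \<xi>) R. \<forall>v\<in>nball (E \<xi>) R.
           norm (f t u - f s v) \<le> C * (\<bar>t - s\<bar> powr \<eta>0 + nrm (E \<xi>) (u - v) powr \<eta>0)"
    then obtain \<eta> where \<eta>: "\<eta> > 0" and holder: "\<And>\<tau> R. \<tau> > 0 \<Longrightarrow> R > 0 \<Longrightarrow> \<exists>C>0.
         \<forall>t\<in>{0..\<tau>}. \<forall>s\<in>{0..\<tau>}. \<forall>u\<in>nball (E \<xi>) R. \<forall>v\<in>nball (E \<xi>) R.
           norm (f t u - f s v) \<le> C * (\<bar>t - s\<bar> powr \<eta> + nrm (E \<xi>) (u - v) powr \<eta>)"
      by (elim bexE) (simp only: greaterThanLessThan_iff, blast)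
    assume u0: "u0 \<in> carr (E \<alpha>)"
      and "\<alpha> \<in> {\<xi>..<1} \<or> (\<exists>T0>0. condition_H \<gamma> \<xi> (E \<gamma>) (E \<xi>) f T0 \<and> condition_H' (E \<xi>) f T0) \<and> \<alpha> \<in> {0..<1 - \<xi>}"
    then have \<alpha>: "\<alpha> \<in> {0..<1}" using assms(9) by auto
    show "\<exists>u. global_strong_solution E1 (E \<alpha>) A f u0 u"
    proof (rule solution[OF \<alpha>])
      show "\<exists>C\<ge>0. \<exists>\<delta>>0. \<forall>s t. a \<le> s \<and> s < t \<and> t \<le> b \<longrightarrow>
          nrm E1 (T (t - s) (f s (u s) - f t (u t))) \<le> C * (t - s) powr (\<delta> - 1)"
        if "mild_solution K sc E1 A T u (\<lambda>s. f s (u s))"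
          "\<forall>t>0. u t \<in> carr (E \<xi>) \<and> ((\<lambda>s. nrm (E \<xi>) (u s - u t)) \<longlongrightarrow> 0) (at t)" "0 < a" "a < b" for u a b
        by (rule holder_forcing[OF X.smoothing_target_axioms X.\<theta>_less_1 \<eta> holder that])
    qed (use u0 in auto)
  qed
qed

end
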